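(* Let $(u_0,v_0)\in L^2(\Omega)\times L^2(\Omega)$ and $0<T<+\infty$, where the time $T$ depends only on $|u_0|_{L^2(\Omega)}$ and $|v_0|_{L^2(\Omega)}$. Suppose that $f:\mathbb{R}\to\mathbb{R}$ satisfies $|f(s)-f(t)|\le M_1|s-t|$ for all $s,t\in\mathbb{R}$, that $a:\mathbb{R}\to\mathbb{R}$ satisfies $|a(s)-a(t)|\le M_2|s-t|$ for all $s,t\in\mathbb{R}$ and $a(\xi)\ge m>0$ for all $\xi\in\mathbb{R}$, and that $l:L^2(\Omega)\to\mathbb{R}$ is a continuous linear form. Then there is at most one (weak) solution $(u,v)$ of the system $$u_t-a(l(u))\,\Delta u+f(u-v)=\alpha(u-v)\quad\text{in }\Omega\times(0,T),$$ $$v_t-a(l(v))\,\Delta v-f(u-v)=\alpha(v-u)\quad\text{in }\Omega\times(0,T),$$ $$u=v=0\quad\text{on }\partial\Omega\times(0,T),$$ in the space $$\bigl[L^2(0,T;H_0^1(\Omega))\cap C([0,T);L^2(\Omega))\bigr]\times\bigl[L^2(0,T;H_0^1(\Omega))\cap C([0,T);L^2(\Omega))\bigr]$$ with initial data $(u(x,0),v(x,0))=(u_0,v_0)$.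
   Context: $\Omega\subset\mathbb{R}^n$ is a bounded domain with boundary $\partial\Omega$ of class $C^2$; $\alpha>0$, $M_1>0$, $M_2>0$, $m>0$ are constants; $u=u(x,t)$, $v=v(x,t)$ are real valued. $l(u)$ denotes the function $t\mapsto l(u(\cdot,t))$. $(\cdot,\cdot)$ denotes the inner product of $L^2(\Omega)$ and $|\cdot|_{L^2(\Omega)}$ its norm. A (weak) solution on $(0,T)$ is a pair $(u,v)$ in the space displayed in the claim, with $(u_t,v_t)\in L^2(0,T;H^{-1}(\Omega))\times L^2(0,T;H^{-1}(\Omega))$, $u(\cdot,0)=u_0$, $v(\cdot,0)=v_0$, such that for all $h_1,h_2\in H_0^1(\Omega)$, as equalities in $\mathcal{D}'(0,T)$, $$\frac{d}{dt}(u,h_1)+a(l(u))\int_\Omega\nabla u\cdot\nabla h_1\,dx=-\int_\Omega f(u-v)\,h_1\,dx+\int_\Omega\alpha(u-v)\,h_1\,dx,$$ $$\frac{d}{dt}(v,h_2)+a(l(v))\int_\Omega\nabla v\cdot\nabla h_2\,dx=\int_\Omega f(u-v)\,h_2\,dx-\int_\Omega\alpha(u-v)\,h_2\,dx.$$ *)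

theory Defs
  imports "HOL-Analysis.Analysis"
begin

text \<open>
  Elements of function spaces over a set \<open>\<Omega>\<close> are represented by functions on the whole type, only
  their values on \<open>\<Omega>\<close> being relevant.  Two representatives denote the same element iff they agree
  almost everywhere on \<open>\<Omega>\<close>; the norms below are therefore seminorms on representatives.
\<close>

section \<open>Smooth functions, test functions, domains of class \<open>C\<^sup>2\<close>\<close>

definition partial_deriv :: "'a::euclidean_space \<Rightarrow> ('a \<Rightarrow> real) \<Rightarrow> 'a \<Rightarrow> real" where
  "partial_deriv b \<phi> = (\<lambda>x. frechet_derivative \<phi> (at x) b)"

primrec C_k :: "nat \<Rightarrow> ('a::euclidean_space \<Rightarrow> real) \<Rightarrow> bool" where
  "C_k 0 \<phi> \<longleftrightarrow> continuous_on UNIV \<phi>"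
| "C_k (Suc k) \<phi> \<longleftrightarrow>
     (\<forall>x. \<phi> differentiable (at x)) \<and> (\<forall>b\<in>Basis. C_k k (partial_deriv b \<phi>))"

definition test_function :: "'a::euclidean_space set \<Rightarrow> ('a \<Rightarrow> real) \<Rightarrow> bool" where
  "test_function \<Omega> \<phi> \<longleftrightarrow>
     (\<forall>k. C_k k \<phi>) \<and> compact (closure {x. \<phi> x \<noteq> 0}) \<and> closure {x. \<phi> x \<noteq> 0} \<subseteq> \<Omega>"

text \<open>
  Near each boundary point, \<open>\<Omega>\<close> is the set lying strictly above the graph of a \<open>C\<^sup>2\<close> function
  \<open>\<gamma>\<close> over the hyperplane orthogonal to some unit vector \<open>\<nu>\<close>; \<open>\<gamma>\<close> is only evaluated at
  the orthogonal projection \<open>x - (x \<bullet> \<nu>) *\<^sub>R \<nu>\<close> onto that hyperplane.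
\<close>

definition C2_boundary :: "'a::euclidean_space set \<Rightarrow> bool" where
  "C2_boundary \<Omega> \<longleftrightarrow>
     (\<forall>p\<in>frontier \<Omega>. \<exists>r>0. \<exists>\<nu> \<gamma>. norm \<nu> = 1 \<and> C_k 2 \<gamma> \<and>
        \<Omega> \<inter> ball p r = {x \<in> ball p r. \<gamma> (x - (x \<bullet> \<nu>) *\<^sub>R \<nu>) < x \<bullet> \<nu>})"

definition bounded_C2_domain :: "'a::euclidean_space set \<Rightarrow> bool" where
  "bounded_C2_domain \<Omega> \<longleftrightarrow>
     open \<Omega> \<and> connected \<Omega> \<and> \<Omega> \<noteq> {} \<and> bounded \<Omega> \<and> C2_boundary \<Omega>"

section \<open>Lebesgue and Sobolev spaces on \<open>\<Omega>\<close>\<close>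

definition L2 :: "'a::euclidean_space set \<Rightarrow> ('a \<Rightarrow> real) set" where
  "L2 \<Omega> = {g \<in> borel_measurable (lebesgue_on \<Omega>). integrable (lebesgue_on \<Omega>) (\<lambda>x. (g x)\<^sup>2)}"

definition L2_inner :: "'a::euclidean_space set \<Rightarrow> ('a \<Rightarrow> real) \<Rightarrow> ('a \<Rightarrow> real) \<Rightarrow> real" where
  "L2_inner \<Omega> g h = (LINT x|lebesgue_on \<Omega>. g x * h x)"

definition L2_norm :: "'a::euclidean_space set \<Rightarrow> ('a \<Rightarrow> real) \<Rightarrow> real" where
  "L2_norm \<Omega> g = sqrt (L2_inner \<Omega> g g)"

definition weak_gradient :: "'a::euclidean_space set \<Rightarrow> ('a \<Rightarrow> real) \<Rightarrow> ('a \<Rightarrow> 'a) \<Rightarrow> bool" where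
  "weak_gradient \<Omega> g G \<longleftrightarrow>
     (\<forall>b\<in>Basis. (\<lambda>x. G x \<bullet> b) \<in> L2 \<Omega> \<and>
        (\<forall>\<phi>. test_function \<Omega> \<phi> \<longrightarrow>
           (LINT x|lebesgue_on \<Omega>. g x * partial_deriv b \<phi> x) =
           - (LINT x|lebesgue_on \<Omega>. (G x \<bullet> b) * \<phi> x)))"

definition H1 :: "'a::euclidean_space set \<Rightarrow> ('a \<Rightarrow> real) set" where
  "H1 \<Omega> = {g \<in> L2 \<Omega>. \<exists>G. weak_gradient \<Omega> g G}"

text \<open>For \<open>g \<in> H1 \<Omega>\<close> the weak gradient is determined up to null subsets of \<open>\<Omega>\<close>.\<close>

definition grad :: "'a::euclidean_space set \<Rightarrow> ('a \<Rightarrow> real) \<Rightarrow> 'a \<Rightarrow> 'a" where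
  "grad \<Omega> g = (SOME G. weak_gradient \<Omega> g G)"

definition H1_norm :: "'a::euclidean_space set \<Rightarrow> ('a \<Rightarrow> real) \<Rightarrow> real" where
  "H1_norm \<Omega> g =
     sqrt ((L2_norm \<Omega> g)\<^sup>2 + (LINT x|lebesgue_on \<Omega>. (norm (grad \<Omega> g x))\<^sup>2))"

definition H10 :: "'a::euclidean_space set \<Rightarrow> ('a \<Rightarrow> real) set" where
  "H10 \<Omega> = {g \<in> H1 \<Omega>. \<exists>\<phi>. (\<forall>k. test_function \<Omega> (\<phi> k)) \<and>
               (\<lambda>k. H1_norm \<Omega> (\<lambda>x. \<phi> k x - g x)) \<longlonglongrightarrow> 0}"

section \<open>Dual spaces\<close>

text \<open>
  Continuous linear forms on a space \<open>X\<close> of (representatives of) functions with seminorm \<open>N\<close>.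
  Continuity forces the form to take equal values on representatives at distance \<open>0\<close>.
\<close>

definition continuous_linear_form ::
    "('c \<Rightarrow> real) set \<Rightarrow> (('c \<Rightarrow> real) \<Rightarrow> real) \<Rightarrow> (('c \<Rightarrow> real) \<Rightarrow> real) \<Rightarrow> bool" where
  "continuous_linear_form X N F \<longleftrightarrow>
     (\<forall>g\<in>X. \<forall>h\<in>X. F (\<lambda>x. g x + h x) = F g + F h) \<and>
     (\<forall>c. \<forall>g\<in>X. F (\<lambda>x. c * g x) = c * F g) \<and>
     (\<forall>g\<in>X. \<forall>\<epsilon>>0. \<exists>\<delta>>0. \<forall>h\<in>X. N (\<lambda>x. h x - g x) < \<delta> \<longrightarrow> \<bar>F h - F g\<bar> < \<epsilon>)"

definition Hm1 :: "'a::euclidean_space set \<Rightarrow> (('a \<Rightarrow> real) \<Rightarrow> real) set" where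
  "Hm1 \<Omega> = {F. continuous_linear_form (H10 \<Omega>) (H1_norm \<Omega>) F}"

definition Hm1_norm :: "'a::euclidean_space set \<Rightarrow> (('a \<Rightarrow> real) \<Rightarrow> real) \<Rightarrow> real" where
  "Hm1_norm \<Omega> F = (SUP h\<in>{h \<in> H10 \<Omega>. H1_norm \<Omega> h \<le> 1}. \<bar>F h\<bar>)"

section \<open>Spaces of functions of time\<close>

text \<open>
  The Bochner space \<open>L\<^sup>2(0,T;X)\<close>, with strong measurability expressed as almost everywhere
  approximation by \<open>X\<close>-valued simple functions.  Both instances used, \<open>X = H10 \<Omega>\<close> and
  \<open>X = Hm1 \<Omega>\<close>, consist of real-valued functions.
\<close>

definition bochner_L2 ::
    "real \<Rightarrow> ('c \<Rightarrow> real) set \<Rightarrow> (('c \<Rightarrow> real) \<Rightarrow> real) \<Rightarrow> (real \<Rightarrow> 'c \<Rightarrow> real) set" where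
  "bochner_L2 T X N = {u.
     (AE t in lebesgue_on {0<..<T}. u t \<in> X) \<and>
     (\<exists>s. (\<forall>k. simple_function (lebesgue_on {0<..<T}) (s k) \<and> (\<forall>t\<in>{0<..<T}. s k t \<in> X)) \<and>
          (AE t in lebesgue_on {0<..<T}. (\<lambda>k. N (\<lambda>x. s k t x - u t x)) \<longlonglongrightarrow> 0)) \<and>
     integrable (lebesgue_on {0<..<T}) (\<lambda>t. (N (u t))\<^sup>2)}"

definition C_time_L2 :: "real \<Rightarrow> 'a::euclidean_space set \<Rightarrow> (real \<Rightarrow> 'a \<Rightarrow> real) set" where
  "C_time_L2 T \<Omega> = {u. (\<forall>t\<in>{0..<T}. u t \<in> L2 \<Omega>) \<and>
     (\<forall>t\<in>{0..<T}. ((\<lambda>s. L2_norm \<Omega> (\<lambda>x. u s x - u t x)) \<longlongrightarrow> 0) (at t within {0..<T}))}"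

definition solution_space :: "real \<Rightarrow> 'a::euclidean_space set \<Rightarrow> (real \<Rightarrow> 'a \<Rightarrow> real) set" where
  "solution_space T \<Omega> = bochner_L2 T (H10 \<Omega>) (H1_norm \<Omega>) \<inter> C_time_L2 T \<Omega>"

section \<open>Distributions on \<open>(0,T)\<close>\<close>

definition dist_of :: "real \<Rightarrow> (real \<Rightarrow> real) \<Rightarrow> (real \<Rightarrow> real) \<Rightarrow> real" where
  "dist_of T g \<psi> = (LINT t|lebesgue_on {0<..<T}. g t * \<psi> t)"

definition dist_deriv :: "real \<Rightarrow> (real \<Rightarrow> real) \<Rightarrow> (real \<Rightarrow> real) \<Rightarrow> real" where
  "dist_deriv T g \<psi> = - dist_of T g (deriv \<psi>)"

text \<open>
  \<open>w\<close> is the distributional time derivative of \<open>u\<close>, as an \<open>H\<^sup>-\<^sup>1(\<Omega>)\<close>-valued distribution, where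
  \<open>g \<in> L\<^sup>2(\<Omega>)\<close> is identified with the form \<open>h \<mapsto> (g,h)\<close>; the equality in \<open>H\<^sup>-\<^sup>1(\<Omega>)\<close> is
  written out by evaluating both sides at each \<open>h\<close>.
\<close>

definition time_derivative ::
    "real \<Rightarrow> 'a::euclidean_space set \<Rightarrow> (real \<Rightarrow> 'a \<Rightarrow> real) \<Rightarrow> (real \<Rightarrow> ('a \<Rightarrow> real) \<Rightarrow> real) \<Rightarrow> bool"
  where
  "time_derivative T \<Omega> u w \<longleftrightarrow>
     (\<forall>h\<in>H10 \<Omega>. \<forall>\<psi>. test_function {0<..<T} \<psi> \<longrightarrow>
        dist_deriv T (\<lambda>t. L2_inner \<Omega> (u t) h) \<psi> = dist_of T (\<lambda>t. w t h) \<psi>)"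

section \<open>Weak solutions\<close>

definition weak_solution ::
    "'a::euclidean_space set \<Rightarrow> real \<Rightarrow> real \<Rightarrow> (real \<Rightarrow> real) \<Rightarrow> (real \<Rightarrow> real) \<Rightarrow> (('a \<Rightarrow> real) \<Rightarrow> real)
     \<Rightarrow> ('a \<Rightarrow> real) \<Rightarrow> ('a \<Rightarrow> real) \<Rightarrow> (real \<Rightarrow> 'a \<Rightarrow> real) \<Rightarrow> (real \<Rightarrow> 'a \<Rightarrow> real) \<Rightarrow> bool" where
  "weak_solution \<Omega> T \<alpha> f a l u0 v0 u v \<longleftrightarrow>
     u \<in> solution_space T \<Omega> \<and> v \<in> solution_space T \<Omega> \<and>
     (\<exists>w \<in> bochner_L2 T (Hm1 \<Omega>) (Hm1_norm \<Omega>). time_derivative T \<Omega> u w) \<and>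
     (\<exists>w \<in> bochner_L2 T (Hm1 \<Omega>) (Hm1_norm \<Omega>). time_derivative T \<Omega> v w) \<and>
     (AE x in lebesgue_on \<Omega>. u 0 x = u0 x) \<and>
     (AE x in lebesgue_on \<Omega>. v 0 x = v0 x) \<and>
     (\<forall>h1\<in>H10 \<Omega>. \<forall>h2\<in>H10 \<Omega>. \<forall>\<psi>. test_function {0<..<T} \<psi> \<longrightarrow>
        dist_deriv T (\<lambda>t. L2_inner \<Omega> (u t) h1) \<psi>
        + dist_of T (\<lambda>t. a (l (u t)) *
            (LINT x|lebesgue_on \<Omega>. grad \<Omega> (u t) x \<bullet> grad \<Omega> h1 x)) \<psi>
        = dist_of T (\<lambda>t. - (LINT x|lebesgue_on \<Omega>. f (u t x - v t x) * h1 x)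
            + (LINT x|lebesgue_on \<Omega>. \<alpha> * (u t x - v t x) * h1 x)) \<psi> \<and>
        dist_deriv T (\<lambda>t. L2_inner \<Omega> (v t) h2) \<psi>
        + dist_of T (\<lambda>t. a (l (v t)) *
            (LINT x|lebesgue_on \<Omega>. grad \<Omega> (v t) x \<bullet> grad \<Omega> h2 x)) \<psi>
        = dist_of T (\<lambda>t. (LINT x|lebesgue_on \<Omega>. f (u t x - v t x) * h2 x)
            - (LINT x|lebesgue_on \<Omega>. \<alpha> * (u t x - v t x) * h2 x)) \<psi>)"

end

theory Submission
  imports Defs
begin

text \<open>
  Let \<open>(u,v)\<close> and \<open>(u',v')\<close> be two weak solutions with the same initial data, \<open>z = u - u'\<close> and
  \<open>w = v - v'\<close>.  The differences are measured in the dual norm of \<open>H\<^sub>0\<^sup>1\<close>, through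
  \<open>E(g) = sup {(g,h) - |h|\<^sup>2/2 : h \<in> H\<^sub>0\<^sup>1}\<close> with the full \<open>H\<^sup>1\<close> norm \<open>|h|\<close>; this is half the square of
  the dual norm.  Let \<open>h\<close> be a maximizer for \<open>g = z(t)\<close>, that is, the function that represents the form
  \<open>(z(t),\<cdot>)\<close> in the inner product of \<open>H\<^sup>1\<close>.  The same \<open>h\<close> competes in the supremum \<open>E(z(s))\<close>, so
  \<open>E(z(t)) - E(z(s)) \<le> (z(t) - z(s), h)\<close>.  Here \<open>h\<close> does not depend on time, so the weak equations,
  tested with this \<open>h\<close>, write the right-hand side as the integral over \<open>r \<in> (s,t)\<close> of
  \<open>- a(l(u)) (\<nabla>z,\<nabla>h) - (a(l(u)) - a(l(u'))) (\<nabla>u',\<nabla>h)\<close> plus the reaction terms tested with \<open>h\<close>.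

  The representation property of \<open>h\<close> yields
  \<open>(\<nabla>z(r),\<nabla>h) = (z(t),z(r)) - (z(r),h)\<close>, which is close to \<open>|z(r)|\<^sup>2 - (z(r),h)\<close> in \<open>L\<^sup>2\<close> norms when \<open>t - r\<close>
  is small.  Since \<open>a \<ge> m\<close>, the first term therefore dissipates \<open>m |z|\<^sup>2\<close>.  The nonlocal term is at
  most a constant times \<open>|z| |\<nabla>u'| |h|\<close>, and \<open>|h|\<^sup>2\<close> is controlled by \<open>E(z(t))\<close>; Young's inequality
  absorbs \<open>|z|\<close> and \<open>|w|\<close> into the dissipation.  After the two components are added, what is left is
  \<open>Y(t) - Y(s) \<le> (Y(t) + \<epsilon>) \<integral> \<nu>\<close> over \<open>(s,t)\<close> for \<open>Y = E(z) + E(w)\<close>, with \<open>\<epsilon>\<close> small for short intervals and the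
  integrable weight \<open>\<nu> = C (1 + |u'|\<^sup>2 + |v'|\<^sup>2)\<close> in \<open>H\<^sup>1\<close> norms.  As \<open>Y(0) = 0\<close>, Gronwall's argument gives
  \<open>Y = 0\<close>.  At almost every time \<open>z\<close> itself lies in \<open>H\<^sub>0\<^sup>1\<close> and can be used as a competitor, hence
  \<open>z = 0\<close> at these times, and continuity into \<open>L\<^sup>2\<close> covers the remaining ones.

  The formal proof replaces \<open>h\<close> by near maximizers, for which the representation property holds up
  to a small error (\<open>dual_energy_near_maximizer\<close>).  The passage from distributional derivatives in
  time to increments is \<open>distributional_derivative_imp_increment\<close>, the estimate for one component is
  \<open>dual_energy_increment\<close>, and the Gronwall argument is \<open>gronwall_local_increment\<close>.  The \<open>H\<^sup>1\<close> norm is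
  defined by a choice of weak gradient; that it comes from an inner product rests on the uniqueness
  of weak gradients (\<open>weak_gradient_unique\<close>), and that \<open>H\<^sub>0\<^sup>1\<close> is a vector space rests on integration by
  parts for test functions (\<open>weak_gradient_test_function\<close>).
\<close>

section \<open>Smooth functions\<close>

lemma partial_deriv_eqI:
  assumes "(\<phi> has_derivative D) (at x)"
  shows "partial_deriv b \<phi> x = D b"
  unfolding partial_deriv_def using frechet_derivative_at[OF assms] by simp

lemma C_k_SucI:
  assumes "\<And>x. (\<phi> has_derivative D x) (at x)" and "\<And>b. b \<in> Basis \<Longrightarrow> C_k k (\<lambda>x. D x b)"
  shows "C_k (Suc k) \<phi>"
proof -
  have "partial_deriv b \<phi> = (\<lambda>x. D x b)" for b
    using partial_deriv_eqI[OF assms(1)] by (intro ext)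
  then show ?thesis
    using assms by (auto simp: differentiable_def)
qed

lemma C_k_has_derivative:
  assumes "C_k (Suc k) \<phi>"
  shows "(\<phi> has_derivative frechet_derivative \<phi> (at x)) (at x)"
  using assms by (simp add: frechet_derivative_works)

lemma C_k_partial:
  assumes "C_k (Suc k) \<phi>" and "b \<in> Basis"
  shows "C_k k (\<lambda>x. frechet_derivative \<phi> (at x) b)"
  using assms by (simp add: partial_deriv_def)

lemma C_k_continuous: "C_k k \<phi> \<Longrightarrow> continuous_on UNIV \<phi>"
  by (cases k) (auto intro: differentiable_imp_continuous_on simp: differentiable_on_def)

lemma C_k_Suc_imp: "C_k (Suc k) \<phi> \<Longrightarrow> C_k k \<phi>"
proof (induction k arbitrary: \<phi>)
  case 0
  then show ?case using C_k_continuous[of "Suc 0" \<phi>] by simp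
next
  case (Suc k)
  then show ?case by (metis C_k.simps(2))
qed

lemma C_k_const [simp]: "C_k k (\<lambda>x. c)"
proof (induction k arbitrary: c)
  case (Suc k)
  show ?case
    by (rule C_k_SucI[where D = "\<lambda>x h. 0"]) (auto intro: Suc)
qed simp

lemma C_k_add: "C_k k \<phi> \<Longrightarrow> C_k k \<psi> \<Longrightarrow> C_k k (\<lambda>x. \<phi> x + \<psi> x)"
proof (induction k arbitrary: \<phi> \<psi>)
  case 0
  then show ?case by (simp add: continuous_on_add)
next
  case (Suc k)
  show ?case
    by (rule C_k_SucI[OF has_derivative_add[OF C_k_has_derivative[OF Suc.prems(1)] C_k_has_derivative[OF Suc.prems(2)]]])
      (intro Suc.IH C_k_partial Suc.prems)
qed

lemma C_k_mult: "C_k k \<phi> \<Longrightarrow> C_k k \<psi> \<Longrightarrow> C_k k (\<lambda>x. \<phi> x * \<psi> x)"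
proof (induction k arbitrary: \<phi> \<psi>)
  case 0
  then show ?case by (simp add: continuous_on_mult)
next
  case (Suc k)
  show ?case
    by (rule C_k_SucI[OF has_derivative_mult[OF C_k_has_derivative[OF Suc.prems(1)] C_k_has_derivative[OF Suc.prems(2)]]])
      (intro Suc.IH C_k_add C_k_partial Suc.prems C_k_Suc_imp[OF Suc.prems(1)] C_k_Suc_imp[OF Suc.prems(2)])
qed

lemma C_k_prod: "finite I \<Longrightarrow> (\<And>i. i \<in> I \<Longrightarrow> C_k k (\<phi> i)) \<Longrightarrow> C_k k (\<lambda>x. \<Prod>i\<in>I. \<phi> i x)"
  by (induction I rule: finite_induct) (auto intro: C_k_mult)

lemma C_k_inverse:
  assumes "\<And>x. \<phi> x \<noteq> 0"
  shows "C_k k \<phi> \<Longrightarrow> C_k k (\<lambda>x. inverse (\<phi> x))"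
proof (induction k)
  case 0
  then show ?case using assms by (simp add: continuous_on_inverse)
next
  case (Suc k)
  have *: "C_k k (\<lambda>x. - 1 * (inverse (\<phi> x) * frechet_derivative \<phi> (at x) b * inverse (\<phi> x)))"
    if "b \<in> Basis" for b
    using Suc.IH C_k_Suc_imp[OF Suc.prems] C_k_partial[OF Suc.prems that]
    by (intro C_k_mult C_k_const) auto
  show ?case
    by (rule C_k_SucI[OF Deriv.has_derivative_inverse[OF assms C_k_has_derivative[OF Suc.prems]]])
      (use * in simp)
qed

lemma C_k_Suc_real:
  fixes \<phi> :: "real \<Rightarrow> real"
  assumes "\<And>x. (\<phi> has_real_derivative \<phi>' x) (at x)" and "C_k k \<phi>'"
  shows "C_k (Suc k) \<phi>"
  by (rule C_k_SucI[where D = "\<lambda>x h. \<phi>' x * h"])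
    (use assms in \<open>auto simp: has_field_derivative_def\<close>)

lemma C_k_real_deriv:
  fixes \<phi> :: "real \<Rightarrow> real"
  assumes "C_k (Suc k) \<phi>"
  shows "(\<phi> has_real_derivative deriv \<phi> x) (at x)" and "C_k k (deriv \<phi>)"
proof -
  show *: "(\<phi> has_real_derivative deriv \<phi> x) (at x)" for x
    using assms by (simp add: DERIV_deriv_iff_real_differentiable)
  have "partial_deriv 1 \<phi> = deriv \<phi>"
    using partial_deriv_eqI[OF *[unfolded has_field_derivative_def]] by (intro ext) simp
  then show "C_k k (deriv \<phi>)" using assms by auto
qed

lemma C_k_comp_affine:
  fixes \<theta> :: "real \<Rightarrow> real" and e :: "'a::euclidean_space"
  shows "C_k k \<theta> \<Longrightarrow> C_k k (\<lambda>x. \<theta> (x \<bullet> e + d))"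
proof (induction k arbitrary: \<theta>)
  case 0
  then have "continuous_on UNIV \<theta>" by simp
  moreover have "continuous_on UNIV (\<lambda>x. x \<bullet> e + d)" by (intro continuous_intros)
  ultimately show ?case
    by (simp add: continuous_on_compose2[of UNIV \<theta> UNIV "\<lambda>x. x \<bullet> e + d"])
next
  case (Suc k)
  have der: "((\<lambda>x. \<theta> (x \<bullet> e + d)) has_derivative (\<lambda>h. deriv \<theta> (x \<bullet> e + d) * (h \<bullet> e))) (at x)" for x
  proof -
    have "((\<lambda>x. x \<bullet> e + d) has_derivative (\<lambda>h. h \<bullet> e)) (at x)"
      by (auto intro!: derivative_eq_intros)
    from has_derivative_compose[OF this C_k_real_deriv(1)[OF Suc.prems, unfolded has_field_derivative_def]]
    show ?thesis .
  qed
  show ?case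
    by (rule C_k_SucI[OF der]) (rule C_k_mult[OF Suc.IH[OF C_k_real_deriv(2)[OF Suc.prems]] C_k_const])
qed

text \<open>
  The derivatives of \<open>exp (-1/x)\<close>, extended by \<open>0\<close> to \<open>x \<le> 0\<close>, are polynomials in \<open>1/x\<close> times this
  function, so the family indexed by the polynomial is closed under differentiation; smoothness of
  all members then follows by one induction.
\<close>

definition flat_exp :: "real poly \<Rightarrow> real \<Rightarrow> real" where
  "flat_exp P x = (if x \<le> 0 then 0 else poly P (1 / x) * exp (- (1 / x)))"

lemma poly_times_exp_decay: "((\<lambda>y::real. poly P y * exp (- y)) \<longlongrightarrow> 0) at_top"
proof -
  have "((\<lambda>y. \<Sum>i\<le>degree P. coeff P i * (y ^ i / exp y)) \<longlongrightarrow> (\<Sum>i\<le>degree P. coeff P i * 0)) at_top"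
    by (intro tendsto_sum tendsto_mult tendsto_const tendsto_power_div_exp_0)
  then show ?thesis
    by (simp add: poly_altdef exp_minus divide_inverse sum_distrib_right mult.assoc)
qed

lemma flat_exp_has_derivative:
  "(flat_exp P has_real_derivative flat_exp ([:0, 0, 1:] * (P - pderiv P)) x) (at x)"
proof -
  consider "x < 0" | "x > 0" | "x = 0" by linarith
  then show ?thesis
  proof cases
    case 1
    then have "\<forall>\<^sub>F y in nhds x. flat_exp P y = 0"
      using eventually_nhds_in_open[of "{..<0}" x] by (auto elim!: eventually_mono simp: flat_exp_def)
    moreover have "((\<lambda>_. 0) has_real_derivative 0) (at x)" by simp
    ultimately show ?thesis using 1
      by (subst DERIV_cong_ev[OF refl _ refl, where g = "\<lambda>_. 0"]) (auto simp: flat_exp_def)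
  next
    case 2
    have ev: "\<forall>\<^sub>F y in nhds x. flat_exp P y = poly P (1 / y) * exp (- (1 / y))"
      using 2 eventually_nhds_in_open[of "{0<..}" x] by (auto elim!: eventually_mono simp: flat_exp_def)
    have "((\<lambda>y. poly P (1 / y) * exp (- (1 / y))) has_real_derivative
            flat_exp ([:0, 0, 1:] * (P - pderiv P)) x) (at x)"
      using 2
      by (auto intro!: derivative_eq_intros DERIV_chain2[OF poly_DERIV]
          simp: flat_exp_def field_simps power2_eq_square)
    then show ?thesis
      using ev by (subst DERIV_cong_ev[OF refl ev refl])
  next
    case 3
    have "((\<lambda>h. (flat_exp P h - flat_exp P 0) / (h - 0)) \<longlongrightarrow> 0) (at 0)"
      unfolding filterlim_at_split
    proof
      have ev: "\<forall>\<^sub>F h in at_left 0. 0 = (flat_exp P h - flat_exp P 0) / (h - 0)"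
        by (auto simp: eventually_at_filter flat_exp_def)
      show "((\<lambda>h. (flat_exp P h - flat_exp P 0) / (h - 0)) \<longlongrightarrow> 0) (at_left 0)"
        using Lim_transform_eventually[OF tendsto_const ev] by simp
      have "((\<lambda>h. poly (pCons 0 P) (inverse h) * exp (- inverse h)) \<longlongrightarrow> 0) (at_right (0::real))"
        using filterlim_compose[OF poly_times_exp_decay[of "pCons 0 P"] filterlim_inverse_at_top_right] .
      moreover have "\<forall>\<^sub>F h in at_right 0. poly (pCons 0 P) (inverse h) * exp (- inverse h) = 
          (flat_exp P h - flat_exp P 0) / (h - 0)"
        by (auto simp: eventually_at_filter flat_exp_def field_simps)
      ultimately show "((\<lambda>h. (flat_exp P h - flat_exp P 0) / (h - 0)) \<longlongrightarrow> 0) (at_right 0)"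
        by (rule Lim_transform_eventually)
    qed
    then show ?thesis using 3
      by (simp add: has_field_derivative_iff flat_exp_def)
  qed
qed

lemma C_k_flat_exp: "C_k k (flat_exp P)"
proof (induction k arbitrary: P)
  case 0
  show ?case
    using DERIV_isCont[OF flat_exp_has_derivative] by (simp add: continuous_at_imp_continuous_on)
next
  case (Suc k)
  show ?case
    by (rule C_k_Suc_real[OF flat_exp_has_derivative Suc])
qed

text \<open>
  The quotient \<open>\<theta>(x) / (\<theta>(x) + \<theta>(1 - x))\<close> with \<open>\<theta>(x) = exp (-1/x)\<close>.  From this one step function come
  both the approximations of boxes in space and the cutoff functions in time.
\<close>

lemma smooth_step_exists:
  obtains S :: "real \<Rightarrow> real"
  where "\<And>k. C_k k S" "\<And>x. x \<le> 0 \<Longrightarrow> S x = 0" "\<And>x. x \<ge> 1 \<Longrightarrow> S x = 1" "mono S"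
proof -
  define \<theta> where "\<theta> = flat_exp 1"
  define S where "S x = \<theta> x * inverse (\<theta> x + \<theta> (1 - x))" for x
  have nn: "\<theta> x \<ge> 0" for x by (simp add: \<theta>_def flat_exp_def)
  have pos: "\<theta> x > 0" if "x > 0" for x using that by (simp add: \<theta>_def flat_exp_def)
  have zero: "\<theta> x = 0" if "x \<le> 0" for x using that by (simp add: \<theta>_def flat_exp_def)
  have den: "\<theta> x + \<theta> (1 - x) > 0" for x
    using pos[of x] pos[of "1 - x"] nn[of x] nn[of "1 - x"] by (cases "x > 0") (auto intro: add_pos_nonneg add_nonneg_pos)
  have mono\<theta>: "\<theta> x \<le> \<theta> y" if "x \<le> y" for x y
    using that by (auto simp: \<theta>_def flat_exp_def frac_le)
  have "C_k k (\<lambda>x. \<theta> (1 - x))" for k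
    using C_k_comp_affine[of k \<theta> "-1::real" 1] C_k_flat_exp by (simp add: \<theta>_def)
  then have "C_k k S" for k
    using den unfolding S_def
    by (intro C_k_mult C_k_inverse C_k_add) (auto simp: \<theta>_def C_k_flat_exp less_le)
  moreover have "S x = 0" if "x \<le> 0" for x using zero[OF that] by (simp add: S_def)
  moreover have "S x = 1" if "x \<ge> 1" for x
    using that zero[of "1 - x"] pos[of x] by (simp add: S_def)
  moreover have "mono S"
  proof
    fix x y :: real assume "x \<le> y"
    then have "\<theta> x * \<theta> (1 - y) \<le> \<theta> y * \<theta> (1 - x)"
      by (intro mult_mono mono\<theta> nn) auto
    then show "S x \<le> S y"
      using den[of x] den[of y] by (simp add: S_def field_simps)
  qed
  ultimately show ?thesis using that by blast
qed

section \<open>Test functions\<close>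

lemma test_function_eq_0: "test_function \<Omega> \<phi> \<Longrightarrow> x \<notin> \<Omega> \<Longrightarrow> \<phi> x = 0"
  using closure_subset[of "{x. \<phi> x \<noteq> 0}"] by (auto simp: test_function_def)

lemma test_functionI:
  assumes "\<And>k. C_k k \<phi>" and "compact K" and "K \<subseteq> \<Omega>" and "\<And>x. x \<notin> K \<Longrightarrow> \<phi> x = 0"
  shows "test_function \<Omega> \<phi>"
proof -
  have "closure {x. \<phi> x \<noteq> 0} \<subseteq> K"
    using assms by (intro closure_minimal compact_imp_closed) auto
  moreover from this have "compact (closure {x. \<phi> x \<noteq> 0})"
    using \<open>compact K\<close> by (metis closed_closure closed_Int_compact inf.absorb_iff2 inf.commute)
  ultimately show ?thesis
    using assms by (auto simp: test_function_def)
qed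

lemma test_functionE:
  assumes "test_function \<Omega> \<phi>"
  obtains K where "compact K" and "K \<subseteq> \<Omega>" and "\<And>x. x \<notin> K \<Longrightarrow> \<phi> x = 0"
proof (rule that)
  show "compact (closure {x. \<phi> x \<noteq> 0})" "closure {x. \<phi> x \<noteq> 0} \<subseteq> \<Omega>"
    using assms unfolding test_function_def by blast+
  show "\<phi> x = 0" if "x \<notin> closure {x. \<phi> x \<noteq> 0}" for x
  proof (rule ccontr)
    assume "\<phi> x \<noteq> 0"
    then have "x \<in> closure {x. \<phi> x \<noteq> 0}" by (intro subsetD[OF closure_subset]) simp
    then show False using that by contradiction
  qed
qed

lemma test_function_has_derivative:
  assumes "test_function \<Omega> \<phi>"
  shows "(\<phi> has_derivative frechet_derivative \<phi> (at x)) (at x)"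
  using C_k_has_derivative[of 0] assms unfolding test_function_def by blast

lemma test_function_add:
  assumes "test_function \<Omega> \<phi>" and "test_function \<Omega> \<psi>"
  shows "test_function \<Omega> (\<lambda>x. \<phi> x + \<psi> x)"
proof -
  obtain K where "compact K" "K \<subseteq> \<Omega>" "\<And>x. x \<notin> K \<Longrightarrow> \<phi> x = 0" using test_functionE[OF assms(1)] by metis
  moreover obtain L where "compact L" "L \<subseteq> \<Omega>" "\<And>x. x \<notin> L \<Longrightarrow> \<psi> x = 0" using test_functionE[OF assms(2)] by metis
  ultimately show ?thesis
    using assms by (intro test_functionI[where K = "K \<union> L"] C_k_add) (auto simp: test_function_def)
qed

lemma test_function_mult_smooth:
  assumes "test_function \<Omega> \<phi>" and "\<And>k. C_k k \<psi>"
  shows "test_function \<Omega> (\<lambda>x. \<psi> x * \<phi> x)"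
proof -
  obtain K where "compact K" "K \<subseteq> \<Omega>" "\<And>x. x \<notin> K \<Longrightarrow> \<phi> x = 0" using test_functionE[OF assms(1)] by metis
  then show ?thesis
    using assms by (intro test_functionI[where K = K] C_k_mult) (auto simp: test_function_def)
qed

lemma test_function_partial:
  assumes "test_function \<Omega> \<phi>" and "b \<in> Basis"
  shows "test_function \<Omega> (partial_deriv b \<phi>)"
proof (rule test_functionI)
  show "C_k k (partial_deriv b \<phi>)" for k
    using assms C_k.simps(2)[of k \<phi>] unfolding test_function_def by blast
  let ?K = "closure {x. \<phi> x \<noteq> 0}"
  show "compact ?K" "?K \<subseteq> \<Omega>" using assms by (auto simp: test_function_def)
  fix x assume x: "x \<notin> ?K"
  have "(\<phi> has_derivative (\<lambda>_. 0)) (at x)"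
  proof (rule has_derivative_transform_within_open[where f = "\<lambda>_. 0" and s = "- ?K"])
    show "0 = \<phi> y" if "y \<in> - ?K" for y
      using that subsetD[OF closure_subset, of y "{x. \<phi> x \<noteq> 0}"] by auto
  qed (use x in \<open>simp_all add: open_Compl\<close>)
  then show "partial_deriv b \<phi> x = 0"
    by (rule partial_deriv_eqI)
qed

lemma test_function_continuous: "test_function \<Omega> \<phi> \<Longrightarrow> continuous_on A \<phi>"
  using C_k_continuous[of 0 \<phi>] continuous_on_subset by (auto simp: test_function_def)

lemma test_function_bounded:
  assumes "test_function \<Omega> \<phi>"
  obtains B where "\<And>x. \<bar>\<phi> x\<bar> \<le> B"
proof -
  obtain K where K: "compact K" "\<And>x. x \<notin> K \<Longrightarrow> \<phi> x = 0" using test_functionE[OF assms] by metis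
  then have "bounded (\<phi> ` K)"
    using assms by (intro compact_imp_bounded compact_continuous_image test_function_continuous)
  then obtain B where "\<And>x. x \<in> K \<Longrightarrow> \<bar>\<phi> x\<bar> \<le> B" by (auto simp: bounded_iff)
  then have "\<bar>\<phi> x\<bar> \<le> max B 0" for x using K by (cases "x \<in> K") (auto simp: le_max_iff_disj)
  then show ?thesis using that by blast
qed

lemma test_function_integrable_lborel:
  assumes "test_function \<Omega> \<phi>"
  shows "integrable lborel \<phi>"
proof -
  obtain K where K: "compact K" "\<And>x. x \<notin> K \<Longrightarrow> \<phi> x = 0" using test_functionE[OF assms] by metis
  have "integrable lborel (\<lambda>x. indicator K x *\<^sub>R \<phi> x)"
    using borel_integrable_compact[OF K(1) test_function_continuous[OF assms]] .
  moreover have "(\<lambda>x. indicator K x *\<^sub>R \<phi> x) = \<phi>"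
    using K(2) by (auto simp: indicator_def fun_eq_iff)
  ultimately show ?thesis by simp
qed

lemma test_function_derivative_along_line:
  assumes "test_function \<Omega> \<phi>"
  shows "((\<lambda>t. \<phi> (x + t *\<^sub>R b)) has_real_derivative partial_deriv b \<phi> (x + t *\<^sub>R b)) (at t)"
proof -
  have "((\<lambda>t. x + t *\<^sub>R b) has_derivative (\<lambda>t. t *\<^sub>R b)) (at t)"
    by (auto intro!: derivative_eq_intros)
  from has_derivative_compose[OF this test_function_has_derivative[OF assms]]
  have *: "((\<lambda>t. \<phi> (x + t *\<^sub>R b)) has_derivative (\<lambda>s. frechet_derivative \<phi> (at (x + t *\<^sub>R b)) (s *\<^sub>R b))) (at t)" .
  have "linear (frechet_derivative \<phi> (at (x + t *\<^sub>R b)))"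
    using test_function_has_derivative[OF assms] has_derivative_linear by blast
  then show ?thesis
    using * by (simp add: has_field_derivative_def partial_deriv_def linear_scale mult.commute[of _ "frechet_derivative _ _ _"])
qed

text \<open>
  The integral of every difference quotient vanishes by translation invariance, and the quotients
  converge boundedly, with supports in a fixed ball, to the partial derivative.
\<close>

lemma integral_partial_deriv_test_function:
  fixes \<phi> :: "'a::euclidean_space \<Rightarrow> real"
  assumes \<phi>: "test_function \<Omega> \<phi>" and b: "b \<in> Basis"
  shows "(\<integral>x. partial_deriv b \<phi> x \<partial>lborel) = 0"
proof -
  obtain B where B: "\<And>x. \<bar>partial_deriv b \<phi> x\<bar> \<le> B"
    using test_function_bounded[OF test_function_partial[OF assms]] by metis
  obtain K where K: "compact K" "\<And>x. x \<notin> K \<Longrightarrow> \<phi> x = 0" using test_functionE[OF \<phi>] by metis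
  obtain R where R: "\<And>x. x \<in> K \<Longrightarrow> norm x \<le> R"
    using compact_imp_bounded[OF K(1)] by (auto simp: bounded_iff)
  define q where "q n x = (\<phi> (x + inverse (real (Suc n)) *\<^sub>R b) - \<phi> x) / inverse (real (Suc n))" for n x
  have int: "integrable lborel \<phi>" by (rule test_function_integrable_lborel[OF \<phi>])
  have shift: "integrable lborel (\<lambda>x. \<phi> (x + c))" "(\<integral>x. \<phi> (x + c) \<partial>lborel) = (\<integral>x. \<phi> x \<partial>lborel)" for c
  proof -
    have *: "lborel = distr lborel borel ((+) c :: 'a \<Rightarrow> 'a)" by (rule lborel_distr_plus[symmetric])
    have m: "\<phi> \<in> borel_measurable borel" using int by auto
    show "integrable lborel (\<lambda>x. \<phi> (x + c))"
      using int integrable_distr_eq[of "(+) c" lborel borel \<phi>] m by (subst (asm) *) (simp add: add.commute)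
    show "(\<integral>x. \<phi> (x + c) \<partial>lborel) = (\<integral>x. \<phi> x \<partial>lborel)"
      using integral_distr[of "(+) c" lborel borel \<phi>] m by (subst (2) *) (simp add: add.commute)
  qed
  have q0: "(\<integral>x. q n x \<partial>lborel) = 0" for n
    unfolding q_def using shift int by simp
  have lim: "(\<lambda>n. q n x) \<longlonglongrightarrow> partial_deriv b \<phi> x" for x
  proof -
    have "((\<lambda>h. (\<phi> (x + h *\<^sub>R b) - \<phi> x) / h) \<longlongrightarrow> partial_deriv b \<phi> x) (at 0)"
      using test_function_derivative_along_line[OF \<phi>, of x b 0] by (simp add: has_field_derivative_iff)
    moreover have "filterlim (\<lambda>n. inverse (real (Suc n))) (at 0) sequentially"
      using LIMSEQ_inverse_real_of_nat by (auto simp: filterlim_at)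
    ultimately show ?thesis
      unfolding q_def by (rule filterlim_compose)
  qed
  have bd: "norm (q n x) \<le> B * indicator (cball 0 (R + 1)) x" for n x
  proof (cases "x \<in> cball 0 (R + 1)")
    case True
    define t where "t = inverse (real (Suc n))"
    have "t > 0" by (simp add: t_def)
    obtain z where "\<phi> (x + t *\<^sub>R b) - \<phi> (x + 0 *\<^sub>R b) = (t - 0) * partial_deriv b \<phi> (x + z *\<^sub>R b)"
      using MVT2[OF \<open>t > 0\<close> test_function_derivative_along_line[OF \<phi>, of x b]] by blast
    then have "q n x = partial_deriv b \<phi> (x + z *\<^sub>R b)"
      unfolding q_def t_def[symmetric] using \<open>t > 0\<close> by simp
    then show ?thesis using True B by simp
  next
    case False
    have n1: "norm (inverse (real (Suc n)) *\<^sub>R b) \<le> 1"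
      using b by (simp add: divide_simps)
    have "norm x > R + 1" using False by simp
    moreover have "norm (x + inverse (real (Suc n)) *\<^sub>R b) \<ge> norm x - 1"
      using norm_triangle_ineq4[of "x + inverse (real (Suc n)) *\<^sub>R b" "inverse (real (Suc n)) *\<^sub>R b"] n1
      by simp
    ultimately have "x \<notin> K" "x + inverse (real (Suc n)) *\<^sub>R b \<notin> K" using R by fastforce+
    then show ?thesis using K(2) False by (simp add: q_def)
  qed
  have "(\<lambda>n. \<integral>x. q n x \<partial>lborel) \<longlonglongrightarrow> (\<integral>x. partial_deriv b \<phi> x \<partial>lborel)"
  proof (rule integral_dominated_convergence[where w = "\<lambda>x. B * indicator (cball 0 (R + 1)) x"])
    show "partial_deriv b \<phi> \<in> borel_measurable lborel"
      using test_function_integrable_lborel[OF test_function_partial[OF assms]] by auto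
    show "q n \<in> borel_measurable lborel" for n
      unfolding q_def using shift(1) int by (intro borel_measurable_divide borel_measurable_diff borel_measurable_const) auto
    show "integrable lborel (\<lambda>x. B * indicator (cball 0 (R + 1)) x :: real)"
      using emeasure_bounded_finite[OF bounded_cball] by (intro integrable_mult_right integrable_real_indicator) auto
  qed (use lim bd in auto)
  then show ?thesis
    by (simp add: q0 LIMSEQ_const_iff)
qed

section \<open>The fundamental lemma of the calculus of variations\<close>

lemma box_indicator_approximation:
  fixes a b :: "'a::euclidean_space"
  assumes "cbox a b \<subseteq> \<Omega>"
  obtains \<phi> where "\<And>k. test_function \<Omega> (\<phi> k)" and "\<And>k x. \<phi> k x \<in> {0..1}"
    and "\<And>x. (\<lambda>k. \<phi> k x) \<longlonglongrightarrow> indicator (box a b) x"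
proof -
  obtain S :: "real \<Rightarrow> real" where S: "\<And>k. C_k k S" "\<And>x. x \<le> 0 \<Longrightarrow> S x = 0"
    "\<And>x. x \<ge> 1 \<Longrightarrow> S x = 1" "mono S"
    using smooth_step_exists by blast
  have S01: "S x \<in> {0..1}" for x
    using monoD[OF S(4), of "min x 0" x] monoD[OF S(4), of x "max x 1"] S(2)[of "min x 0"] S(3)[of "max x 1"]
    by auto
  define \<phi> where "\<phi> k x = (\<Prod>e\<in>Basis. S (real k * (x \<bullet> e - a \<bullet> e)) * S (real k * (b \<bullet> e - x \<bullet> e)))"
    for k and x :: 'a
  have sm: "C_k j (\<phi> k)" for j k
  proof -
    have "C_k j (\<lambda>x. S (real k * (x \<bullet> e - a \<bullet> e)))" "C_k j (\<lambda>x. S (real k * (b \<bullet> e - x \<bullet> e)))" for e :: 'a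
      using C_k_comp_affine[of j S "real k *\<^sub>R e" "- real k * (a \<bullet> e)"]
        C_k_comp_affine[of j S "- real k *\<^sub>R e" "real k * (b \<bullet> e)"] S(1)
      by (simp_all add: algebra_simps)
    then show ?thesis
      unfolding \<phi>_def by (intro C_k_prod C_k_mult) auto
  qed
  have zero: "\<phi> k x = 0" if "x \<notin> box a b" for k x
  proof -
    obtain e where e: "e \<in> Basis" "x \<bullet> e \<le> a \<bullet> e \<or> b \<bullet> e \<le> x \<bullet> e"
      using \<open>x \<notin> box a b\<close> by (auto simp: mem_box not_less)
    then have "S (real k * (x \<bullet> e - a \<bullet> e)) * S (real k * (b \<bullet> e - x \<bullet> e)) = 0"
      by (auto intro!: S(2) mult_nonneg_nonpos)
    then show ?thesis
      using e(1) unfolding \<phi>_def by (intro prod_zero) auto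
  qed
  have "test_function \<Omega> (\<phi> k)" for k
  proof (rule test_functionI[OF sm compact_cbox assms])
    show "\<phi> k x = 0" if "x \<notin> cbox a b" for x
      using that zero box_subset_cbox[of a b] by blast
  qed
  moreover have "\<phi> k x \<in> {0..1}" for k x
    using S01 unfolding \<phi>_def by (auto intro!: prod_nonneg prod_le_1 mult_nonneg_nonneg mult_le_one)
  moreover have "(\<lambda>k. \<phi> k x) \<longlonglongrightarrow> indicator (box a b) x" for x
  proof (cases "x \<in> box a b")
    case True
    have step: "\<forall>\<^sub>F k in sequentially. S (real k * d) = 1" if "d > 0" for d
    proof -
      obtain n :: nat where n: "1 / d < real n" using reals_Archimedean2 by blast
      have "S (real k * d) = 1" if "k \<ge> n" for k
      proof (rule S(3))
        have "1 \<le> real n * d" using n \<open>d > 0\<close> by (simp add: field_simps)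
        also have "\<dots> \<le> real k * d" using that \<open>d > 0\<close> by simp
        finally show "1 \<le> real k * d" .
      qed
      then show ?thesis by (auto simp: eventually_sequentially)
    qed
    have "\<forall>\<^sub>F k in sequentially. \<forall>e\<in>Basis. S (real k * (x \<bullet> e - a \<bullet> e)) = 1 \<and> S (real k * (b \<bullet> e - x \<bullet> e)) = 1"
      using True by (intro eventually_ball_finite ballI eventually_conj step) (auto simp: mem_box)
    then have "\<forall>\<^sub>F k in sequentially. 1 = \<phi> k x"
      by eventually_elim (simp add: \<phi>_def)
    then have "(\<lambda>k. \<phi> k x) \<longlonglongrightarrow> 1"
      by (rule Lim_transform_eventually[OF tendsto_const])
    then show ?thesis using True by simp
  next
    case False
    then show ?thesis using zero by simp
  qed
  ultimately show ?thesis using that by blast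
qed

text \<open>
  Test functions approximate indicators of boxes, so the integral of \<open>d\<close> over every box inside \<open>\<Omega>\<close>
  vanishes; \<open>d\<close> is almost everywhere the limit of its means over small cubes.
\<close>

lemma zero_if_orthogonal_to_test_functions:
  fixes d :: "'a::euclidean_space \<Rightarrow> real"
  assumes \<Omega>: "open \<Omega>" and d: "integrable (lebesgue_on \<Omega>) d"
    and zero: "\<And>\<phi>. test_function \<Omega> \<phi> \<Longrightarrow> (LINT x|lebesgue_on \<Omega>. d x * \<phi> x) = 0"
  shows "AE x in lebesgue_on \<Omega>. d x = 0"
proof -
  have \<Omega>m: "\<Omega> \<in> sets lebesgue" using \<Omega> by auto
  define f where "f x = (if x \<in> \<Omega> then d x else 0)" for x
  have f: "integrable lebesgue f"
    using d \<Omega>m unfolding f_def by (simp add: Lebesgue_Measure.integrable_restrict_UNIV)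
  have fi: "f integrable_on cbox a b" for a b
    using integrable_on_lebesgue[OF f] integrable_on_subcbox by blast
  obtain N where N: "negligible N" and
    lim: "\<And>x e. x \<notin> N \<Longrightarrow> 0 < e \<Longrightarrow> \<exists>\<delta>>0. \<forall>h. 0 < h \<and> h < \<delta> \<longrightarrow>
        norm (integral (cbox x (x + h *\<^sub>R One)) f /\<^sub>R h ^ DIM('a) - f x) < e"
    using integrable_ccontinuous_explicit[of f] fi by metis
  have box0: "integral (cbox a b) f = 0" if ab: "cbox a b \<subseteq> \<Omega>" for a b
  proof -
    obtain \<phi> where \<phi>: "\<And>k. test_function \<Omega> (\<phi> k)" "\<And>k x. \<phi> k x \<in> {0..1}"
      "\<And>x. (\<lambda>k. \<phi> k x) \<longlonglongrightarrow> indicator (box a b) x"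
      using box_indicator_approximation[OF ab] by metis
    have m: "\<phi> k \<in> borel_measurable (lebesgue_on \<Omega>)" for k
      using \<Omega>m test_function_continuous[OF \<phi>(1)] by (intro continuous_imp_measurable_on_sets_lebesgue)
    have "(\<lambda>k. LINT x|lebesgue_on \<Omega>. d x * \<phi> k x) \<longlonglongrightarrow> (LINT x|lebesgue_on \<Omega>. d x * indicator (box a b) x)"
    proof (rule integral_dominated_convergence[where w = "\<lambda>x. \<bar>d x\<bar>"])
      show "(\<lambda>x. d x * indicator (box a b) x) \<in> borel_measurable (lebesgue_on \<Omega>)"
        using borel_measurable_integrable[OF d] \<Omega>m
        by (intro borel_measurable_times borel_measurable_indicator)
          (use ab box_subset_cbox[of a b] in \<open>auto simp: sets_restrict_space_iff\<close>)
      show "AE x in lebesgue_on \<Omega>. norm (d x * \<phi> k x) \<le> \<bar>d x\<bar>" for k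
        using \<phi>(2)[of k] by (auto simp: abs_mult intro!: mult_left_le)
    qed (use d m \<phi>(3) in \<open>auto intro!: tendsto_intros\<close>)
    then have "0 = (LINT x|lebesgue_on \<Omega>. d x * indicator (box a b) x)"
      by (simp add: zero[OF \<phi>(1)] LIMSEQ_const_iff)
    also have "\<dots> = (LINT x|lebesgue_on (box a b). f x)"
    proof -
      have "box a b \<subseteq> \<Omega>" using ab box_subset_cbox by blast
      then have "(\<lambda>x. if x \<in> \<Omega> then d x * indicator (box a b) x else 0) = (\<lambda>x. if x \<in> box a b then f x else 0)"
        by (auto simp: indicator_def f_def fun_eq_iff)
      then show ?thesis
        using \<Omega>m Lebesgue_Measure.integral_restrict_UNIV[of \<Omega> "\<lambda>x. d x * indicator (box a b) x"]
          Lebesgue_Measure.integral_restrict_UNIV[of "box a b" f] by simp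
    qed
    also have "\<dots> = integral (box a b) f"
    proof (rule lebesgue_integral_eq_integral)
      have "integrable lebesgue (\<lambda>x. indicator (box a b) x *\<^sub>R f x)"
        using f by (intro integrable_mult_indicator) auto
      then show "integrable (lebesgue_on (box a b)) f"
        by (simp add: integrable_restrict_space)
    qed auto
    finally show ?thesis by (simp add: integral_open_interval)
  qed
  have "f x = 0" if "x \<in> \<Omega>" "x \<notin> N" for x
  proof -
    obtain r where r: "r > 0" "cball x r \<subseteq> \<Omega>" using \<Omega> \<open>x \<in> \<Omega>\<close> open_contains_cball by metis
    have "norm (f x) < e" if "e > 0" for e
    proof -
      obtain \<delta> where \<delta>: "\<delta> > 0" "\<And>h. 0 < h \<Longrightarrow> h < \<delta> \<Longrightarrow>
          norm (integral (cbox x (x + h *\<^sub>R One)) f /\<^sub>R h ^ DIM('a) - f x) < e"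
        using lim[OF \<open>x \<notin> N\<close> \<open>e > 0\<close>] by blast
      define h where "h = min (\<delta> / 2) (r / DIM('a))"
      have h: "0 < h" "h < \<delta>" "h * DIM('a) \<le> r"
        using \<delta>(1) r(1) by (auto simp: h_def min_def field_simps)
      have "cbox x (x + h *\<^sub>R One) \<subseteq> cball x r"
      proof
        fix y assume y: "y \<in> cbox x (x + h *\<^sub>R One)"
        have "norm (y - x) \<le> (\<Sum>e\<in>Basis. \<bar>(y - x) \<bullet> e\<bar>)" by (rule norm_le_l1)
        also have "\<dots> \<le> (\<Sum>e\<in>(Basis::'a set). h)"
          using y by (intro sum_mono) (auto simp: mem_box inner_diff_left inner_add_left)
        finally show "y \<in> cball x r" using h(3) by (simp add: dist_norm norm_minus_commute mult.commute)
      qed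
      then show ?thesis using \<delta>(2)[OF h(1,2)] box0[of x "x + h *\<^sub>R One"] r(2) by simp
    qed
    then show ?thesis by (metis less_irrefl norm_eq_zero zero_less_norm_iff)
  qed
  then have "{x \<in> \<Omega>. d x \<noteq> 0} \<subseteq> N" by (auto simp: f_def)
  then have "negligible {x \<in> \<Omega>. d x \<noteq> 0}" using N negligible_subset by blast
  then have "{x \<in> \<Omega>. d x \<noteq> 0} \<in> null_sets (lebesgue_on \<Omega>)"
    using \<Omega>m by (auto simp: negligible_iff_null_sets null_sets_restrict_space)
  then show ?thesis
    by (rule AE_I') auto
qed

section \<open>Square integrable functions\<close>

text \<open>
  The discriminant inequality behind the Cauchy-Schwarz inequalities for \<open>L\<^sup>2\<close>, for the Dirichlet form
  and for \<open>H\<^sup>1\<close>, and behind the estimates for near maximizers of the dual energy.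
\<close>

lemma quadratic_form_cauchy_schwarz:
  fixes A B C :: real
  assumes pos: "\<And>c. 0 \<le> A + 2 * c * B + c\<^sup>2 * C" and C: "0 \<le> C"
  shows "B\<^sup>2 \<le> A * C"
proof (cases "C = 0")
  case True
  have "B = 0"
  proof (rule ccontr)
    assume "B \<noteq> 0"
    then have "2 * (- (\<bar>A\<bar> + 1) / (2 * B)) * B = - (\<bar>A\<bar> + 1)" by simp
    then show False
      using pos[of "- (\<bar>A\<bar> + 1) / (2 * B)"] True by simp
  qed
  then show ?thesis using True by simp
next
  case False
  then have "0 \<le> C * (A + 2 * (- B / C) * B + (- B / C)\<^sup>2 * C)"
    using C by (intro mult_nonneg_nonneg pos)
  also have "\<dots> = A * C - B\<^sup>2"
    using False by (simp add: field_simps power2_eq_square)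
  finally show ?thesis by simp
qed

lemma L2_measurable: "g \<in> L2 \<Omega> \<Longrightarrow> g \<in> borel_measurable (lebesgue_on \<Omega>)"
  by (simp add: L2_def)

lemma L2_square_integrable: "g \<in> L2 \<Omega> \<Longrightarrow> integrable (lebesgue_on \<Omega>) (\<lambda>x. (g x)\<^sup>2)"
  by (simp add: L2_def)

lemma L2_mult_integrable:
  assumes "g \<in> L2 \<Omega>" and "h \<in> L2 \<Omega>"
  shows "integrable (lebesgue_on \<Omega>) (\<lambda>x. g x * h x)"
proof (rule Bochner_Integration.integrable_bound)
  show "integrable (lebesgue_on \<Omega>) (\<lambda>x. (g x)\<^sup>2 + (h x)\<^sup>2)"
    using assms by (intro Bochner_Integration.integrable_add L2_square_integrable)
  show "(\<lambda>x. g x * h x) \<in> borel_measurable (lebesgue_on \<Omega>)"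
    using assms by (intro borel_measurable_times L2_measurable)
  have "\<bar>a * b\<bar> \<le> a\<^sup>2 + b\<^sup>2" for a b :: real
    using sum_squares_bound[of "\<bar>a\<bar>" "\<bar>b\<bar>"] mult_nonneg_nonneg[OF abs_ge_zero[of a] abs_ge_zero[of b]]
    unfolding abs_mult power2_abs by linarith
  then show "AE x in lebesgue_on \<Omega>. norm (g x * h x) \<le> norm ((g x)\<^sup>2 + (h x)\<^sup>2)"
    by simp
qed

lemma L2_bound:
  assumes "g \<in> borel_measurable (lebesgue_on \<Omega>)" and "h \<in> L2 \<Omega>"
    and "AE x in lebesgue_on \<Omega>. \<bar>g x\<bar> \<le> \<bar>h x\<bar>"
  shows "g \<in> L2 \<Omega>"
proof -
  have "integrable (lebesgue_on \<Omega>) (\<lambda>x. (g x)\<^sup>2)"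
    using L2_square_integrable[OF assms(2)]
  proof (rule Bochner_Integration.integrable_bound)
    show "(\<lambda>x. (g x)\<^sup>2) \<in> borel_measurable (lebesgue_on \<Omega>)" using assms(1) by measurable
    show "AE x in lebesgue_on \<Omega>. norm ((g x)\<^sup>2) \<le> norm ((h x)\<^sup>2)"
      using assms(3) by eventually_elim (simp add: abs_le_square_iff)
  qed
  then show ?thesis using assms(1) by (simp add: L2_def)
qed

lemma L2_lincomb:
  assumes g: "g \<in> L2 \<Omega>" and h: "h \<in> L2 \<Omega>"
  shows "(\<lambda>x. g x + c * h x) \<in> L2 \<Omega>"
proof -
  have "integrable (lebesgue_on \<Omega>) (\<lambda>x. (g x)\<^sup>2 + 2 * c * (g x * h x) + c\<^sup>2 * (h x)\<^sup>2)"
    using assms by (intro Bochner_Integration.integrable_add integrable_mult_right L2_square_integrable L2_mult_integrable)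
  moreover have "(\<lambda>x. (g x)\<^sup>2 + 2 * c * (g x * h x) + c\<^sup>2 * (h x)\<^sup>2) = (\<lambda>x. (g x + c * h x)\<^sup>2)"
    by (auto simp: power2_eq_square algebra_simps)
  moreover have "(\<lambda>x. g x + c * h x) \<in> borel_measurable (lebesgue_on \<Omega>)"
    using L2_measurable[OF g] L2_measurable[OF h] by measurable
  ultimately show ?thesis by (simp add: L2_def)
qed

lemma L2_diff: "g \<in> L2 \<Omega> \<Longrightarrow> h \<in> L2 \<Omega> \<Longrightarrow> (\<lambda>x. g x - h x) \<in> L2 \<Omega>"
  using L2_lincomb[of g \<Omega> h "-1"] by simp

lemma L2_inner_commute: "L2_inner \<Omega> g h = L2_inner \<Omega> h g"
  by (simp add: L2_inner_def mult.commute)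

lemma L2_inner_lincomb_left:
  assumes "g \<in> L2 \<Omega>" and "h \<in> L2 \<Omega>" and "k \<in> L2 \<Omega>"
  shows "L2_inner \<Omega> (\<lambda>x. g x + c * h x) k = L2_inner \<Omega> g k + c * L2_inner \<Omega> h k"
proof -
  have "L2_inner \<Omega> (\<lambda>x. g x + c * h x) k = (LINT x|lebesgue_on \<Omega>. g x * k x + c * (h x * k x))"
    by (simp add: L2_inner_def algebra_simps)
  also have "\<dots> = L2_inner \<Omega> g k + c * L2_inner \<Omega> h k"
    unfolding L2_inner_def using assms
    by (simp add: L2_mult_integrable)
  finally show ?thesis .
qed

lemma L2_inner_lincomb_right:
  assumes "g \<in> L2 \<Omega>" and "h \<in> L2 \<Omega>" and "k \<in> L2 \<Omega>"
  shows "L2_inner \<Omega> k (\<lambda>x. g x + c * h x) = L2_inner \<Omega> k g + c * L2_inner \<Omega> k h"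
  using L2_inner_lincomb_left[OF assms] by (simp add: L2_inner_commute)

lemma L2_inner_diff_left:
  "g \<in> L2 \<Omega> \<Longrightarrow> h \<in> L2 \<Omega> \<Longrightarrow> k \<in> L2 \<Omega> \<Longrightarrow>
    L2_inner \<Omega> (\<lambda>x. g x - h x) k = L2_inner \<Omega> g k - L2_inner \<Omega> h k"
  using L2_inner_lincomb_left[of g \<Omega> h k "-1"] by simp

lemma L2_inner_self_nonneg: "0 \<le> L2_inner \<Omega> g g"
  by (simp add: L2_inner_def)

lemma L2_norm_nonneg: "0 \<le> L2_norm \<Omega> g"
  by (simp add: L2_norm_def L2_inner_self_nonneg)

lemma L2_norm_square: "(L2_norm \<Omega> g)\<^sup>2 = L2_inner \<Omega> g g"
  by (simp add: L2_norm_def L2_inner_self_nonneg)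

lemma L2_norm_scale: "L2_norm \<Omega> (\<lambda>x. c * g x) = \<bar>c\<bar> * L2_norm \<Omega> g"
proof -
  have "L2_inner \<Omega> (\<lambda>x. c * g x) (\<lambda>x. c * g x) = c\<^sup>2 * L2_inner \<Omega> g g"
    unfolding L2_inner_def by (simp add: power2_eq_square mult_ac flip: integral_mult_right_zero)
  then show ?thesis by (simp add: L2_norm_def real_sqrt_mult)
qed

lemma zero_in_L2: "(\<lambda>x. 0) \<in> L2 \<Omega>"
  by (simp add: L2_def)

lemma L2_scale: "g \<in> L2 \<Omega> \<Longrightarrow> (\<lambda>x. c * g x) \<in> L2 \<Omega>"
  using L2_lincomb[OF zero_in_L2, of g \<Omega> c] by simp

lemma L2_cauchy_schwarz:
  assumes g: "g \<in> L2 \<Omega>" and h: "h \<in> L2 \<Omega>"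
  shows "\<bar>L2_inner \<Omega> g h\<bar> \<le> L2_norm \<Omega> g * L2_norm \<Omega> h"
proof -
  have "0 \<le> L2_inner \<Omega> g g + 2 * c * L2_inner \<Omega> g h + c\<^sup>2 * L2_inner \<Omega> h h" for c
    using L2_inner_self_nonneg[of \<Omega> "\<lambda>x. g x + c * h x"] g h
    by (simp add: L2_inner_lincomb_left L2_inner_lincomb_right L2_lincomb algebra_simps power2_eq_square
        L2_inner_commute[of \<Omega> h g])
  then have "(L2_inner \<Omega> g h)\<^sup>2 \<le> (L2_norm \<Omega> g * L2_norm \<Omega> h)\<^sup>2"
    unfolding power_mult_distrib L2_norm_square
    by (rule quadratic_form_cauchy_schwarz[OF _ L2_inner_self_nonneg])
  then show ?thesis
    using power2_le_iff_abs_le[OF mult_nonneg_nonneg[OF L2_norm_nonneg L2_norm_nonneg]] by blast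
qed

lemma L2_norm_lincomb_le:
  assumes "g \<in> L2 \<Omega>" and "h \<in> L2 \<Omega>"
  shows "L2_norm \<Omega> (\<lambda>x. g x + c * h x) \<le> L2_norm \<Omega> g + \<bar>c\<bar> * L2_norm \<Omega> h"
proof (rule power2_le_imp_le)
  have "(L2_norm \<Omega> (\<lambda>x. g x + c * h x))\<^sup>2 = L2_inner \<Omega> g g + 2 * (c * L2_inner \<Omega> g h) + c\<^sup>2 * L2_inner \<Omega> h h"
    unfolding L2_norm_square
    using assms by (simp add: L2_inner_lincomb_left L2_inner_lincomb_right L2_lincomb algebra_simps
        power2_eq_square L2_inner_commute[of \<Omega> h g])
  also have "c * L2_inner \<Omega> g h \<le> \<bar>c\<bar> * (L2_norm \<Omega> g * L2_norm \<Omega> h)"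
    using mult_left_mono[OF L2_cauchy_schwarz[OF assms], of "\<bar>c\<bar>"] abs_ge_self[of "c * L2_inner \<Omega> g h"]
    by (simp add: abs_mult)
  finally show "(L2_norm \<Omega> (\<lambda>x. g x + c * h x))\<^sup>2 \<le> (L2_norm \<Omega> g + \<bar>c\<bar> * L2_norm \<Omega> h)\<^sup>2"
    by (simp add: power2_sum power_mult_distrib L2_norm_square mult_ac)
qed (simp add: L2_norm_nonneg)

lemma L2_norm_diff_le:
  "g \<in> L2 \<Omega> \<Longrightarrow> h \<in> L2 \<Omega> \<Longrightarrow> L2_norm \<Omega> (\<lambda>x. g x - h x) \<le> L2_norm \<Omega> g + L2_norm \<Omega> h"
  using L2_norm_lincomb_le[of g \<Omega> h "-1"] by simp

lemma L2_norm_mono: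
  assumes "g \<in> borel_measurable (lebesgue_on \<Omega>)" and "h \<in> L2 \<Omega>"
    and "AE x in lebesgue_on \<Omega>. \<bar>g x\<bar> \<le> \<bar>h x\<bar>"
  shows "L2_norm \<Omega> g \<le> L2_norm \<Omega> h"
  unfolding L2_norm_def L2_inner_def real_sqrt_le_iff power2_eq_square[symmetric]
proof (rule integral_mono_AE)
  show "AE x in lebesgue_on \<Omega>. (g x)\<^sup>2 \<le> (h x)\<^sup>2"
    using assms(3) by eventually_elim (simp add: abs_le_square_iff)
qed (use L2_bound[OF assms] assms(2) L2_square_integrable in auto)

lemma L2_norm_eq_0_iff:
  assumes "g \<in> L2 \<Omega>"
  shows "L2_norm \<Omega> g = 0 \<longleftrightarrow> (AE x in lebesgue_on \<Omega>. g x = 0)"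
  using integral_nonneg_eq_0_iff_AE[OF L2_square_integrable[OF assms]]
  by (simp add: L2_norm_def L2_inner_def power2_eq_square)

text \<open>
  Rescale \<open>g\<close> into the ball on which continuity at \<open>0\<close> bounds \<open>l\<close> by \<open>1\<close>.  A nonzero \<open>g\<close> may have
  seminorm \<open>0\<close>; then all its multiples lie in that ball, which forces \<open>l g = 0\<close>.
\<close>

lemma continuous_linear_form_bounded:
  assumes "continuous_linear_form (L2 \<Omega>) (L2_norm \<Omega>) l"
  obtains L where "L \<ge> 0" and "\<And>g. g \<in> L2 \<Omega> \<Longrightarrow> \<bar>l g\<bar> \<le> L * L2_norm \<Omega> g"
proof -
  have scale: "l (\<lambda>x. c * g x) = c * l g" if "g \<in> L2 \<Omega>" for c g
    using assms that by (simp add: continuous_linear_form_def)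
  have l0: "l (\<lambda>x. 0) = 0" using scale[OF zero_in_L2, of 0] by simp
  obtain \<delta> where \<delta>: "\<delta> > 0" "\<And>h. h \<in> L2 \<Omega> \<Longrightarrow> L2_norm \<Omega> h < \<delta> \<Longrightarrow> \<bar>l h\<bar> < 1"
    using assms zero_in_L2[of \<Omega>] l0 unfolding continuous_linear_form_def
    by (metis (no_types, lifting) diff_zero less_numeral_extra(1) ext)
  have "\<bar>l g\<bar> \<le> 2 / \<delta> * L2_norm \<Omega> g" if g: "g \<in> L2 \<Omega>" for g
  proof (cases "L2_norm \<Omega> g = 0")
    case True
    have "\<bar>c * l g\<bar> < 1" for c
      using \<delta>(2)[OF L2_scale[OF g, of c], unfolded L2_norm_scale scale[OF g]] True \<delta>(1) by simp
    then have "\<bar>l g\<bar> = 0"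
      by (metis abs_one less_irrefl nonzero_eq_divide_eq abs_eq_0 divide_self mult.commute times_divide_eq_right mult_1)
    then show ?thesis using True by simp
  next
    case False
    then have pos: "L2_norm \<Omega> g > 0" using L2_norm_nonneg[of \<Omega> g] by simp
    define c where "c = \<delta> / (2 * L2_norm \<Omega> g)"
    have c: "c > 0" "c * L2_norm \<Omega> g < \<delta>" using \<delta>(1) pos by (auto simp: c_def)
    have "\<bar>c * l g\<bar> < 1"
      using \<delta>(2)[OF L2_scale[OF g, of c], unfolded L2_norm_scale scale[OF g]] c by simp
    then have "\<bar>l g\<bar> < 1 / c" using c(1) by (simp add: abs_mult field_simps)
    then show ?thesis by (simp add: c_def)
  qed
  then show ?thesis using that[of "2 / \<delta>"] \<delta>(1) by simp
qed

section \<open>Weak gradients and the spaces \<open>H\<^sup>1\<close> and \<open>H\<^sub>0\<^sup>1\<close>\<close>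

locale bounded_open =
  fixes \<Omega> :: "'a::euclidean_space set"
  assumes open_\<Omega>: "open \<Omega>" and bounded_\<Omega>: "bounded \<Omega>"
begin

abbreviation "M \<equiv> lebesgue_on \<Omega>"

lemma \<Omega>_measurable: "\<Omega> \<in> sets lebesgue"
  using open_\<Omega> by auto

lemma finite_measure_M: "finite_measure M"
  using open_\<Omega> bounded_\<Omega> by (intro finite_measure_lebesgue_on lmeasurable_open)

lemma bounded_in_L2:
  assumes "g \<in> borel_measurable M" and "\<And>x. \<bar>g x\<bar> \<le> B"
  shows "g \<in> L2 \<Omega>"
proof -
  interpret finite_measure M by (rule finite_measure_M)
  have "(g x)\<^sup>2 \<le> B\<^sup>2" for x
    using power_mono[OF assms(2)[of x], of 2] by simp
  then have "integrable M (\<lambda>x. (g x)\<^sup>2)"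
    using assms(1) by (intro integrable_const_bound[where B = "B\<^sup>2"]) auto
  then show ?thesis using assms(1) by (simp add: L2_def)
qed

lemma const_in_L2: "(\<lambda>x. c) \<in> L2 \<Omega>"
  by (rule bounded_in_L2[where B = "\<bar>c\<bar>"]) auto

lemma L2_integrable: "g \<in> L2 \<Omega> \<Longrightarrow> integrable M g"
  using L2_mult_integrable[OF _ const_in_L2, of g 1] by simp

lemma test_function_L2: "test_function \<Omega> \<phi> \<Longrightarrow> \<phi> \<in> L2 \<Omega>"
  using test_function_bounded bounded_in_L2 continuous_imp_measurable_on_sets_lebesgue[OF test_function_continuous \<Omega>_measurable]
  by metis

lemma weak_gradient_L2: "weak_gradient \<Omega> g G \<Longrightarrow> b \<in> Basis \<Longrightarrow> (\<lambda>x. G x \<bullet> b) \<in> L2 \<Omega>"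
  by (simp add: weak_gradient_def)

lemma weak_gradient_unique:
  assumes G: "weak_gradient \<Omega> g G" and H: "weak_gradient \<Omega> g H"
  shows "AE x in M. G x = H x"
proof -
  have "AE x in M. G x \<bullet> b - H x \<bullet> b = 0" if b: "b \<in> Basis" for b
  proof (rule zero_if_orthogonal_to_test_functions[OF open_\<Omega>])
    have L2: "(\<lambda>x. G x \<bullet> b) \<in> L2 \<Omega>" "(\<lambda>x. H x \<bullet> b) \<in> L2 \<Omega>"
      using assms b weak_gradient_L2 by auto
    then show "integrable M (\<lambda>x. G x \<bullet> b - H x \<bullet> b)"
      by (intro L2_integrable L2_diff)
    show "(LINT x|M. (G x \<bullet> b - H x \<bullet> b) * \<phi> x) = 0" if \<phi>: "test_function \<Omega> \<phi>" for \<phi>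
    proof -
      have "(LINT x|M. (G x \<bullet> b) * \<phi> x) = (LINT x|M. (H x \<bullet> b) * \<phi> x)"
        using assms b \<phi> by (simp add: weak_gradient_def)
      then show ?thesis
        using L2_inner_diff_left[OF L2 test_function_L2[OF \<phi>]] by (simp add: L2_inner_def)
    qed
  qed
  then have "AE x in M. \<forall>b\<in>Basis. G x \<bullet> b - H x \<bullet> b = 0"
    by (simp add: AE_finite_all)
  then show ?thesis
    by eventually_elim (auto intro: euclidean_eqI)
qed

lemma weak_gradient_lincomb:
  assumes "g \<in> L2 \<Omega>" "h \<in> L2 \<Omega>" and G: "weak_gradient \<Omega> g G" and H: "weak_gradient \<Omega> h H"
  shows "weak_gradient \<Omega> (\<lambda>x. g x + c * h x) (\<lambda>x. G x + c *\<^sub>R H x)"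
  unfolding weak_gradient_def
proof (intro ballI conjI allI impI)
  fix b :: 'a assume b: "b \<in> Basis"
  have L2: "(\<lambda>x. G x \<bullet> b) \<in> L2 \<Omega>" "(\<lambda>x. H x \<bullet> b) \<in> L2 \<Omega>"
    using G H b weak_gradient_L2 by auto
  show "(\<lambda>x. (G x + c *\<^sub>R H x) \<bullet> b) \<in> L2 \<Omega>"
    using L2_lincomb[OF L2] by (simp add: inner_add_left)
  fix \<phi> assume \<phi>: "test_function \<Omega> \<phi>"
  have "L2_inner \<Omega> g (partial_deriv b \<phi>) = - L2_inner \<Omega> (\<lambda>x. G x \<bullet> b) \<phi>"
    "L2_inner \<Omega> h (partial_deriv b \<phi>) = - L2_inner \<Omega> (\<lambda>x. H x \<bullet> b) \<phi>"
    using G H b \<phi> by (auto simp: weak_gradient_def L2_inner_def)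
  then have "L2_inner \<Omega> (\<lambda>x. g x + c * h x) (partial_deriv b \<phi>) =
      - L2_inner \<Omega> (\<lambda>x. (G x \<bullet> b) + c * (H x \<bullet> b)) \<phi>"
    using assms L2 test_function_L2[OF \<phi>] test_function_L2[OF test_function_partial[OF \<phi> b]]
    by (simp add: L2_inner_lincomb_left)
  then show "(LINT x|M. (g x + c * h x) * partial_deriv b \<phi> x) = - (LINT x|M. (G x + c *\<^sub>R H x) \<bullet> b * \<phi> x)"
    by (simp add: L2_inner_def inner_add_left)
qed

text \<open>
  Integration by parts: the partial derivatives of the product of two test functions integrate to \<open>0\<close>.
\<close>

lemma weak_gradient_test_function:
  assumes \<phi>: "test_function \<Omega> \<phi>"
  shows "weak_gradient \<Omega> \<phi> (\<lambda>x. \<Sum>b\<in>Basis. partial_deriv b \<phi> x *\<^sub>R b)"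
  unfolding weak_gradient_def
proof (intro ballI conjI allI impI)
  fix b :: 'a assume b: "b \<in> Basis"
  have comp: "(\<Sum>b\<in>Basis. partial_deriv b \<phi> x *\<^sub>R b) \<bullet> b = partial_deriv b \<phi> x" for x
    using b by simp
  show "(\<lambda>x. (\<Sum>b\<in>Basis. partial_deriv b \<phi> x *\<^sub>R b) \<bullet> b) \<in> L2 \<Omega>"
    unfolding comp by (rule test_function_L2[OF test_function_partial[OF \<phi> b]])
  fix \<psi> assume \<psi>: "test_function \<Omega> \<psi>"
  have prod: "test_function \<Omega> (\<lambda>x. \<phi> x * \<psi> x)"
    using \<phi> \<psi> by (intro test_function_mult_smooth) (auto simp: test_function_def)
  have leibniz: "partial_deriv b (\<lambda>x. \<phi> x * \<psi> x) x = \<phi> x * partial_deriv b \<psi> x + partial_deriv b \<phi> x * \<psi> x" for x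
    using partial_deriv_eqI[OF has_derivative_mult[OF test_function_has_derivative[OF \<phi>] test_function_has_derivative[OF \<psi>]]]
    by (simp add: partial_deriv_def)
  have "(LINT x|M. partial_deriv b (\<lambda>x. \<phi> x * \<psi> x) x) = (\<integral>x. partial_deriv b (\<lambda>x. \<phi> x * \<psi> x) x \<partial>lebesgue)"
  proof -
    have "(\<lambda>x. if x \<in> \<Omega> then partial_deriv b (\<lambda>x. \<phi> x * \<psi> x) x else 0) = partial_deriv b (\<lambda>x. \<phi> x * \<psi> x)"
      using test_function_eq_0[OF test_function_partial[OF prod b]] by auto
    then show ?thesis
      using Lebesgue_Measure.integral_restrict_UNIV[OF \<Omega>_measurable, of "partial_deriv b (\<lambda>x. \<phi> x * \<psi> x)"] by simp
  qed
  also have "\<dots> = 0"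
    using integral_partial_deriv_test_function[OF prod b] test_function_integrable_lborel[OF test_function_partial[OF prod b]]
    by (simp add: integral_completion)
  finally have "(LINT x|M. \<phi> x * partial_deriv b \<psi> x + partial_deriv b \<phi> x * \<psi> x) = 0"
    by (simp add: leibniz)
  then show "(LINT x|M. \<phi> x * partial_deriv b \<psi> x) =
      - (LINT x|M. (\<Sum>b\<in>Basis. partial_deriv b \<phi> x *\<^sub>R b) \<bullet> b * \<psi> x)"
    unfolding comp using \<phi> \<psi> test_function_partial[OF _ b]
    by (simp add: L2_mult_integrable test_function_L2)
qed

lemma H1_L2: "g \<in> H1 \<Omega> \<Longrightarrow> g \<in> L2 \<Omega>"
  by (simp add: H1_def)

lemma weak_gradient_grad: "g \<in> H1 \<Omega> \<Longrightarrow> weak_gradient \<Omega> g (grad \<Omega> g)"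
  unfolding H1_def grad_def by (auto intro: someI_ex[of "weak_gradient \<Omega> g"])

lemma H1_lincomb: "g \<in> H1 \<Omega> \<Longrightarrow> h \<in> H1 \<Omega> \<Longrightarrow> (\<lambda>x. g x + c * h x) \<in> H1 \<Omega>"
  using weak_gradient_lincomb[of g h] L2_lincomb[of g \<Omega> h] unfolding H1_def by blast

lemma test_function_H1: "test_function \<Omega> \<phi> \<Longrightarrow> \<phi> \<in> H1 \<Omega>"
  using test_function_L2 weak_gradient_test_function by (auto simp: H1_def)

lemma grad_lincomb:
  assumes "g \<in> H1 \<Omega>" and "h \<in> H1 \<Omega>"
  shows "AE x in M. grad \<Omega> (\<lambda>x. g x + c * h x) x = grad \<Omega> g x + c *\<^sub>R grad \<Omega> h x"
  using assms by (intro weak_gradient_unique[OF weak_gradient_grad weak_gradient_lincomb] H1_lincomb H1_L2 weak_gradient_grad)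

definition dirichlet :: "('a \<Rightarrow> real) \<Rightarrow> ('a \<Rightarrow> real) \<Rightarrow> real" where
  "dirichlet g h = (LINT x|M. grad \<Omega> g x \<bullet> grad \<Omega> h x)"

definition H1_inner :: "('a \<Rightarrow> real) \<Rightarrow> ('a \<Rightarrow> real) \<Rightarrow> real" where
  "H1_inner g h = L2_inner \<Omega> g h + dirichlet g h"

lemma grad_inner_integrable:
  assumes "g \<in> H1 \<Omega>" and "h \<in> H1 \<Omega>"
  shows "integrable M (\<lambda>x. grad \<Omega> g x \<bullet> grad \<Omega> h x)"
proof -
  have "integrable M (\<lambda>x. \<Sum>b\<in>Basis. (grad \<Omega> g x \<bullet> b) * (grad \<Omega> h x \<bullet> b))"
    using weak_gradient_L2[OF weak_gradient_grad[OF assms(1)]] weak_gradient_L2[OF weak_gradient_grad[OF assms(2)]]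
    by (intro Bochner_Integration.integrable_sum L2_mult_integrable)
  then show ?thesis by (simp add: euclidean_inner[symmetric])
qed

lemma grad_measurable:
  assumes "g \<in> H1 \<Omega>"
  shows "grad \<Omega> g \<in> borel_measurable M"
  by (subst borel_measurable_euclidean_space)
    (use assms in \<open>auto intro!: L2_measurable weak_gradient_L2 weak_gradient_grad\<close>)

lemma dirichlet_commute: "dirichlet g h = dirichlet h g"
  by (simp add: dirichlet_def inner_commute)

lemma dirichlet_lincomb_left:
  assumes "g \<in> H1 \<Omega>" and "h \<in> H1 \<Omega>" and "k \<in> H1 \<Omega>"
  shows "dirichlet (\<lambda>x. g x + c * h x) k = dirichlet g k + c * dirichlet h k"
proof -
  have "dirichlet (\<lambda>x. g x + c * h x) k =
      (LINT x|M. grad \<Omega> g x \<bullet> grad \<Omega> k x + c * (grad \<Omega> h x \<bullet> grad \<Omega> k x))"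
    unfolding dirichlet_def
  proof (rule integral_cong_AE)
    show "AE x in M. grad \<Omega> (\<lambda>x. g x + c * h x) x \<bullet> grad \<Omega> k x =
        grad \<Omega> g x \<bullet> grad \<Omega> k x + c * (grad \<Omega> h x \<bullet> grad \<Omega> k x)"
      using grad_lincomb[OF assms(1,2), of c] by eventually_elim (simp add: inner_add_left)
  qed (use assms H1_lincomb[OF assms(1,2), of c] grad_measurable in measurable)
  also have "\<dots> = dirichlet g k + c * dirichlet h k"
    unfolding dirichlet_def using assms by (simp add: grad_inner_integrable)
  finally show ?thesis .
qed

lemma dirichlet_lincomb_right:
  assumes "g \<in> H1 \<Omega>" and "h \<in> H1 \<Omega>" and "k \<in> H1 \<Omega>"
  shows "dirichlet k (\<lambda>x. g x + c * h x) = dirichlet k g + c * dirichlet k h"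
  using dirichlet_lincomb_left[OF assms] by (simp add: dirichlet_commute)

lemma H1_inner_commute: "H1_inner g h = H1_inner h g"
  by (simp add: H1_inner_def dirichlet_commute[of g] L2_inner_commute[of _ g])

lemma H1_inner_lincomb_left:
  assumes "g \<in> H1 \<Omega>" and "h \<in> H1 \<Omega>" and "k \<in> H1 \<Omega>"
  shows "H1_inner (\<lambda>x. g x + c * h x) k = H1_inner g k + c * H1_inner h k"
  using assms by (simp add: H1_inner_def dirichlet_lincomb_left L2_inner_lincomb_left H1_L2 algebra_simps)

lemma H1_inner_lincomb_right:
  assumes "g \<in> H1 \<Omega>" and "h \<in> H1 \<Omega>" and "k \<in> H1 \<Omega>"
  shows "H1_inner k (\<lambda>x. g x + c * h x) = H1_inner k g + c * H1_inner k h"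
  using H1_inner_lincomb_left[OF assms] by (simp add: H1_inner_commute)

lemma dirichlet_self_nonneg: "0 \<le> dirichlet g g"
  by (simp add: dirichlet_def)

lemma H1_norm_square: "(H1_norm \<Omega> g)\<^sup>2 = H1_inner g g"
  using dirichlet_self_nonneg[of g] L2_inner_self_nonneg[of \<Omega> g]
  by (simp add: H1_norm_def H1_inner_def L2_norm_square dirichlet_def power2_norm_eq_inner)

lemma H1_norm_nonneg: "0 \<le> H1_norm \<Omega> g"
  by (simp add: H1_norm_def L2_norm_square L2_inner_self_nonneg)

lemma L2_norm_le_H1_norm: "L2_norm \<Omega> g \<le> H1_norm \<Omega> g"
proof (rule power2_le_imp_le[OF _ H1_norm_nonneg])
  show "(L2_norm \<Omega> g)\<^sup>2 \<le> (H1_norm \<Omega> g)\<^sup>2"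
    using dirichlet_self_nonneg[of g] by (simp add: L2_norm_square H1_norm_square H1_inner_def)
qed

lemma H1_norm_lincomb_square:
  assumes "g \<in> H1 \<Omega>" and "h \<in> H1 \<Omega>"
  shows "(H1_norm \<Omega> (\<lambda>x. g x + c * h x))\<^sup>2 = (H1_norm \<Omega> g)\<^sup>2 + 2 * c * H1_inner g h + c\<^sup>2 * (H1_norm \<Omega> h)\<^sup>2"
  unfolding H1_norm_square using assms
  by (simp add: H1_inner_lincomb_left H1_inner_lincomb_right H1_lincomb algebra_simps power2_eq_square
      H1_inner_commute[of h g])

lemma H1_cauchy_schwarz:
  assumes "g \<in> H1 \<Omega>" and "h \<in> H1 \<Omega>"
  shows "\<bar>H1_inner g h\<bar> \<le> H1_norm \<Omega> g * H1_norm \<Omega> h"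
proof -
  have "0 \<le> (H1_norm \<Omega> g)\<^sup>2 + 2 * c * H1_inner g h + c\<^sup>2 * (H1_norm \<Omega> h)\<^sup>2" for c
    using H1_norm_lincomb_square[OF assms, of c] by (metis zero_le_power2)
  then have "(H1_inner g h)\<^sup>2 \<le> (H1_norm \<Omega> g * H1_norm \<Omega> h)\<^sup>2"
    unfolding power_mult_distrib by (rule quadratic_form_cauchy_schwarz) simp
  then show ?thesis
    using power2_le_iff_abs_le[OF mult_nonneg_nonneg[OF H1_norm_nonneg H1_norm_nonneg]] by blast
qed

lemma dirichlet_cauchy_schwarz:
  assumes "g \<in> H1 \<Omega>" and "h \<in> H1 \<Omega>"
  shows "\<bar>dirichlet g h\<bar> \<le> H1_norm \<Omega> g * H1_norm \<Omega> h"
proof -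
  have "0 \<le> dirichlet g g + 2 * c * dirichlet g h + c\<^sup>2 * dirichlet h h" for c
    using dirichlet_self_nonneg[of "\<lambda>x. g x + c * h x"] assms
    by (simp add: dirichlet_lincomb_left dirichlet_lincomb_right H1_lincomb algebra_simps
        power2_eq_square dirichlet_commute[of h g])
  then have "(dirichlet g h)\<^sup>2 \<le> dirichlet g g * dirichlet h h"
    by (rule quadratic_form_cauchy_schwarz[OF _ dirichlet_self_nonneg])
  also have "\<dots> \<le> (H1_norm \<Omega> g)\<^sup>2 * (H1_norm \<Omega> h)\<^sup>2"
    using dirichlet_self_nonneg L2_inner_self_nonneg
    by (intro mult_mono) (auto simp: H1_norm_square H1_inner_def)
  finally show ?thesis
    unfolding power_mult_distrib[symmetric]
    using power2_le_iff_abs_le[OF mult_nonneg_nonneg[OF H1_norm_nonneg H1_norm_nonneg]] by blast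
qed

lemma H1_norm_lincomb_le:
  assumes "g \<in> H1 \<Omega>" and "h \<in> H1 \<Omega>"
  shows "H1_norm \<Omega> (\<lambda>x. g x + c * h x) \<le> H1_norm \<Omega> g + \<bar>c\<bar> * H1_norm \<Omega> h"
proof (rule power2_le_imp_le)
  have "c * H1_inner g h \<le> \<bar>c\<bar> * (H1_norm \<Omega> g * H1_norm \<Omega> h)"
    using mult_left_mono[OF H1_cauchy_schwarz[OF assms], of "\<bar>c\<bar>"] abs_ge_self[of "c * H1_inner g h"]
    by (simp add: abs_mult)
  then show "(H1_norm \<Omega> (\<lambda>x. g x + c * h x))\<^sup>2 \<le> (H1_norm \<Omega> g + \<bar>c\<bar> * H1_norm \<Omega> h)\<^sup>2"
    by (simp add: H1_norm_lincomb_square[OF assms] power2_sum power_mult_distrib mult_ac)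
qed (simp add: H1_norm_nonneg)

lemma H10_H1: "g \<in> H10 \<Omega> \<Longrightarrow> g \<in> H1 \<Omega>"
  by (simp add: H10_def)

lemma H10_L2: "g \<in> H10 \<Omega> \<Longrightarrow> g \<in> L2 \<Omega>"
  by (simp add: H10_H1 H1_L2)

text \<open>
  Combinations of approximating test functions approximate the combination.  The triangle inequality
  in \<open>H1_norm\<close> applies because test functions belong to \<open>H1\<close>.
\<close>

lemma H10_lincomb:
  assumes g: "g \<in> H10 \<Omega>" and h: "h \<in> H10 \<Omega>"
  shows "(\<lambda>x. g x + c * h x) \<in> H10 \<Omega>"
proof -
  obtain \<phi> where \<phi>: "\<And>k. test_function \<Omega> (\<phi> k)" "(\<lambda>k. H1_norm \<Omega> (\<lambda>x. \<phi> k x - g x)) \<longlonglongrightarrow> 0"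
    using g by (auto simp: H10_def)
  obtain \<psi> where \<psi>: "\<And>k. test_function \<Omega> (\<psi> k)" "(\<lambda>k. H1_norm \<Omega> (\<lambda>x. \<psi> k x - h x)) \<longlonglongrightarrow> 0"
    using h by (auto simp: H10_def)
  have test: "test_function \<Omega> (\<lambda>x. \<phi> k x + c * \<psi> k x)" for k
    using \<phi>(1) \<psi>(1) by (intro test_function_add test_function_mult_smooth) auto
  have H1: "(\<lambda>x. \<phi> k x - g x) \<in> H1 \<Omega>" "(\<lambda>x. \<psi> k x - h x) \<in> H1 \<Omega>" for k
    using H1_lincomb[OF test_function_H1[OF \<phi>(1)[of k]] H10_H1[OF g], of "-1"]
      H1_lincomb[OF test_function_H1[OF \<psi>(1)[of k]] H10_H1[OF h], of "-1"] by auto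
  have "(\<lambda>k. H1_norm \<Omega> (\<lambda>x. \<phi> k x + c * \<psi> k x - (g x + c * h x))) \<longlonglongrightarrow> 0"
  proof (rule tendsto_sandwich[OF _ _ tendsto_const])
    show "(\<lambda>k. H1_norm \<Omega> (\<lambda>x. \<phi> k x - g x) + \<bar>c\<bar> * H1_norm \<Omega> (\<lambda>x. \<psi> k x - h x)) \<longlonglongrightarrow> 0"
      using tendsto_add[OF \<phi>(2) tendsto_mult_right_zero[OF \<psi>(2), of "\<bar>c\<bar>"]] by simp
    have eq: "\<phi> k x + c * \<psi> k x - (g x + c * h x) = \<phi> k x - g x + c * (\<psi> k x - h x)" for k x
      by (simp add: algebra_simps)
    show "\<forall>\<^sub>F k in sequentially. H1_norm \<Omega> (\<lambda>x. \<phi> k x + c * \<psi> k x - (g x + c * h x))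
        \<le> H1_norm \<Omega> (\<lambda>x. \<phi> k x - g x) + \<bar>c\<bar> * H1_norm \<Omega> (\<lambda>x. \<psi> k x - h x)"
      unfolding eq using H1_norm_lincomb_le[OF H1] by simp
  qed (simp add: H1_norm_nonneg)
  then show ?thesis
    using H1_lincomb[OF H10_H1[OF g] H10_H1[OF h]] test unfolding H10_def
    by (auto intro!: exI[of _ "\<lambda>k x. \<phi> k x + c * \<psi> k x"])
qed

lemma H10_diff: "g \<in> H10 \<Omega> \<Longrightarrow> h \<in> H10 \<Omega> \<Longrightarrow> (\<lambda>x. g x - h x) \<in> H10 \<Omega>"
  using H10_lincomb[of g h "-1"] by simp

lemma H1_norm_zero: "H1_norm \<Omega> (\<lambda>x. 0) = 0"
  and zero_in_H10: "(\<lambda>x. 0) \<in> H10 \<Omega>"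
proof -
  have test: "test_function \<Omega> (\<lambda>x. 0)"
    by (rule test_functionI[where K = "{}"]) auto
  then have "(H1_norm \<Omega> (\<lambda>x. 0))\<^sup>2 = 0"
    using H1_norm_lincomb_square[OF test_function_H1 test_function_H1, OF test test, of "-1"]
      H1_norm_square[of "\<lambda>x. 0"] by simp
  then show "H1_norm \<Omega> (\<lambda>x. 0) = 0" by simp
  then show "(\<lambda>x. 0) \<in> H10 \<Omega>"
    using test test_function_H1[OF test] unfolding H10_def by (auto intro!: exI[of _ "\<lambda>k x. 0"])
qed

end

section \<open>The energy in the dual norm\<close>

context bounded_open
begin

text \<open>
  Half the square of the norm of \<open>g\<close> in the dual of \<open>H\<^sub>0\<^sup>1\<close>: for a fixed direction \<open>h\<close>, optimizing the
  multiple of \<open>h\<close> in this concave expression gives half the square of \<open>(g,h) / |h|\<close>.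
\<close>

definition dual_energy :: "('a \<Rightarrow> real) \<Rightarrow> real" where
  "dual_energy g = (SUP h\<in>H10 \<Omega>. L2_inner \<Omega> g h - (H1_norm \<Omega> h)\<^sup>2 / 2)"

lemma dual_energy_term_le:
  assumes "g \<in> L2 \<Omega>" and "h \<in> H10 \<Omega>"
  shows "L2_inner \<Omega> g h - (H1_norm \<Omega> h)\<^sup>2 / 2 \<le> (L2_norm \<Omega> g)\<^sup>2 / 2"
proof -
  have "L2_inner \<Omega> g h \<le> L2_norm \<Omega> g * L2_norm \<Omega> h"
    using L2_cauchy_schwarz[OF assms(1) H10_L2[OF assms(2)]] by simp
  also have "\<dots> \<le> L2_norm \<Omega> g * H1_norm \<Omega> h"
    by (intro mult_left_mono L2_norm_le_H1_norm L2_norm_nonneg)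
  finally show ?thesis
    using sum_squares_bound[of "L2_norm \<Omega> g" "H1_norm \<Omega> h"] by simp
qed

lemma dual_energy_bdd:
  "g \<in> L2 \<Omega> \<Longrightarrow> bdd_above ((\<lambda>h. L2_inner \<Omega> g h - (H1_norm \<Omega> h)\<^sup>2 / 2) ` H10 \<Omega>)"
  using dual_energy_term_le by (intro bdd_aboveI2[where M = "(L2_norm \<Omega> g)\<^sup>2 / 2"])

lemma dual_energy_upper:
  "g \<in> L2 \<Omega> \<Longrightarrow> h \<in> H10 \<Omega> \<Longrightarrow> L2_inner \<Omega> g h - (H1_norm \<Omega> h)\<^sup>2 / 2 \<le> dual_energy g"
  unfolding dual_energy_def by (rule cSUP_upper[OF _ dual_energy_bdd])

lemma dual_energy_nonneg: "g \<in> L2 \<Omega> \<Longrightarrow> 0 \<le> dual_energy g"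
  using dual_energy_upper[OF _ zero_in_H10] by (simp add: H1_norm_zero L2_inner_def)

lemma dual_energy_le: "g \<in> L2 \<Omega> \<Longrightarrow> dual_energy g \<le> (L2_norm \<Omega> g)\<^sup>2 / 2"
  unfolding dual_energy_def using zero_in_H10 by (intro cSUP_least dual_energy_term_le) auto

text \<open>
  The multiples of \<open>g\<close> itself are competitors: \<open>c (g,g) \<le> c\<^sup>2 |g|\<^sup>2 / 2\<close> for all \<open>c\<close> forces \<open>(g,g) = 0\<close>.
\<close>

lemma dual_energy_eq_0_imp:
  assumes g: "g \<in> H10 \<Omega>" and "dual_energy g \<le> 0"
  shows "L2_norm \<Omega> g = 0"
proof -
  have "0 \<le> 0 + 2 * c * (- L2_inner \<Omega> g g) + c\<^sup>2 * (H1_norm \<Omega> g)\<^sup>2" for c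
  proof -
    have cg: "(\<lambda>x. 0 + c * g x) \<in> H10 \<Omega>" using H10_lincomb[OF zero_in_H10 g] .
    have "L2_inner \<Omega> g (\<lambda>x. 0 + c * g x) = c * L2_inner \<Omega> g g"
      using L2_inner_lincomb_right[OF H10_L2[OF zero_in_H10] H10_L2[OF g] H10_L2[OF g], of c]
      by (simp add: L2_inner_def)
    moreover have "(H1_norm \<Omega> (\<lambda>x. 0 + c * g x))\<^sup>2 = c\<^sup>2 * (H1_norm \<Omega> g)\<^sup>2"
      using H1_norm_lincomb_square[OF H10_H1[OF zero_in_H10] H10_H1[OF g], of c]
        H1_cauchy_schwarz[OF H10_H1[OF zero_in_H10] H10_H1[OF g]] by (simp add: H1_norm_zero)
    ultimately show ?thesis
      using dual_energy_upper[OF H10_L2[OF g] cg] assms(2) by simp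
  qed
  then have "(- L2_inner \<Omega> g g)\<^sup>2 \<le> 0 * (H1_norm \<Omega> g)\<^sup>2"
    by (rule quadratic_form_cauchy_schwarz) simp
  then show ?thesis by (simp add: L2_norm_def)
qed

text \<open>
  The functional is quadratic in \<open>h\<close>.  Moving a near maximizer along a line \<open>h + c k\<close> gains at most
  \<open>\<epsilon>\<close>, and optimizing over \<open>c\<close> shows that \<open>h\<close> represents \<open>g\<close> in the \<open>H\<^sup>1\<close> inner product up to
  \<open>sqrt (2 \<epsilon>)\<close>.
\<close>

lemma dual_energy_near_maximizer:
  assumes g: "g \<in> L2 \<Omega>" and "\<epsilon> > 0"
  obtains h where "h \<in> H10 \<Omega>" and "dual_energy g - \<epsilon> < L2_inner \<Omega> g h - (H1_norm \<Omega> h)\<^sup>2 / 2"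
    and "\<And>k. k \<in> H10 \<Omega> \<Longrightarrow> \<bar>L2_inner \<Omega> g k - H1_inner h k\<bar> \<le> sqrt (2 * \<epsilon>) * H1_norm \<Omega> k"
    and "(H1_norm \<Omega> h)\<^sup>2 \<le> 4 * dual_energy g + 8 * \<epsilon>"
proof -
  obtain h where h: "h \<in> H10 \<Omega>" "dual_energy g - \<epsilon> < L2_inner \<Omega> g h - (H1_norm \<Omega> h)\<^sup>2 / 2"
    using less_cSUP_iff[OF _ dual_energy_bdd[OF g], of "dual_energy g - \<epsilon>"] zero_in_H10 \<open>\<epsilon> > 0\<close>
    unfolding dual_energy_def[symmetric] by auto
  have expand: "c * (L2_inner \<Omega> g k - H1_inner h k) - c\<^sup>2 * (H1_norm \<Omega> k)\<^sup>2 / 2 \<le> \<epsilon>" if k: "k \<in> H10 \<Omega>" for k c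
  proof -
    have "L2_inner \<Omega> g h + c * L2_inner \<Omega> g k
        - ((H1_norm \<Omega> h)\<^sup>2 + 2 * c * H1_inner h k + c\<^sup>2 * (H1_norm \<Omega> k)\<^sup>2) / 2 \<le> dual_energy g"
      using dual_energy_upper[OF g H10_lincomb[OF h(1) k, of c]]
      by (simp add: L2_inner_lincomb_right g h(1) k H10_L2 H10_H1 H1_norm_lincomb_square)
    then show ?thesis using h(2) by (simp add: field_simps)
  qed
  have "\<bar>L2_inner \<Omega> g k - H1_inner h k\<bar> \<le> sqrt (2 * \<epsilon>) * H1_norm \<Omega> k" if k: "k \<in> H10 \<Omega>" for k
  proof -
    have "0 \<le> 2 * \<epsilon> + 2 * c * (L2_inner \<Omega> g k - H1_inner h k) + c\<^sup>2 * (H1_norm \<Omega> k)\<^sup>2" for c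
      using expand[OF k, of "- c"] by (simp add: algebra_simps)
    then have "(L2_inner \<Omega> g k - H1_inner h k)\<^sup>2 \<le> 2 * \<epsilon> * (H1_norm \<Omega> k)\<^sup>2"
      by (rule quadratic_form_cauchy_schwarz) simp
    then have "(L2_inner \<Omega> g k - H1_inner h k)\<^sup>2 \<le> (sqrt (2 * \<epsilon>) * H1_norm \<Omega> k)\<^sup>2"
      using \<open>\<epsilon> > 0\<close> by (simp add: power_mult_distrib)
    then show ?thesis
      using power2_le_iff_abs_le[of "sqrt (2 * \<epsilon>) * H1_norm \<Omega> k"] H1_norm_nonneg[of k] \<open>\<epsilon> > 0\<close> by simp
  qed
  moreover have "(H1_norm \<Omega> h)\<^sup>2 \<le> 4 * dual_energy g + 8 * \<epsilon>"
    \<comment> \<open>\<open>h / 2\<close> is a competitor as well, and \<open>h\<close> is nearly optimal\<close>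
  proof -
    have "- 1 / 2 * (L2_inner \<Omega> g h - (H1_norm \<Omega> h)\<^sup>2) - 1 / 4 * (H1_norm \<Omega> h)\<^sup>2 / 2 \<le> \<epsilon>"
      using expand[OF h(1), of "- 1 / 2"] unfolding H1_norm_square by (simp add: power_divide)
    then show ?thesis
      using dual_energy_upper[OF g h(1)] by argo
  qed
  ultimately show ?thesis using that h by blast
qed

end

section \<open>Distributional time derivatives\<close>

lemma step_scaled_tendsto:
  fixes S :: "real \<Rightarrow> real"
  assumes "\<And>x. x \<le> 0 \<Longrightarrow> S x = (0::real)" and "\<And>x. x \<ge> 1 \<Longrightarrow> S x = 1" and "filterlim \<kappa> at_top sequentially"
  shows "(\<lambda>n. S (\<kappa> n * (r - c) - 1)) \<longlonglongrightarrow> (if c < r then 1 else 0)"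
proof (cases "c < r")
  case True
  have "\<forall>\<^sub>F n in sequentially. \<kappa> n \<ge> 2 / (r - c)"
    using assms(3) by (simp add: filterlim_at_top)
  then have "\<forall>\<^sub>F n in sequentially. 1 = S (\<kappa> n * (r - c) - 1)"
  proof eventually_elim
    case (elim n)
    then have "\<kappa> n * (r - c) \<ge> 2" using True by (simp add: field_simps)
    then show ?case using assms(2) by simp
  qed
  then show ?thesis using True by (simp add: Lim_transform_eventually[OF tendsto_const])
next
  case False
  have "\<forall>\<^sub>F n in sequentially. \<kappa> n \<ge> 0"
    using assms(3) by (simp add: filterlim_at_top)
  then have "\<forall>\<^sub>F n in sequentially. 0 = S (\<kappa> n * (r - c) - 1)"
  proof eventually_elim
    case (elim n)
    then have "\<kappa> n * (r - c) \<le> 0" using False by (simp add: mult_nonneg_nonpos)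
    then show ?case using assms(1) by simp
  qed
  then show ?thesis using False by (simp add: Lim_transform_eventually[OF tendsto_const])
qed

text \<open>
  The derivative of the rescaled step \<open>S (\<kappa> (r - c) - 1)\<close> is an approximate identity, concentrated
  on \<open>[c + 1/\<kappa>, c + 2/\<kappa>]\<close>.  The shift by \<open>1\<close> keeps its support inside the open interval \<open>(0,T)\<close>
  also for \<open>c = 0\<close>, which is how the initial value at time \<open>0\<close> is reached.
\<close>

lemma integral_against_approximate_delta:
  fixes G S :: "real \<Rightarrow> real"
  assumes S: "\<And>k. C_k k S" "\<And>x. x \<le> 0 \<Longrightarrow> S x = 0" "\<And>x. x \<ge> 1 \<Longrightarrow> S x = 1" "mono S"
    and G: "continuous_on {0..<T} G" and c: "0 \<le> c" and \<kappa>: "\<kappa> > 0" "c + 2 / \<kappa> < T"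
    and e: "\<And>r. c \<le> r \<Longrightarrow> r \<le> c + 2 / \<kappa> \<Longrightarrow> \<bar>G r - G c\<bar> \<le> e"
  shows "integrable (lebesgue_on {0<..<T}) (\<lambda>r. G r * (\<kappa> * deriv S (\<kappa> * (r - c) - 1)))"
    and "\<bar>(LINT r|lebesgue_on {0<..<T}. G r * (\<kappa> * deriv S (\<kappa> * (r - c) - 1))) - G c\<bar> \<le> e"
proof -
  define \<rho> where "\<rho> r = \<kappa> * deriv S (\<kappa> * (r - c) - 1)" for r
  define J where "J = {c + 1 / \<kappa>..c + 2 / \<kappa>}"
  have "0 < c + 1 / \<kappa>" using c \<kappa>(1) by (intro add_nonneg_pos) auto
  then have J: "J \<subseteq> {0<..<T}" using \<kappa>(2) by (auto simp: J_def)
  have Jc: "r \<in> J \<Longrightarrow> c \<le> r \<and> r \<le> c + 2 / \<kappa>" for r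
    using \<kappa>(1) by (auto simp: J_def intro: order_trans[of c "c + 1 / \<kappa>"])
  have Sder: "(S has_real_derivative deriv S x) (at x)" for x
    using C_k_real_deriv(1) S(1) by blast
  have \<rho>0: "\<rho> r \<ge> 0" for r
  proof -
    have "deriv S x \<ge> 0" for x
      using S(4) Sder[of x] by (intro mono_on_imp_deriv_nonneg[of UNIV S]) auto
    then show ?thesis using \<kappa> by (simp add: \<rho>_def)
  qed
  have deriv0: "deriv S x = 0" if "x < 0 \<or> x > 1" for x
  proof -
    have "\<exists>v. \<forall>\<^sub>F y in nhds x. S y = v"
      using that
    proof
      assume "x < 0"
      then have "\<forall>\<^sub>F y in nhds x. S y = 0"
        using eventually_nhds_in_open[of "{..<0}" x] S(2) by (auto elim!: eventually_mono)
      then show ?thesis ..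
    next
      assume "x > 1"
      then have "\<forall>\<^sub>F y in nhds x. S y = 1"
        using eventually_nhds_in_open[of "{1<..}" x] S(3) by (auto elim!: eventually_mono)
      then show ?thesis ..
    qed
    then obtain v where "\<forall>\<^sub>F y in nhds x. S y = v" ..
    then have "deriv S x = deriv (\<lambda>_. v) x" by (intro deriv_cong_ev) auto
    then show ?thesis by simp
  qed
  have out: "\<rho> r = 0" if "r \<notin> J" for r
  proof -
    have "r < c + 1 / \<kappa> \<or> r > c + 2 / \<kappa>" using that by (auto simp: J_def)
    then have "\<kappa> * (r - c) - 1 < 0 \<or> \<kappa> * (r - c) - 1 > 1" using \<kappa>(1) by (auto simp: field_simps)
    then show ?thesis using deriv0 by (simp add: \<rho>_def)
  qed
  have cont\<rho>: "continuous_on A \<rho>" for A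
  proof -
    have "continuous_on UNIV (deriv S)" using C_k_continuous[OF C_k_real_deriv(2)] S(1) by blast
    moreover have "continuous_on A (\<lambda>r. \<kappa> * (r - c) - 1)" by (intro continuous_intros)
    ultimately have "continuous_on A (\<lambda>r. deriv S (\<kappa> * (r - c) - 1))"
      by (rule continuous_on_compose2) simp
    then show ?thesis unfolding \<rho>_def by (intro continuous_on_mult continuous_on_const)
  qed
  have GJ: "continuous_on J G" by (rule continuous_on_subset[OF G]) (use J in auto)
  have "integrable lebesgue (\<lambda>r. if r \<in> J then G r * \<rho> r else 0)"
    using continuous_imp_integrable_real[of "c + 1 / \<kappa>" "c + 2 / \<kappa>" "\<lambda>r. G r * \<rho> r"] GJ cont\<rho>
    by (subst Lebesgue_Measure.integrable_restrict_UNIV) (auto simp: J_def intro!: continuous_on_mult)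
  moreover have eq: "(\<lambda>r. if r \<in> J then G r * \<rho> r else 0) = (\<lambda>r. if r \<in> {0<..<T} then G r * \<rho> r else 0)"
    using J out by fastforce
  ultimately show int: "integrable (lebesgue_on {0<..<T}) (\<lambda>r. G r * (\<kappa> * deriv S (\<kappa> * (r - c) - 1)))"
    unfolding \<rho>_def[symmetric] using Lebesgue_Measure.integrable_restrict_UNIV[of "{0<..<T}" "\<lambda>r. G r * \<rho> r"]
    by simp
  have "(LINT r|lebesgue_on {0<..<T}. G r * \<rho> r) = (LINT r|lebesgue_on J. G r * \<rho> r)"
    using Lebesgue_Measure.integral_restrict_UNIV[of J "\<lambda>r. G r * \<rho> r"]
      Lebesgue_Measure.integral_restrict_UNIV[of "{0<..<T}" "\<lambda>r. G r * \<rho> r"] eq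
    by (simp add: J_def)
  also have "\<dots> = integral J (\<lambda>r. G r * \<rho> r)"
    using continuous_imp_integrable_real[of "c + 1 / \<kappa>" "c + 2 / \<kappa>" "\<lambda>r. G r * \<rho> r"] GJ cont\<rho>
    by (intro lebesgue_integral_eq_integral) (auto simp: J_def intro!: continuous_on_mult)
  finally have L: "(LINT r|lebesgue_on {0<..<T}. G r * \<rho> r) = integral J (\<lambda>r. G r * \<rho> r)" .
  have \<rho>1: "(\<rho> has_integral 1) J"
  proof -
    have "((\<lambda>r. S (\<kappa> * (r - c) - 1)) has_real_derivative \<rho> r) (at r)" for r
      unfolding \<rho>_def by (rule DERIV_chain2[OF Sder, THEN DERIV_cong]) (auto intro!: derivative_eq_intros)
    then have "(\<rho> has_integral S (\<kappa> * (c + 2 / \<kappa> - c) - 1) - S (\<kappa> * (c + 1 / \<kappa> - c) - 1)) J"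
      unfolding J_def using \<kappa>(1)
      by (intro fundamental_theorem_of_calculus)
        (auto simp: has_real_derivative_iff_has_vector_derivative divide_right_mono intro: has_vector_derivative_at_within)
    then show ?thesis using \<kappa>(1) S(2)[of 0] S(3)[of 1] by simp
  qed
  have i1: "(\<lambda>r. G r * \<rho> r) integrable_on J"
    unfolding J_def using GJ cont\<rho> by (intro integrable_continuous_real continuous_on_mult) (auto simp: J_def)
  have i2: "((\<lambda>r. G c * \<rho> r) has_integral G c) J" using has_integral_mult_right[OF \<rho>1, of "G c"] by simp
  have i3: "((\<lambda>r. e * \<rho> r) has_integral e) J" using has_integral_mult_right[OF \<rho>1, of e] by simp
  have "norm (integral J (\<lambda>r. G r * \<rho> r - G c * \<rho> r)) \<le> integral J (\<lambda>r. e * \<rho> r)"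
  proof (rule integral_norm_bound_integral)
    show "norm (G r * \<rho> r - G c * \<rho> r) \<le> e * \<rho> r" if "r \<in> J" for r
      using e[of r] Jc[OF that] \<rho>0[of r] by (simp add: abs_mult mult_right_mono flip: left_diff_distrib)
  qed (use i1 i2 i3 in \<open>auto intro: integrable_diff has_integral_integrable\<close>)
  moreover have "integral J (\<lambda>r. G r * \<rho> r - G c * \<rho> r) = integral J (\<lambda>r. G r * \<rho> r) - G c"
    using has_integral_diff[OF integrable_integral[OF i1] i2] by (rule integral_unique)
  moreover have "integral J (\<lambda>r. e * \<rho> r) = e" using i3 by (rule integral_unique)
  ultimately show "\<bar>(LINT r|lebesgue_on {0<..<T}. G r * (\<kappa> * deriv S (\<kappa> * (r - c) - 1))) - G c\<bar> \<le> e"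
    unfolding \<rho>_def[symmetric] L by (simp only: real_norm_def)
qed


text \<open>
  Test with the difference of two rescaled steps at \<open>s\<close> and \<open>t\<close>: it converges to the indicator of
  \<open>(s,t]\<close>, and its derivative to the difference of the point evaluations at \<open>s\<close> and \<open>t\<close>.
\<close>

lemma distributional_derivative_imp_increment:
  fixes G F :: "real \<Rightarrow> real"
  assumes G: "continuous_on {0..<T} G"
    and F: "\<And>\<tau>. \<tau> < T \<Longrightarrow> integrable (lebesgue_on {0<..<T}) (\<lambda>r. indicator {0<..\<tau>} r * F r)"
    and eq: "\<And>\<psi>. test_function {0<..<T} \<psi> \<Longrightarrow> dist_deriv T G \<psi> = dist_of T F \<psi>"
    and st: "0 \<le> s" "s \<le> t" "t < T"
  shows "G t - G s = (LINT r|lebesgue_on {0<..<T}. indicator {s<..t} r * F r)"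
proof -
  let ?M = "lebesgue_on {0<..<T}"
  obtain S :: "real \<Rightarrow> real" where S: "\<And>k. C_k k S" "\<And>x. x \<le> 0 \<Longrightarrow> S x = 0"
    "\<And>x. x \<ge> 1 \<Longrightarrow> S x = 1" "mono S"
    using smooth_step_exists by blast
  have S01: "0 \<le> S x" "S x \<le> 1" for x
    using monoD[OF S(4), of "min x 0" x] monoD[OF S(4), of x "max x 1"] S(2)[of "min x 0"] S(3)[of "max x 1"]
    by auto
  have Sder: "(S has_real_derivative deriv S x) (at x)" for x
    using C_k_real_deriv(1) S(1) by blast
  \<comment> \<open>\<open>\<kappa> n\<close> is at least \<open>2 / (\<tau> - t)\<close>, so that both steps are completed before \<open>\<tau> < T\<close>\<close>
  define \<tau> where "\<tau> = (t + T) / 2"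
  have \<tau>: "t < \<tau>" "\<tau> < T" using st by (auto simp: \<tau>_def)
  define \<kappa> where "\<kappa> n = 2 / (\<tau> - t) + real n" for n
  have \<kappa>0: "\<kappa> n > 0" for n using \<tau> by (simp add: \<kappa>_def add_pos_nonneg)
  have \<kappa>t: "c + 2 / \<kappa> n \<le> \<tau>" if "c \<le> t" for c n
  proof -
    have "2 / (\<tau> - t) \<le> \<kappa> n" by (simp add: \<kappa>_def)
    then have "2 / \<kappa> n \<le> \<tau> - t" using \<tau> \<kappa>0[of n] by (simp add: field_simps)
    then show ?thesis using that by simp
  qed
  have \<kappa>lim: "filterlim \<kappa> at_top sequentially"
    unfolding \<kappa>_def by (rule filterlim_tendsto_add_at_top[OF tendsto_const filterlim_real_sequentially])
  define \<delta> where "\<delta> c n r = \<kappa> n * deriv S (\<kappa> n * (r - c) - 1)" for c n r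
  define \<psi> where "\<psi> n r = S (\<kappa> n * (r - s) - 1) - S (\<kappa> n * (r - t) - 1)" for n r
  have Sn: "((\<lambda>r. S (\<kappa> n * (r - c) - 1)) has_real_derivative \<delta> c n r) (at r)" for c n r
    unfolding \<delta>_def by (rule DERIV_chain2[OF Sder, THEN DERIV_cong]) (auto intro!: derivative_eq_intros)
  have \<delta>: "integrable ?M (\<lambda>r. G r * \<delta> c n r)" "(\<lambda>n. LINT r|?M. G r * \<delta> c n r) \<longlonglongrightarrow> G c"
    if c: "0 \<le> c" "c \<le> t" for c n
  proof -
    have bnd: "integrable ?M (\<lambda>r. G r * \<delta> c n r)"
      "\<bar>(LINT r|?M. G r * \<delta> c n r) - G c\<bar> \<le> e"
      if "\<And>r. c \<le> r \<Longrightarrow> r \<le> c + 2 / \<kappa> n \<Longrightarrow> \<bar>G r - G c\<bar> \<le> e" for n e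
      unfolding \<delta>_def using integral_against_approximate_delta[OF S G c(1) \<kappa>0[of n] _ that] \<kappa>t[OF c(2), of n] \<tau>
      by auto
    have "compact ((\<lambda>r. \<bar>G r - G c\<bar>) ` {c..c + 2 / \<kappa> n})"
      using c \<kappa>t[OF c(2), of n] \<tau>
      by (intro compact_continuous_image continuous_intros continuous_on_subset[OF G]) auto
    then have "bounded ((\<lambda>r. \<bar>G r - G c\<bar>) ` {c..c + 2 / \<kappa> n})" by (rule compact_imp_bounded)
    then obtain e where "\<And>r. r \<in> {c..c + 2 / \<kappa> n} \<Longrightarrow> \<bar>G r - G c\<bar> \<le> e"
      unfolding bounded_iff by fastforce
    then show "integrable ?M (\<lambda>r. G r * \<delta> c n r)" by (intro bnd(1)[of n e]) auto
    show "(\<lambda>n. LINT r|?M. G r * \<delta> c n r) \<longlonglongrightarrow> G c"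
    proof (rule LIMSEQ_I)
      fix e :: real assume "e > 0"
      have "c \<in> {0..<T}" using c st by auto
      then obtain d where d: "d > 0" "\<And>r. r \<in> {0..<T} \<Longrightarrow> dist r c < d \<Longrightarrow> dist (G r) (G c) < e / 2"
        using G \<open>e > 0\<close> unfolding continuous_on_iff by (metis half_gt_zero)
      have "\<forall>\<^sub>F n in sequentially. \<kappa> n \<ge> 4 / d" using \<kappa>lim by (simp add: filterlim_at_top)
      then have "\<forall>\<^sub>F n in sequentially. norm ((LINT r|?M. G r * \<delta> c n r) - G c) < e"
      proof eventually_elim
        case (elim n)
        then have "2 / \<kappa> n < d" using d(1) \<kappa>0[of n] by (simp add: field_simps)
        have "\<bar>G r - G c\<bar> \<le> e / 2" if "c \<le> r" "r \<le> c + 2 / \<kappa> n" for r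
        proof -
          have "r \<in> {0..<T}" using that c \<kappa>t[OF c(2), of n] \<tau> by auto
          moreover have "dist r c < d" using that \<open>2 / \<kappa> n < d\<close> by (simp add: dist_real_def)
          ultimately show ?thesis using d(2)[of r] by (simp add: dist_real_def)
        qed
        then show ?case using bnd(2)[of n "e / 2"] \<open>e > 0\<close> by force
      qed
      then show "\<exists>N. \<forall>n\<ge>N. norm ((LINT r|?M. G r * \<delta> c n r) - G c) < e"
        by (simp add: eventually_sequentially)
    qed
  qed
  have \<psi>_zero: "\<psi> n r = 0" if "r \<notin> {s + 1 / \<kappa> n..t + 2 / \<kappa> n}" for n r
  proof -
    have "r < s + 1 / \<kappa> n \<or> r > t + 2 / \<kappa> n" using that by auto
    then show ?thesis
    proof
      assume "r < s + 1 / \<kappa> n"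
      then have *: "\<kappa> n * (r - s) < 1" using \<kappa>0[of n] by (simp add: field_simps)
      moreover have "\<kappa> n * (r - t) \<le> \<kappa> n * (r - s)" using st \<kappa>0[of n] by (intro mult_left_mono) auto
      ultimately show ?thesis by (simp add: \<psi>_def S(2))
    next
      assume "r > t + 2 / \<kappa> n"
      then have *: "\<kappa> n * (r - t) > 2" using \<kappa>0[of n] by (simp add: field_simps)
      moreover have "\<kappa> n * (r - t) \<le> \<kappa> n * (r - s)" using st \<kappa>0[of n] by (intro mult_left_mono) auto
      ultimately show ?thesis by (simp add: \<psi>_def S(3))
    qed
  qed
  have test: "test_function {0<..<T} (\<psi> n)" for n
  proof (rule test_functionI[OF _ _ _ \<psi>_zero])
    have "C_k k (\<lambda>r. S (\<kappa> n * (r - c) - 1))" for k c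
      using C_k_comp_affine[OF S(1), of k "\<kappa> n" "- \<kappa> n * c - 1"] by (simp add: algebra_simps)
    from C_k_add[OF this C_k_mult[OF C_k_const[of _ "-1"] this]]
    show "C_k k (\<psi> n)" for k by (simp add: \<psi>_def[abs_def])
    have "0 < s + 1 / \<kappa> n" using st \<kappa>0[of n] by (intro add_nonneg_pos) auto
    then show "{s + 1 / \<kappa> n..t + 2 / \<kappa> n} \<subseteq> {0<..<T}" using \<kappa>t[of t n] \<tau> by auto
  qed simp
  have "deriv (\<psi> n) r = \<delta> s n r - \<delta> t n r" for n r
    unfolding \<psi>_def by (rule DERIV_imp_deriv) (intro DERIV_diff Sn)
  then have "dist_deriv T G (\<psi> n) = (LINT r|?M. G r * \<delta> t n r) - (LINT r|?M. G r * \<delta> s n r)" for n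
    using \<delta>(1)[of s n] \<delta>(1)[of t n] st by (simp add: dist_deriv_def dist_of_def right_diff_distrib)
  then have lim1: "(\<lambda>n. dist_deriv T G (\<psi> n)) \<longlonglongrightarrow> G t - G s"
    using tendsto_diff[OF \<delta>(2)[of t] \<delta>(2)[of s]] st by simp
  have "(\<lambda>n. LINT r|?M. F r * \<psi> n r) \<longlonglongrightarrow> (LINT r|?M. indicator {s<..t} r * F r)"
  proof (rule integral_dominated_convergence[where w = "\<lambda>r. \<bar>indicator {0<..\<tau>} r * F r\<bar>"])
    have cut: "F r * \<psi> n r = (indicator {0<..\<tau>} r * F r) * \<psi> n r" if "r \<in> {0<..<T}" for n r
      using \<psi>_zero[of r n] \<kappa>t[of t n] that by (cases "r \<le> \<tau>") auto
    have cut': "indicator {s<..t} r * F r = indicator {s<..t} r * (indicator {0<..\<tau>} r * F r)" for r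
      using st \<tau> by (auto simp: indicator_def)
    have Fm: "(\<lambda>r. indicator {0<..\<tau>} r * F r) \<in> borel_measurable ?M"
      using F[OF \<tau>(2)] by (rule borel_measurable_integrable)
    show "(\<lambda>r. indicator {s<..t} r * F r) \<in> borel_measurable ?M"
      unfolding cut' by (rule borel_measurable_times[OF borel_measurable_indicator Fm])
        (use st in \<open>auto simp: sets_restrict_space_iff\<close>)
    have \<psi>m: "\<psi> n \<in> borel_measurable ?M" for n
      by (intro continuous_imp_measurable_on_sets_lebesgue test_function_continuous[OF test]) auto
    show "(\<lambda>r. F r * \<psi> n r) \<in> borel_measurable ?M" for n
      using measurable_cong[of ?M "\<lambda>r. F r * \<psi> n r" "\<lambda>r. (indicator {0<..\<tau>} r * F r) * \<psi> n r"] cut Fm \<psi>m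
      by simp
    show "AE r in ?M. (\<lambda>n. F r * \<psi> n r) \<longlonglongrightarrow> indicator {s<..t} r * F r"
    proof (rule AE_I2)
      fix r
      have "(\<lambda>n. \<psi> n r) \<longlonglongrightarrow> (if s < r then 1 else 0) - (if t < r then 1 else (0::real))"
        unfolding \<psi>_def by (intro tendsto_diff step_scaled_tendsto S(2,3) \<kappa>lim)
      moreover have "(if s < r then 1 else 0) - (if t < r then 1 else (0::real)) = indicator {s<..t} r"
        using st by (auto simp: indicator_def)
      ultimately show "(\<lambda>n. F r * \<psi> n r) \<longlonglongrightarrow> indicator {s<..t} r * F r"
        by (subst mult.commute[of "indicator _ _"]) (simp add: tendsto_mult_left)
    qed
    show "AE r in ?M. norm (F r * \<psi> n r) \<le> \<bar>indicator {0<..\<tau>} r * F r\<bar>" for n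
    proof (rule AE_I2)
      fix r assume "r \<in> space ?M"
      then have "r \<in> {0<..<T}" by simp
      have "\<bar>\<psi> n r\<bar> \<le> 1"
        using S01[of "\<kappa> n * (r - s) - 1"] S01[of "\<kappa> n * (r - t) - 1"] by (auto simp: \<psi>_def)
      then show "norm (F r * \<psi> n r) \<le> \<bar>indicator {0<..\<tau>} r * F r\<bar>"
        unfolding cut[OF \<open>r \<in> {0<..<T}\<close>] by (simp add: abs_mult mult_left_le)
    qed
  qed (use F[OF \<tau>(2)] in auto)
  then have "(\<lambda>n. dist_deriv T G (\<psi> n)) \<longlonglongrightarrow> (LINT r|?M. indicator {s<..t} r * F r)"
    using eq[OF test] by (simp add: dist_of_def)
  with lim1 show ?thesis by (rule LIMSEQ_unique)
qed

section \<open>Local integrability in time\<close>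

lemma lebesgue_on_measurable_cong_AE:
  fixes f g :: "'a::euclidean_space \<Rightarrow> real"
  assumes S: "S \<in> sets lebesgue" and f: "f \<in> borel_measurable (lebesgue_on S)"
    and ae: "AE x in lebesgue_on S. f x = g x"
  shows "g \<in> borel_measurable (lebesgue_on S)"
proof -
  have "(\<lambda>x. if x \<in> S then f x else 0) \<in> borel_measurable lebesgue"
    using f borel_measurable_if[OF S] by blast
  moreover have "AE x in lebesgue. (if x \<in> S then f x else 0) = (if x \<in> S then g x else 0)"
    using ae S by (simp add: AE_restrict_space_iff)
  ultimately have "(\<lambda>x. if x \<in> S then g x else 0) \<in> borel_measurable lebesgue"
    by (rule borel_measurable_AE)
  then show ?thesis using borel_measurable_if[OF S] by blast
qed

lemma lebesgue_on_measurable_AE_limit: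
  fixes f :: "nat \<Rightarrow> 'a::euclidean_space \<Rightarrow> real"
  assumes S: "S \<in> sets lebesgue" and f: "\<And>k. f k \<in> borel_measurable (lebesgue_on S)"
    and lim: "AE x in lebesgue_on S. (\<lambda>k. f k x) \<longlonglongrightarrow> g x"
  shows "g \<in> borel_measurable (lebesgue_on S)"
proof (rule lebesgue_on_measurable_cong_AE[OF S])
  show "(\<lambda>x. lim (\<lambda>k. f k x)) \<in> borel_measurable (lebesgue_on S)"
    by (rule borel_measurable_lim_metric[OF f])
  show "AE x in lebesgue_on S. lim (\<lambda>k. f k x) = g x"
    using lim by eventually_elim (rule limI)
qed

text \<open>
  Integrability up to every time before \<open>T\<close>: functions in \<open>C([0,T);L\<^sup>2)\<close> may be unbounded near \<open>T\<close>,
  whereas integrability down to time \<open>0\<close> is used for the initial condition.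
\<close>

definition locally_integrable :: "real \<Rightarrow> (real \<Rightarrow> real) \<Rightarrow> bool" where
  "locally_integrable T F \<longleftrightarrow>
     (\<forall>\<tau><T. integrable (lebesgue_on {0<..<T}) (\<lambda>r. indicator {0<..\<tau>} r * F r))"

lemma integrable_indicator_interval:
  fixes F :: "real \<Rightarrow> real"
  assumes "integrable (lebesgue_on {0<..<T}) F"
  shows "integrable (lebesgue_on {0<..<T}) (\<lambda>r. indicator {s<..t} r * F r)"
proof -
  have "{0<..<T} \<inter> {s<..t} \<in> sets (lebesgue_on {0<..<T})"
    by (auto simp: sets_restrict_space_iff)
  from integrable_mult_indicator[OF this assms]
  show ?thesis
    by (rule Bochner_Integration.integrable_cong[THEN iffD1, rotated -1]) (auto simp: indicator_def)
qed

lemma locally_integrableD: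
  assumes "locally_integrable T F" and "0 \<le> s" and "t < T"
  shows "integrable (lebesgue_on {0<..<T}) (\<lambda>r. indicator {s<..t} r * F r)"
proof -
  have "integrable (lebesgue_on {0<..<T}) (\<lambda>r. indicator {s<..t} r * (indicator {0<..t} r * F r))"
    by (rule integrable_indicator_interval) (use assms(1,3) in \<open>simp add: locally_integrable_def\<close>)
  moreover have "indicator {s<..t} r * (indicator {0<..t} r * F r) = indicator {s<..t} r * F r" for r
    using assms(2) by (auto simp: indicator_def)
  ultimately show ?thesis by simp
qed

lemma integrable_imp_locally_integrable:
  "integrable (lebesgue_on {0<..<T}) F \<Longrightarrow> locally_integrable T F"
  using integrable_indicator_interval by (simp add: locally_integrable_def)

lemma locally_integrable_add:
  assumes "locally_integrable T F" and "locally_integrable T G"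
  shows "locally_integrable T (\<lambda>r. F r + G r)"
  using assms by (simp add: locally_integrable_def distrib_left)

lemma continuous_bounded_until:
  fixes A :: "real \<Rightarrow> real"
  assumes "continuous_on {0..<T} A" and "\<tau> < T"
  obtains B where "B > 0" and "\<And>r. 0 \<le> r \<Longrightarrow> r \<le> \<tau> \<Longrightarrow> \<bar>A r\<bar> \<le> B"
proof -
  have "compact (A ` {0..\<tau>})"
    using assms by (intro compact_continuous_image continuous_on_subset[OF assms(1)]) auto
  then have "bounded (A ` {0..\<tau>})" by (rule compact_imp_bounded)
  then obtain B where "B > 0" "\<And>r. r \<in> {0..\<tau>} \<Longrightarrow> \<bar>A r\<bar> \<le> B"
    unfolding bounded_pos by fastforce
  then show ?thesis using that by simp
qed

lemma locally_integrable_mult_continuous: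
  assumes A: "continuous_on {0..<T} A" and F: "locally_integrable T F"
  shows "locally_integrable T (\<lambda>r. A r * F r)"
  unfolding locally_integrable_def
proof (intro allI impI)
  fix \<tau> assume "\<tau> < T"
  obtain B where B: "B > 0" "\<And>r. 0 \<le> r \<Longrightarrow> r \<le> \<tau> \<Longrightarrow> \<bar>A r\<bar> \<le> B"
    using continuous_bounded_until[OF A \<open>\<tau> < T\<close>] by blast
  have Fi: "integrable (lebesgue_on {0<..<T}) (\<lambda>r. indicator {0<..\<tau>} r * F r)"
    using F \<open>\<tau> < T\<close> by (simp add: locally_integrable_def)
  have "integrable (lebesgue_on {0<..<T}) (\<lambda>r. A r * (indicator {0<..\<tau>} r * F r))"
  proof (rule Bochner_Integration.integrable_bound[OF integrable_mult_right[OF Fi, of B]])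
    have "A \<in> borel_measurable (lebesgue_on {0<..<T})"
      by (intro continuous_imp_measurable_on_sets_lebesgue continuous_on_subset[OF A]) auto
    then show "(\<lambda>r. A r * (indicator {0<..\<tau>} r * F r)) \<in> borel_measurable (lebesgue_on {0<..<T})"
      by (rule borel_measurable_times[OF _ borel_measurable_integrable[OF Fi]])
    show "AE r in lebesgue_on {0<..<T}. norm (A r * (indicator {0<..\<tau>} r * F r)) \<le> norm (B * (indicator {0<..\<tau>} r * F r))"
      using B by (auto simp: indicator_def abs_mult intro!: mult_right_mono)
  qed
  then show "integrable (lebesgue_on {0<..<T}) (\<lambda>r. indicator {0<..\<tau>} r * (A r * F r))"
    by (simp add: mult.left_commute)
qed

lemma finite_measure_time: "finite_measure (lebesgue_on {0<..<T::real})"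
  by (intro finite_measure_lebesgue_on lmeasurable_open) auto

lemma locally_integrable_continuous:
  assumes "continuous_on {0..<T} Q"
  shows "locally_integrable T Q"
proof -
  interpret finite_measure "lebesgue_on {0<..<T}" by (rule finite_measure_time)
  have "locally_integrable T (\<lambda>r. 1)"
    by (intro integrable_imp_locally_integrable) simp
  from locally_integrable_mult_continuous[OF assms this] show ?thesis by simp
qed

lemma locally_integrable_mult_test_function:
  assumes F: "locally_integrable T F" and \<psi>: "test_function {0<..<T} \<psi>"
  shows "integrable (lebesgue_on {0<..<T}) (\<lambda>r. F r * \<psi> r)"
proof -
  obtain K where K: "compact K" "K \<subseteq> {0<..<T}" "\<And>r. r \<notin> K \<Longrightarrow> \<psi> r = 0"
    using test_functionE[OF \<psi>] by metis
  obtain \<tau> where \<tau>: "\<tau> < T" "\<And>r. r \<in> K \<Longrightarrow> r \<le> \<tau>"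
  proof (cases "K = {}")
    case False
    then obtain \<tau> where "\<tau> \<in> K" "\<And>r. r \<in> K \<Longrightarrow> r \<le> \<tau>"
      using compact_attains_sup[OF K(1)] by blast
    then show ?thesis using K(2) that by (meson greaterThanLessThan_iff subsetD)
  qed (use that[of "T - 1"] in auto)
  have c: "continuous_on {0..<T} \<psi>" by (rule test_function_continuous[OF \<psi>])
  have "integrable (lebesgue_on {0<..<T}) (\<lambda>r. indicator {0<..\<tau>} r * (\<psi> r * F r))"
    using locally_integrable_mult_continuous[OF c F] \<tau>(1) by (simp add: locally_integrable_def)
  then show ?thesis
  proof (rule Bochner_Integration.integrable_cong[THEN iffD1, rotated -1])
    fix r assume "r \<in> space (lebesgue_on {0<..<T})"
    then show "indicator {0<..\<tau>} r * (\<psi> r * F r) = F r * \<psi> r"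
      using \<tau>(2)[of r] K(3)[of r] by (cases "r \<in> K") (auto simp: indicator_def)
  qed simp
qed

lemma continuous_on_integral_upto:
  fixes F :: "real \<Rightarrow> real"
  assumes F: "integrable (lebesgue_on {0<..<T}) F"
  shows "continuous_on A (\<lambda>t. LINT r|lebesgue_on {0<..<T}. indicator {0<..t} r * F r)"
proof (rule continuous_on_sequentiallyI)
  fix \<sigma> :: "nat \<Rightarrow> real" and t assume lim: "\<sigma> \<longlonglongrightarrow> t"
  let ?M = "lebesgue_on {0<..<T}"
  show "(\<lambda>n. LINT r|?M. indicator {0<..\<sigma> n} r * F r) \<longlonglongrightarrow> (LINT r|?M. indicator {0<..t} r * F r)"
  proof (rule integral_dominated_convergence[where w = "\<lambda>r. \<bar>F r\<bar>"])
    have "AE r in lebesgue. r \<noteq> t"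
      by (rule AE_I'[of "{t}"]) (auto simp: negligible_iff_null_sets[symmetric])
    then have ne: "AE r in ?M. r \<noteq> t"
      by (subst AE_restrict_space_iff) (auto elim!: eventually_mono)
    show "AE r in ?M. (\<lambda>n. indicator {0<..\<sigma> n} r * F r) \<longlonglongrightarrow> indicator {0<..t} r * F r"
      using ne
    proof eventually_elim
      case (elim r)
      have "\<forall>\<^sub>F n in sequentially. (r \<le> \<sigma> n) = (r \<le> t)"
      proof (cases "r < t")
        case True
        then show ?thesis using order_tendstoD(1)[OF lim True] by (auto elim!: eventually_mono)
      next
        case False
        then have "t < r" using elim by simp
        then show ?thesis using order_tendstoD(2)[OF lim \<open>t < r\<close>] by (auto elim!: eventually_mono)
      qed
      then have "\<forall>\<^sub>F n in sequentially. indicator {0<..t} r * F r = indicator {0<..\<sigma> n} r * F r"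
        by eventually_elim (simp add: indicator_def)
      then show ?case by (rule Lim_transform_eventually[OF tendsto_const])
    qed
    show "integrable ?M (\<lambda>r. \<bar>F r\<bar>)" using F by simp
    show "(\<lambda>r. indicator {0<..t} r * F r) \<in> borel_measurable ?M" "(\<lambda>r. indicator {0<..\<sigma> n} r * F r) \<in> borel_measurable ?M" for n
      using borel_measurable_integrable[OF integrable_indicator_interval[OF F]] by auto
    show "AE r in ?M. norm (indicator {0<..\<sigma> n} r * F r) \<le> \<bar>F r\<bar>" for n
      by (auto simp: indicator_def)
  qed
qed

section \<open>Functions in the solution space\<close>

context bounded_open
begin

lemma solution_space_C_time_L2: "p \<in> solution_space T \<Omega> \<Longrightarrow> p \<in> C_time_L2 T \<Omega>"
  by (simp add: solution_space_def)

lemma C_time_L2_in_L2: "p \<in> C_time_L2 T \<Omega> \<Longrightarrow> t \<in> {0..<T} \<Longrightarrow> p t \<in> L2 \<Omega>"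
  by (simp add: C_time_L2_def)

lemma C_time_L2_tendsto:
  "p \<in> C_time_L2 T \<Omega> \<Longrightarrow> t \<in> {0..<T} \<Longrightarrow>
    ((\<lambda>s. L2_norm \<Omega> (\<lambda>x. p s x - p t x)) \<longlongrightarrow> 0) (at t within {0..<T})"
  by (simp add: C_time_L2_def)

lemma C_time_L2_diff:
  assumes p: "p \<in> C_time_L2 T \<Omega>" and p': "p' \<in> C_time_L2 T \<Omega>"
  shows "(\<lambda>t x. p t x - p' t x) \<in> C_time_L2 T \<Omega>"
  unfolding C_time_L2_def
proof (intro CollectI conjI ballI)
  fix t assume t: "t \<in> {0..<T}"
  show "(\<lambda>x. p t x - p' t x) \<in> L2 \<Omega>"
    using C_time_L2_in_L2 p p' t by (intro L2_diff) auto
  have "((\<lambda>s. L2_norm \<Omega> (\<lambda>x. p s x - p t x) + L2_norm \<Omega> (\<lambda>x. p' s x - p' t x)) \<longlongrightarrow> 0) (at t within {0..<T})"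
    using tendsto_add[OF C_time_L2_tendsto[OF p t] C_time_L2_tendsto[OF p' t]] by simp
  then show "((\<lambda>s. L2_norm \<Omega> (\<lambda>x. p s x - p' s x - (p t x - p' t x))) \<longlongrightarrow> 0) (at t within {0..<T})"
  proof (rule Lim_null_comparison[rotated])
    have "L2_norm \<Omega> (\<lambda>x. p s x - p' s x - (p t x - p' t x))
        \<le> L2_norm \<Omega> (\<lambda>x. p s x - p t x) + L2_norm \<Omega> (\<lambda>x. p' s x - p' t x)" if s: "s \<in> {0..<T}" for s
    proof -
      have "(\<lambda>x. p s x - p' s x - (p t x - p' t x)) = (\<lambda>x. (p s x - p t x) - (p' s x - p' t x))"
        by auto
      then show ?thesis
        using C_time_L2_in_L2[OF p s] C_time_L2_in_L2[OF p t] C_time_L2_in_L2[OF p' s] C_time_L2_in_L2[OF p' t]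
        by (simp add: L2_norm_diff_le L2_diff)
    qed
    then show "\<forall>\<^sub>F s in at t within {0..<T}. norm (L2_norm \<Omega> (\<lambda>x. p s x - p' s x - (p t x - p' t x)))
        \<le> L2_norm \<Omega> (\<lambda>x. p s x - p t x) + L2_norm \<Omega> (\<lambda>x. p' s x - p' t x)"
      by (auto simp: eventually_at_filter L2_norm_nonneg)
  qed
qed

lemma solution_space_H10: "p \<in> solution_space T \<Omega> \<Longrightarrow> AE r in lebesgue_on {0<..<T}. p r \<in> H10 \<Omega>"
  by (simp add: solution_space_def bochner_L2_def)

lemma solution_space_H1_norm_square:
  "p \<in> solution_space T \<Omega> \<Longrightarrow> integrable (lebesgue_on {0<..<T}) (\<lambda>r. (H1_norm \<Omega> (p r))\<^sup>2)"
  by (simp add: solution_space_def bochner_L2_def)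

lemma solution_space_H1_norm:
  assumes "p \<in> solution_space T \<Omega>"
  shows "integrable (lebesgue_on {0<..<T}) (\<lambda>r. H1_norm \<Omega> (p r))"
proof -
  interpret finite_measure "lebesgue_on {0<..<T}" by (rule finite_measure_time)
  note sq = solution_space_H1_norm_square[OF assms]
  have "(\<lambda>r. sqrt ((H1_norm \<Omega> (p r))\<^sup>2)) \<in> borel_measurable (lebesgue_on {0<..<T})"
    using borel_measurable_integrable[OF sq] by measurable
  then have m: "(\<lambda>r. H1_norm \<Omega> (p r)) \<in> borel_measurable (lebesgue_on {0<..<T})"
    by (simp add: H1_norm_nonneg)
  have "integrable (lebesgue_on {0<..<T}) (\<lambda>r. 1 + (H1_norm \<Omega> (p r))\<^sup>2)"
    using sq by simp
  then show ?thesis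
  proof (rule Bochner_Integration.integrable_bound[OF _ m])
    have "\<bar>x\<bar> \<le> \<bar>1 + x\<^sup>2\<bar>" for x :: real
      using sum_squares_bound[of 1 "\<bar>x\<bar>"] by simp
    then show "AE r in lebesgue_on {0<..<T}. norm (H1_norm \<Omega> (p r)) \<le> norm (1 + (H1_norm \<Omega> (p r))\<^sup>2)"
      by simp
  qed
qed

text \<open>
  Measurability comes from the strong measurability in the Bochner space: along the approximating
  simple functions the Dirichlet form is simple, and it converges almost everywhere.
\<close>

lemma dirichlet_integrable_in_time:
  assumes p: "p \<in> solution_space T \<Omega>" and h: "h \<in> H10 \<Omega>"
  shows "integrable (lebesgue_on {0<..<T}) (\<lambda>r. dirichlet (p r) h)"
proof (rule Bochner_Integration.integrable_bound[OF integrable_mult_left[OF solution_space_H1_norm[OF p], of "H1_norm \<Omega> h"]])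
  obtain s where s: "\<And>k. simple_function (lebesgue_on {0<..<T}) (s k)"
    "\<And>k t. t \<in> {0<..<T} \<Longrightarrow> s k t \<in> H10 \<Omega>"
    "AE t in lebesgue_on {0<..<T}. (\<lambda>k. H1_norm \<Omega> (\<lambda>x. s k t x - p t x)) \<longlonglongrightarrow> 0"
    using p unfolding solution_space_def bochner_L2_def by blast
  show "(\<lambda>r. dirichlet (p r) h) \<in> borel_measurable (lebesgue_on {0<..<T})"
  proof (rule lebesgue_on_measurable_AE_limit)
    show "(\<lambda>r. dirichlet (s k r) h) \<in> borel_measurable (lebesgue_on {0<..<T})" for k
      using simple_function_compose1[OF s(1)[of k], of "\<lambda>g. dirichlet g h"]
      by (intro borel_measurable_simple_function)
    have "AE t in lebesgue_on {0<..<T}. t \<in> {0<..<T}" by (rule AE_I2) simp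
    with s(3) solution_space_H10[OF p]
    show "AE r in lebesgue_on {0<..<T}. (\<lambda>k. dirichlet (s k r) h) \<longlonglongrightarrow> dirichlet (p r) h"
    proof eventually_elim
      case (elim r)
      have bound: "\<bar>dirichlet (s k r) h - dirichlet (p r) h\<bar> \<le> H1_norm \<Omega> (\<lambda>x. s k r x - p r x) * H1_norm \<Omega> h" for k
      proof -
        have "dirichlet (\<lambda>x. s k r x - p r x) h = dirichlet (s k r) h - dirichlet (p r) h"
          using dirichlet_lincomb_left[OF H10_H1[OF s(2)[OF elim(3), of k]] H10_H1[OF elim(2)] H10_H1[OF h], of "-1"] by simp
        then show ?thesis
          using dirichlet_cauchy_schwarz[OF H10_H1[OF H10_diff[OF s(2)[OF elim(3), of k] elim(2)]] H10_H1[OF h]] by simp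
      qed
      have "(\<lambda>k. dirichlet (s k r) h - dirichlet (p r) h) \<longlonglongrightarrow> 0"
        by (rule Lim_null_comparison[OF _ tendsto_mult_left_zero[OF elim(1), of "H1_norm \<Omega> h"]]) (use bound in auto)
      then show ?case by (simp add: LIM_zero_iff)
    qed
  qed auto
  show "AE r in lebesgue_on {0<..<T}. norm (dirichlet (p r) h) \<le> norm (H1_norm \<Omega> (p r) * H1_norm \<Omega> h)"
    using solution_space_H10[OF p]
    by eventually_elim (use dirichlet_cauchy_schwarz h in \<open>auto simp: H1_norm_nonneg abs_mult dest!: H10_H1\<close>)
qed

text \<open>
  The form in which continuity into \<open>L\<^sup>2\<close> passes to all scalar quantities below.
\<close>

lemma continuous_on_of_L2_modulus:
  fixes G :: "real \<Rightarrow> real"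
  assumes p: "p \<in> C_time_L2 T \<Omega>"
    and mod: "\<And>s t. s \<in> {0..<T} \<Longrightarrow> t \<in> {0..<T} \<Longrightarrow> \<bar>G s - G t\<bar> \<le> C * L2_norm \<Omega> (\<lambda>x. p s x - p t x)"
  shows "continuous_on {0..<T} G"
  unfolding continuous_on_def
proof
  fix t assume t: "t \<in> {0..<T}"
  have "((\<lambda>s. G s - G t) \<longlongrightarrow> 0) (at t within {0..<T})"
    by (rule Lim_null_comparison[OF _ tendsto_mult_right_zero[OF C_time_L2_tendsto[OF p t], of C]])
      (use mod t in \<open>auto simp: eventually_at_filter\<close>)
  then show "(G \<longlongrightarrow> G t) (at t within {0..<T})" by (simp add: LIM_zero_iff)
qed

lemma continuous_on_L2_inner_time:
  assumes p: "p \<in> C_time_L2 T \<Omega>" and k: "k \<in> L2 \<Omega>"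
  shows "continuous_on {0..<T} (\<lambda>t. L2_inner \<Omega> (p t) k)"
proof (rule continuous_on_of_L2_modulus[OF p, where C = "L2_norm \<Omega> k"])
  fix s t assume "s \<in> {0..<T}" "t \<in> {0..<T}"
  then have st: "p s \<in> L2 \<Omega>" "p t \<in> L2 \<Omega>" using C_time_L2_in_L2[OF p] by auto
  show "\<bar>L2_inner \<Omega> (p s) k - L2_inner \<Omega> (p t) k\<bar> \<le> L2_norm \<Omega> k * L2_norm \<Omega> (\<lambda>x. p s x - p t x)"
    using L2_cauchy_schwarz[OF L2_diff[OF st] k] L2_inner_diff_left[OF st k] by (simp add: mult.commute)
qed

lemma continuous_on_L2_norm_time:
  assumes p: "p \<in> C_time_L2 T \<Omega>"
  shows "continuous_on {0..<T} (\<lambda>t. L2_norm \<Omega> (p t))"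
proof (rule continuous_on_of_L2_modulus[OF p, where C = 1])
  fix s t assume "s \<in> {0..<T}" "t \<in> {0..<T}"
  then have st: "p s \<in> L2 \<Omega>" "p t \<in> L2 \<Omega>" using C_time_L2_in_L2[OF p] by auto
  have "L2_norm \<Omega> (p s) \<le> L2_norm \<Omega> (p t) + L2_norm \<Omega> (\<lambda>x. p s x - p t x)"
    using L2_norm_lincomb_le[OF st(2) L2_diff[OF st], of 1] by simp
  moreover have "L2_norm \<Omega> (p t) \<le> L2_norm \<Omega> (p s) + L2_norm \<Omega> (\<lambda>x. p s x - p t x)"
    using L2_norm_lincomb_le[OF st(1) L2_diff[OF st], of "-1"] by simp
  ultimately show "\<bar>L2_norm \<Omega> (p s) - L2_norm \<Omega> (p t)\<bar> \<le> 1 * L2_norm \<Omega> (\<lambda>x. p s x - p t x)"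
    by simp
qed

text \<open>
  Heine-Cantor for the \<open>L\<^sup>2\<close> seminorm, by a Lebesgue number of the covering of \<open>[0,\<tau>]\<close>.
\<close>

lemma C_time_L2_uniformly_continuous:
  assumes p: "p \<in> C_time_L2 T \<Omega>" and "\<tau> < T" and "e > 0"
  obtains \<delta> where "\<delta> > 0"
    and "\<And>s t. s \<in> {0..\<tau>} \<Longrightarrow> t \<in> {0..\<tau>} \<Longrightarrow> \<bar>s - t\<bar> < \<delta> \<Longrightarrow> L2_norm \<Omega> (\<lambda>x. p t x - p s x) \<le> e"
proof -
  have "\<exists>\<rho>>0. \<forall>s\<in>{0..<T}. dist s c < \<rho> \<longrightarrow> L2_norm \<Omega> (\<lambda>x. p s x - p c x) < e / 2" if "c \<in> {0..\<tau>}" for c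
  proof -
    have c: "c \<in> {0..<T}" using that \<open>\<tau> < T\<close> by auto
    have "\<forall>\<^sub>F s in at c within {0..<T}. L2_norm \<Omega> (\<lambda>x. p s x - p c x) < e / 2"
      using order_tendstoD(2)[OF C_time_L2_tendsto[OF p c], of "e / 2"] \<open>e > 0\<close> by simp
    then obtain \<rho> where "\<rho> > 0" "\<forall>s\<in>{0..<T}. s \<noteq> c \<and> dist s c < \<rho> \<longrightarrow> L2_norm \<Omega> (\<lambda>x. p s x - p c x) < e / 2"
      unfolding eventually_at by blast
    moreover have "L2_norm \<Omega> (\<lambda>x. p c x - p c x) < e / 2"
      using \<open>e > 0\<close> by (simp add: L2_norm_def L2_inner_def)
    ultimately show ?thesis by metis
  qed
  then obtain \<rho> where \<rho>: "\<And>c. c \<in> {0..\<tau>} \<Longrightarrow> \<rho> c > 0"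
    "\<And>c s. c \<in> {0..\<tau>} \<Longrightarrow> s \<in> {0..<T} \<Longrightarrow> dist s c < \<rho> c \<Longrightarrow> L2_norm \<Omega> (\<lambda>x. p s x - p c x) < e / 2"
    by metis
  have "{0..\<tau>} \<subseteq> (\<Union>c\<in>{0..\<tau>}. ball c (\<rho> c))" using \<rho>(1) by force
  then obtain \<delta> where \<delta>: "\<delta> > 0"
    "\<And>s. s \<in> {0..\<tau>} \<Longrightarrow> \<exists>G\<in>(\<lambda>c. ball c (\<rho> c)) ` {0..\<tau>}. ball s \<delta> \<subseteq> G"
  proof (rule Heine_Borel_lemma[OF compact_Icc])
    show "open G" if "G \<in> (\<lambda>c. ball c (\<rho> c)) ` {0..\<tau>}" for G using that by auto
  qed blast
  have "L2_norm \<Omega> (\<lambda>x. p t x - p s x) \<le> e" if s: "s \<in> {0..\<tau>}" and t: "t \<in> {0..\<tau>}" and "\<bar>s - t\<bar> < \<delta>" for s t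
  proof -
    obtain c where c: "c \<in> {0..\<tau>}" "ball s \<delta> \<subseteq> ball c (\<rho> c)" using \<delta>(2)[OF s] by auto
    have "s \<in> ball s \<delta>" "t \<in> ball s \<delta>" using \<delta>(1) that by (auto simp: dist_real_def)
    then have "s \<in> ball c (\<rho> c)" "t \<in> ball c (\<rho> c)" using c(2) by blast+
    then have d: "dist s c < \<rho> c" "dist t c < \<rho> c" by (simp_all add: dist_commute)
    have T: "s \<in> {0..<T}" "t \<in> {0..<T}" "c \<in> {0..<T}" using s t c \<open>\<tau> < T\<close> by auto
    have "(\<lambda>x. p t x - p s x) = (\<lambda>x. (p t x - p c x) - (p s x - p c x))" by auto
    then have "L2_norm \<Omega> (\<lambda>x. p t x - p s x) \<le> L2_norm \<Omega> (\<lambda>x. p t x - p c x) + L2_norm \<Omega> (\<lambda>x. p s x - p c x)"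
      using L2_norm_diff_le[OF L2_diff L2_diff, of "p t" \<Omega> "p c" "p s" "p c"] C_time_L2_in_L2[OF p] T by simp
    then show ?thesis using \<rho>(2)[OF c(1) T(1) d(1)] \<rho>(2)[OF c(1) T(2) d(2)] by simp
  qed
  then show ?thesis using that \<delta>(1) by blast
qed

lemma weak_equation_imp_increment:
  assumes p: "p \<in> solution_space T \<Omega>" and A: "continuous_on {0..<T} A"
    and q: "continuous_on {0..<T} (\<lambda>t. L2_inner \<Omega> (q t) h)" and h: "h \<in> H10 \<Omega>"
    and eq: "\<And>\<psi>. test_function {0<..<T} \<psi> \<Longrightarrow>
      dist_deriv T (\<lambda>t. L2_inner \<Omega> (p t) h) \<psi> + dist_of T (\<lambda>t. A t * dirichlet (p t) h) \<psi>
      = dist_of T (\<lambda>t. L2_inner \<Omega> (q t) h) \<psi>"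
  shows "locally_integrable T (\<lambda>r. L2_inner \<Omega> (q r) h - A r * dirichlet (p r) h)"
    and "0 \<le> s \<Longrightarrow> s \<le> t \<Longrightarrow> t < T \<Longrightarrow> L2_inner \<Omega> (p t) h - L2_inner \<Omega> (p s) h =
      (LINT r|lebesgue_on {0<..<T}. indicator {s<..t} r * (L2_inner \<Omega> (q r) h - A r * dirichlet (p r) h))"
proof -
  have li: "locally_integrable T (\<lambda>r. - A r * dirichlet (p r) h)"
    by (intro locally_integrable_mult_continuous continuous_on_minus A integrable_imp_locally_integrable
        dirichlet_integrable_in_time p h)
  show loc: "locally_integrable T (\<lambda>r. L2_inner \<Omega> (q r) h - A r * dirichlet (p r) h)"
    using locally_integrable_add[OF locally_integrable_continuous[OF q] li] by simp
  assume st: "0 \<le> s" "s \<le> t" "t < T"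
  show "L2_inner \<Omega> (p t) h - L2_inner \<Omega> (p s) h =
      (LINT r|lebesgue_on {0<..<T}. indicator {s<..t} r * (L2_inner \<Omega> (q r) h - A r * dirichlet (p r) h))"
  proof (rule distributional_derivative_imp_increment)
    show "dist_deriv T (\<lambda>t. L2_inner \<Omega> (p t) h) \<psi> = dist_of T (\<lambda>r. L2_inner \<Omega> (q r) h - A r * dirichlet (p r) h) \<psi>"
      if \<psi>: "test_function {0<..<T} \<psi>" for \<psi>
    proof -
      have "dist_of T (\<lambda>r. L2_inner \<Omega> (q r) h - A r * dirichlet (p r) h) \<psi> =
          (LINT r|lebesgue_on {0<..<T}. L2_inner \<Omega> (q r) h * \<psi> r + (- A r * dirichlet (p r) h) * \<psi> r)"
        by (simp add: dist_of_def algebra_simps)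
      also have "\<dots> = dist_of T (\<lambda>t. L2_inner \<Omega> (q t) h) \<psi> - dist_of T (\<lambda>t. A t * dirichlet (p t) h) \<psi>"
        using locally_integrable_mult_test_function[OF locally_integrable_continuous[OF q] \<psi>]
          locally_integrable_mult_test_function[OF li \<psi>] by (simp add: dist_of_def)
      finally show ?thesis using eq[OF \<psi>] by simp
    qed
  qed (use st loc continuous_on_L2_inner_time[OF solution_space_C_time_L2[OF p] H10_L2[OF h]] in \<open>simp_all add: locally_integrable_def\<close>)
qed

end

section \<open>The energy estimate for one component\<close>

text \<open>
  The pointwise inequality of the energy estimate.  Here \<open>Z\<close> and \<open>W\<close> stand for the \<open>L\<^sup>2\<close> norms of the two
  differences, \<open>D\<close> and \<open>D'\<close> for the Dirichlet forms of the difference and of the second solution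
  with the test function, \<open>n\<close> and \<open>P\<close> for \<open>H\<^sup>1\<close> norms of the test function and of the second solution.
  Of the dissipation \<open>m Z\<^sup>2\<close>, Young's inequality spends one half on the terms with the factor \<open>Z\<close>;
  the other half remains to cancel \<open>m/2 W\<^sup>2\<close> in the estimate of the other component.
\<close>

lemma dissipation_absorbs_coupling:
  fixes m A A' B D D' K \<Lambda> P Q W Z \<eta> n r :: real
  assumes "0 < m" "m \<le> A" "A \<le> B" "0 \<le> K" "0 \<le> \<Lambda>" "0 \<le> P" "0 \<le> W" "0 \<le> Z" "0 \<le> \<eta>" "0 \<le> n" "0 \<le> r"
    and D: "Z\<^sup>2 - \<eta> * Z - r - Z * n \<le> D" and A': "\<bar>A - A'\<bar> \<le> \<Lambda> * Z" and D': "\<bar>D'\<bar> \<le> P * n"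
    and Q: "Q \<le> K * (Z + W) * n"
  shows "Q - A * D - (A - A') * D' \<le> m / 2 * W\<^sup>2 - m / 2 * Z\<^sup>2
    + n\<^sup>2 * (((B + K)\<^sup>2 + \<Lambda>\<^sup>2 * P\<^sup>2) / m + K\<^sup>2 / (2 * m)) + B * (\<eta> * Z + r)"
proof -
  have young: "x * y \<le> m / 2 * x\<^sup>2 + y\<^sup>2 / (2 * m)" for x y
  proof -
    have "0 \<le> (m * x - y)\<^sup>2 / (2 * m)" using \<open>0 < m\<close> by simp
    also have "\<dots> = m / 2 * x\<^sup>2 + y\<^sup>2 / (2 * m) - x * y"
      using \<open>0 < m\<close> by (simp add: power2_eq_square field_simps)
    finally show ?thesis by simp
  qed
  have "A * (Z\<^sup>2 - \<eta> * Z - r - Z * n) \<le> A * D" using assms by (intro mult_left_mono) auto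
  moreover have "A * (\<eta> * Z + r + Z * n) \<le> B * (\<eta> * Z + r + Z * n)" using assms by (intro mult_right_mono) auto
  moreover have "m * Z\<^sup>2 \<le> A * Z\<^sup>2" using assms by (intro mult_right_mono) auto
  ultimately have 1: "- (A * D) \<le> - (m * Z\<^sup>2) + B * (\<eta> * Z + r) + Z * (B * n)"
    by (simp add: algebra_simps)
  have "\<bar>(A - A') * D'\<bar> \<le> \<Lambda> * Z * (P * n)"
    unfolding abs_mult using assms by (intro mult_mono) auto
  then have 2: "- ((A - A') * D') \<le> Z * (\<Lambda> * P * n)" by (simp add: mult_ac)
  have 3: "Q \<le> Z * (K * n) + W * (K * n)" using Q by (simp add: algebra_simps)
  have 4: "Z * ((B + K + \<Lambda> * P) * n) \<le> m / 2 * Z\<^sup>2 + n\<^sup>2 * ((B + K)\<^sup>2 + \<Lambda>\<^sup>2 * P\<^sup>2) / m"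
  proof -
    have "(x + y)\<^sup>2 \<le> 2 * (x\<^sup>2 + y\<^sup>2)" for x y :: real
      using sum_squares_bound[of x y] by (simp add: power2_sum)
    then have "(B + K + \<Lambda> * P)\<^sup>2 \<le> 2 * ((B + K)\<^sup>2 + \<Lambda>\<^sup>2 * P\<^sup>2)"
      unfolding power_mult_distrib[symmetric] .
    then have "((B + K + \<Lambda> * P) * n)\<^sup>2 / (2 * m) \<le> 2 * ((B + K)\<^sup>2 + \<Lambda>\<^sup>2 * P\<^sup>2) * n\<^sup>2 / (2 * m)"
      using \<open>0 < m\<close> unfolding power_mult_distrib by (intro divide_right_mono mult_right_mono) auto
    also have "\<dots> = n\<^sup>2 * ((B + K)\<^sup>2 + \<Lambda>\<^sup>2 * P\<^sup>2) / m"
      using \<open>0 < m\<close> by (simp add: field_simps)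
    finally show ?thesis using young[of Z "(B + K + \<Lambda> * P) * n"] by linarith
  qed
  have 5: "W * (K * n) \<le> m / 2 * W\<^sup>2 + n\<^sup>2 * K\<^sup>2 / (2 * m)"
    using young[of W "K * n"] by (simp add: power_mult_distrib mult_ac)
  have "Q - A * D - (A - A') * D' \<le> - (m * Z\<^sup>2) + B * (\<eta> * Z + r) + Z * ((B + K + \<Lambda> * P) * n) + W * (K * n)"
    using 1 2 3 by (simp add: algebra_simps)
  also have "\<dots> \<le> - (m * Z\<^sup>2) + B * (\<eta> * Z + r) + (m / 2 * Z\<^sup>2 + n\<^sup>2 * ((B + K)\<^sup>2 + \<Lambda>\<^sup>2 * P\<^sup>2) / m)
      + (m / 2 * W\<^sup>2 + n\<^sup>2 * K\<^sup>2 / (2 * m))"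
    using 4 5 by simp
  also have "\<dots> = m / 2 * W\<^sup>2 - m / 2 * Z\<^sup>2
    + n\<^sup>2 * (((B + K)\<^sup>2 + \<Lambda>\<^sup>2 * P\<^sup>2) / m + K\<^sup>2 / (2 * m)) + B * (\<eta> * Z + r)"
    by (simp add: algebra_simps)
  finally show ?thesis .
qed

context bounded_open
begin

text \<open>
  The energy estimate for one component on a time interval so short that the difference \<open>z\<close> moves by
  at most \<open>\<eta>\<close> in \<open>L\<^sup>2\<close>.  The test function is an \<open>\<epsilon>\<close>-near maximizer at the right end point \<open>t\<close>; all errors in
  \<open>\<epsilon>\<close> vanish as \<open>\<epsilon> \<rightarrow> 0\<close> with \<open>s\<close> and \<open>t\<close> fixed.
\<close>

lemma dual_energy_increment:
  fixes A A' W :: "real \<Rightarrow> real" and p p' q q' :: "real \<Rightarrow> 'a \<Rightarrow> real" and B K \<Lambda> m :: real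
  defines "z \<equiv> \<lambda>r x. p r x - p' r x"
  defines "\<mu> \<equiv> \<lambda>r. ((B + K)\<^sup>2 + \<Lambda>\<^sup>2 * (H1_norm \<Omega> (p' r))\<^sup>2) / m + K\<^sup>2 / (2 * m)"
  assumes p: "p \<in> solution_space T \<Omega>" and p': "p' \<in> solution_space T \<Omega>"
    and A: "continuous_on {0..<T} A" and A': "continuous_on {0..<T} A'" and W: "continuous_on {0..<T} W"
    and q: "q \<in> C_time_L2 T \<Omega>" and q': "q' \<in> C_time_L2 T \<Omega>"
    and eq: "\<And>h \<psi>. h \<in> H10 \<Omega> \<Longrightarrow> test_function {0<..<T} \<psi> \<Longrightarrow>
      dist_deriv T (\<lambda>t. L2_inner \<Omega> (p t) h) \<psi> + dist_of T (\<lambda>t. A t * dirichlet (p t) h) \<psi>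
      = dist_of T (\<lambda>t. L2_inner \<Omega> (q t) h) \<psi>"
    and eq': "\<And>h \<psi>. h \<in> H10 \<Omega> \<Longrightarrow> test_function {0<..<T} \<psi> \<Longrightarrow>
      dist_deriv T (\<lambda>t. L2_inner \<Omega> (p' t) h) \<psi> + dist_of T (\<lambda>t. A' t * dirichlet (p' t) h) \<psi>
      = dist_of T (\<lambda>t. L2_inner \<Omega> (q' t) h) \<psi>"
    and pos: "0 < m" "0 \<le> K" "0 \<le> \<Lambda>" and st: "0 \<le> s" "s \<le> t" "t < T"
    and A_ge: "\<And>r. r \<in> {s<..t} \<Longrightarrow> m \<le> A r" and A_le: "\<And>r. r \<in> {s<..t} \<Longrightarrow> A r \<le> B"
    and A_diff: "\<And>r. r \<in> {s<..t} \<Longrightarrow> \<bar>A r - A' r\<bar> \<le> \<Lambda> * L2_norm \<Omega> (z r)"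
    and W0: "\<And>r. r \<in> {s<..t} \<Longrightarrow> 0 \<le> W r"
    and q_diff: "\<And>r. r \<in> {s<..t} \<Longrightarrow> L2_norm \<Omega> (\<lambda>x. q r x - q' r x) \<le> K * (L2_norm \<Omega> (z r) + W r)"
    and \<eta>: "0 \<le> \<eta>" "\<And>r. r \<in> {s<..t} \<Longrightarrow> L2_norm \<Omega> (\<lambda>x. z t x - z r x) \<le> \<eta>"
  shows "dual_energy (z t) - dual_energy (z s) \<le>
      (LINT r|lebesgue_on {0<..<T}. indicator {s<..t} r * (m / 2 * (W r)\<^sup>2 - m / 2 * (L2_norm \<Omega> (z r))\<^sup>2
        + 4 * dual_energy (z t) * \<mu> r + B * \<eta> * L2_norm \<Omega> (z r)))"
proof -
  let ?M = "lebesgue_on {0<..<T}"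
  define I where "I F = (LINT r|?M. indicator {s<..t} r * F r)" for F :: "real \<Rightarrow> real"
  define Z where "Z r = L2_norm \<Omega> (z r)" for r
  define R where "R r = H1_norm \<Omega> (p r) + H1_norm \<Omega> (p' r)" for r
  define E where "E r = m / 2 * (W r)\<^sup>2 - m / 2 * (Z r)\<^sup>2 + 4 * dual_energy (z t) * \<mu> r + B * \<eta> * Z r" for r
  have zC: "z \<in> C_time_L2 T \<Omega>"
    unfolding z_def using p p' by (intro C_time_L2_diff solution_space_C_time_L2)
  have zL2: "z r \<in> L2 \<Omega>" if "r \<in> {0..<T}" for r using C_time_L2_in_L2[OF zC that] .
  have Zc: "continuous_on {0..<T} Z" unfolding Z_def by (rule continuous_on_L2_norm_time[OF zC])
  interpret time: finite_measure ?M by (rule finite_measure_time)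
  have \<mu>i: "integrable ?M \<mu>"
    unfolding \<mu>_def using solution_space_H1_norm_square[OF p'] by simp
  have Ri: "locally_integrable T R"
    unfolding R_def using solution_space_H1_norm[OF p] solution_space_H1_norm[OF p']
    by (intro locally_integrable_add integrable_imp_locally_integrable)
  have Ei: "locally_integrable T E"
  proof -
    have "locally_integrable T (\<lambda>r. (m / 2 * (W r)\<^sup>2 - m / 2 * (Z r)\<^sup>2 + B * \<eta> * Z r) + 4 * dual_energy (z t) * \<mu> r)"
      using \<mu>i by (intro locally_integrable_add locally_integrable_continuous continuous_intros W Zc
          integrable_imp_locally_integrable integrable_mult_right)
    then show ?thesis by (simp add: E_def[abs_def] algebra_simps)
  qed
  have int: "integrable ?M (\<lambda>r. indicator {s<..t} r * F r)" if "locally_integrable T F" for F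
    using locally_integrableD[OF that st(1,3)] .
  have \<mu>0: "0 \<le> \<mu> r" for r using pos by (simp add: \<mu>_def)
  have approx: "dual_energy (z t) - dual_energy (z s) \<le> \<epsilon> + I E + 8 * \<epsilon> * I \<mu> + B * sqrt (2 * \<epsilon>) * I R"
    if \<epsilon>: "\<epsilon> > 0" for \<epsilon>
  proof -
    have ztL2: "z t \<in> L2 \<Omega>" and zsL2: "z s \<in> L2 \<Omega>" using zL2 st by auto
    obtain h where h: "h \<in> H10 \<Omega>" and hmax: "dual_energy (z t) - \<epsilon> < L2_inner \<Omega> (z t) h - (H1_norm \<Omega> h)\<^sup>2 / 2"
      and hriesz: "\<And>k. k \<in> H10 \<Omega> \<Longrightarrow> \<bar>L2_inner \<Omega> (z t) k - H1_inner h k\<bar> \<le> sqrt (2 * \<epsilon>) * H1_norm \<Omega> k"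
      and hnorm: "(H1_norm \<Omega> h)\<^sup>2 \<le> 4 * dual_energy (z t) + 8 * \<epsilon>"
      using dual_energy_near_maximizer[OF ztL2 \<epsilon>] by blast
    note hL2 = H10_L2[OF h] and hH1 = H10_H1[OF h]
    define F1 where "F1 r = L2_inner \<Omega> (q r) h - A r * dirichlet (p r) h" for r
    define F2 where "F2 r = L2_inner \<Omega> (q' r) h - A' r * dirichlet (p' r) h" for r
    define F where "F r = F1 r - F2 r" for r
    have inc: "locally_integrable T F1" "L2_inner \<Omega> (p t) h - L2_inner \<Omega> (p s) h = I F1"
      using weak_equation_imp_increment(1)[OF p A continuous_on_L2_inner_time[OF q hL2] h eq[OF h]]
        weak_equation_imp_increment(2)[OF p A continuous_on_L2_inner_time[OF q hL2] h eq[OF h], of s t] st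
      unfolding F1_def I_def by simp_all
    have inc': "locally_integrable T F2" "L2_inner \<Omega> (p' t) h - L2_inner \<Omega> (p' s) h = I F2"
      using weak_equation_imp_increment(1)[OF p' A' continuous_on_L2_inner_time[OF q' hL2] h eq'[OF h]]
        weak_equation_imp_increment(2)[OF p' A' continuous_on_L2_inner_time[OF q' hL2] h eq'[OF h], of s t] st
      unfolding F2_def I_def by simp_all
    have Fi: "integrable ?M (\<lambda>r. indicator {s<..t} r * F r)"
      unfolding F_def right_diff_distrib using int[OF inc(1)] int[OF inc'(1)]
      by (rule Bochner_Integration.integrable_diff)
    have "L2_inner \<Omega> (z t) h - L2_inner \<Omega> (z s) h
        = (L2_inner \<Omega> (p t) h - L2_inner \<Omega> (p s) h) - (L2_inner \<Omega> (p' t) h - L2_inner \<Omega> (p' s) h)"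
      using L2_inner_diff_left[of "p t" \<Omega> "p' t" h] L2_inner_diff_left[of "p s" \<Omega> "p' s" h] hL2 st
        C_time_L2_in_L2[OF solution_space_C_time_L2[OF p]] C_time_L2_in_L2[OF solution_space_C_time_L2[OF p']]
      by (simp add: z_def)
    also have "\<dots> = I F"
      unfolding inc(2) inc'(2) I_def F_def
      using int[OF inc(1)] int[OF inc'(1)] by (simp add: right_diff_distrib)
    finally have "L2_inner \<Omega> (z t) h - L2_inner \<Omega> (z s) h = I F" .
    then have "dual_energy (z t) - dual_energy (z s) \<le> \<epsilon> + I F"
      using hmax dual_energy_upper[OF zsL2 h] by simp
    also have "I F \<le> I (\<lambda>r. E r + 8 * \<epsilon> * \<mu> r + B * sqrt (2 * \<epsilon>) * R r)"
      unfolding I_def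
    proof (rule integral_mono_AE[OF Fi])
      have "locally_integrable T (\<lambda>r. 8 * \<epsilon> * \<mu> r)" "locally_integrable T (\<lambda>r. B * sqrt (2 * \<epsilon>) * R r)"
        using locally_integrable_mult_continuous[OF continuous_on_const Ri]
          locally_integrable_mult_continuous[OF continuous_on_const integrable_imp_locally_integrable[OF \<mu>i]] by auto
      then show "integrable ?M (\<lambda>r. indicator {s<..t} r * (E r + 8 * \<epsilon> * \<mu> r + B * sqrt (2 * \<epsilon>) * R r))"
        using Ei by (intro int locally_integrable_add)
      show "AE r in ?M. indicator {s<..t} r * F r \<le> indicator {s<..t} r * (E r + 8 * \<epsilon> * \<mu> r + B * sqrt (2 * \<epsilon>) * R r)"
        using solution_space_H10[OF p] solution_space_H10[OF p']
      proof eventually_elim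
        case (elim r)
        show ?case
        proof (cases "r \<in> {s<..t}")
          case r: True
          then have rT: "r \<in> {0..<T}" using st by auto
          have zr: "z r \<in> H10 \<Omega>" unfolding z_def by (rule H10_diff[OF elim])
          have Nz: "H1_norm \<Omega> (z r) \<le> R r"
            using H1_norm_lincomb_le[OF H10_H1[OF elim(1)] H10_H1[OF elim(2)], of "-1"] by (simp add: z_def R_def)
          \<comment> \<open>in \<open>F\<close>, the difference \<open>A - A'\<close> then multiplies the form of \<open>p'\<close>, and \<open>A\<close> that of \<open>z\<close>\<close>
          have Dz: "dirichlet (p r) h = dirichlet (z r) h + dirichlet (p' r) h"
            using dirichlet_lincomb_left[OF H10_H1[OF elim(1)] H10_H1[OF elim(2)] hH1, of "-1"] by (simp add: z_def)
          have qL2: "q r \<in> L2 \<Omega>" "q' r \<in> L2 \<Omega>" using C_time_L2_in_L2 q q' rT by auto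
          have Qd: "L2_inner \<Omega> (\<lambda>x. q r x - q' r x) h = L2_inner \<Omega> (q r) h - L2_inner \<Omega> (q' r) h"
            by (rule L2_inner_diff_left[OF qL2 hL2])
          have Q: "L2_inner \<Omega> (\<lambda>x. q r x - q' r x) h \<le> K * (Z r + W r) * H1_norm \<Omega> h"
          proof -
            have "L2_inner \<Omega> (\<lambda>x. q r x - q' r x) h \<le> L2_norm \<Omega> (\<lambda>x. q r x - q' r x) * L2_norm \<Omega> h"
              using L2_cauchy_schwarz[OF L2_diff[OF qL2] hL2] by simp
            also have "\<dots> \<le> K * (Z r + W r) * H1_norm \<Omega> h"
              using q_diff[OF r] by (intro mult_mono') (auto simp: Z_def L2_norm_nonneg L2_norm_le_H1_norm)
            finally show ?thesis .
          qed
          \<comment> \<open>replace \<open>(\<nabla>z,\<nabla>h)\<close> by \<open>(z(t),z(r)) - (z(r),h)\<close>, and \<open>z(t)\<close> by \<open>z(r)\<close>\<close>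
          have D: "(Z r)\<^sup>2 - \<eta> * Z r - sqrt (2 * \<epsilon>) * R r - Z r * H1_norm \<Omega> h \<le> dirichlet (z r) h"
          proof -
            have "L2_inner \<Omega> (z t) (z r) - sqrt (2 * \<epsilon>) * R r \<le> H1_inner h (z r)"
            proof -
              have "sqrt (2 * \<epsilon>) * H1_norm \<Omega> (z r) \<le> sqrt (2 * \<epsilon>) * R r"
                using Nz \<epsilon> by (intro mult_left_mono) auto
              then show ?thesis using hriesz[OF zr] by linarith
            qed
            moreover have "(Z r)\<^sup>2 - \<eta> * Z r \<le> L2_inner \<Omega> (z t) (z r)"
            proof -
              have "- L2_inner \<Omega> (\<lambda>x. z t x - z r x) (z r) \<le> L2_norm \<Omega> (\<lambda>x. z t x - z r x) * Z r"
                using L2_cauchy_schwarz[OF L2_diff[OF ztL2 zL2[OF rT]] zL2[OF rT]] by (simp add: Z_def)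
              also have "\<dots> \<le> \<eta> * Z r" using \<eta>(2)[OF r] by (intro mult_right_mono) (auto simp: Z_def L2_norm_nonneg)
              finally show ?thesis
                using L2_inner_diff_left[OF ztL2 zL2[OF rT] zL2[OF rT]] by (simp add: Z_def L2_norm_square)
            qed
            moreover have "H1_inner h (z r) = L2_inner \<Omega> (z r) h + dirichlet (z r) h"
              by (simp add: H1_inner_def L2_inner_commute[of _ h] dirichlet_commute[of h])
            moreover have "L2_inner \<Omega> (z r) h \<le> Z r * H1_norm \<Omega> h"
              using L2_cauchy_schwarz[OF zL2[OF rT] hL2] mult_left_mono[OF L2_norm_le_H1_norm[of h], of "Z r"]
              by (simp add: Z_def L2_norm_nonneg)
            ultimately show ?thesis by linarith
          qed
          have "F r = L2_inner \<Omega> (\<lambda>x. q r x - q' r x) h - A r * dirichlet (z r) h - (A r - A' r) * dirichlet (p' r) h"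
            unfolding F_def F1_def F2_def Dz Qd by (simp add: algebra_simps)
          also have "\<dots> \<le> m / 2 * (W r)\<^sup>2 - m / 2 * (Z r)\<^sup>2 + (H1_norm \<Omega> h)\<^sup>2 * \<mu> r
              + B * (\<eta> * Z r + sqrt (2 * \<epsilon>) * R r)"
            unfolding \<mu>_def
            using pos A_ge[OF r] A_le[OF r] W0[OF r] \<eta>(1) D A_diff[OF r] Q \<epsilon>
              dirichlet_cauchy_schwarz[OF H10_H1[OF elim(2)] hH1]
            by (intro dissipation_absorbs_coupling)
              (auto simp: Z_def R_def L2_norm_nonneg H1_norm_nonneg)
          also have "\<dots> \<le> E r + 8 * \<epsilon> * \<mu> r + B * sqrt (2 * \<epsilon>) * R r"
            using mult_right_mono[OF hnorm \<mu>0[of r]] by (simp add: E_def algebra_simps)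
          finally show ?thesis using r by simp
        qed simp
      qed
    qed
    also have "I (\<lambda>r. E r + 8 * \<epsilon> * \<mu> r + B * sqrt (2 * \<epsilon>) * R r) = I E + 8 * \<epsilon> * I \<mu> + B * sqrt (2 * \<epsilon>) * I R"
    proof -
      have "I (\<lambda>r. E r + 8 * \<epsilon> * \<mu> r + B * sqrt (2 * \<epsilon>) * R r) =
          (LINT r|?M. indicator {s<..t} r * E r + 8 * \<epsilon> * (indicator {s<..t} r * \<mu> r)
            + B * sqrt (2 * \<epsilon>) * (indicator {s<..t} r * R r))"
        by (simp add: I_def algebra_simps)
      also have "\<dots> = I E + 8 * \<epsilon> * I \<mu> + B * sqrt (2 * \<epsilon>) * I R"
        unfolding I_def using int[OF Ei] int[OF Ri] int[OF integrable_imp_locally_integrable[OF \<mu>i]] by simp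
      finally show ?thesis .
    qed
    finally show ?thesis by simp
  qed
  have "dual_energy (z t) - dual_energy (z s) \<le> I E"
  proof (rule tendsto_lowerbound)
    have "((\<lambda>\<epsilon>. \<epsilon> + I E + 8 * \<epsilon> * I \<mu> + B * sqrt (2 * \<epsilon>) * I R)
        \<longlongrightarrow> 0 + I E + 8 * 0 * I \<mu> + B * sqrt (2 * 0) * I R) (at_right 0)"
      by (intro tendsto_intros)
    then show "((\<lambda>\<epsilon>. \<epsilon> + I E + 8 * \<epsilon> * I \<mu> + B * sqrt (2 * \<epsilon>) * I R) \<longlongrightarrow> I E) (at_right 0)" by simp
    show "\<forall>\<^sub>F \<epsilon> in at_right 0. dual_energy (z t) - dual_energy (z s) \<le> \<epsilon> + I E + 8 * \<epsilon> * I \<mu> + B * sqrt (2 * \<epsilon>) * I R"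
      using approx by (auto simp: eventually_at_filter)
  qed simp
  then show "dual_energy (z t) - dual_energy (z s) \<le>
      (LINT r|lebesgue_on {0<..<T}. indicator {s<..t} r * (m / 2 * (W r)\<^sup>2 - m / 2 * (L2_norm \<Omega> (z r))\<^sup>2
        + 4 * dual_energy (z t) * \<mu> r + B * \<eta> * L2_norm \<Omega> (z r)))"
    by (simp add: I_def E_def Z_def)
qed

end

section \<open>A discrete Gronwall argument\<close>

text \<open>
  With \<open>1 - x \<ge> exp (-2 x)\<close> for \<open>0 \<le> x \<le> 1/2\<close>, the hypothesis says that \<open>(Y + \<epsilon>) exp (-2 \<Lambda>)\<close> does not increase
  over short intervals, hence not over \<open>[0,t]\<close>; then let \<open>\<epsilon> \<rightarrow> 0\<close>.
\<close>

lemma gronwall_local_increment: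
  fixes Y \<Lambda> :: "real \<Rightarrow> real"
  assumes \<Lambda>: "continuous_on {0..\<tau>} \<Lambda>" and \<Lambda>mono: "mono_on {0..\<tau>} \<Lambda>"
    and Y0: "Y 0 = 0" and Ynn: "\<And>t. t \<in> {0..\<tau>} \<Longrightarrow> 0 \<le> Y t"
    and inc: "\<And>\<epsilon>. \<epsilon> > 0 \<Longrightarrow> \<exists>\<delta>>0. \<forall>s t. 0 \<le> s \<longrightarrow> s \<le> t \<longrightarrow> t \<le> \<tau> \<longrightarrow> t - s < \<delta> \<longrightarrow>
      Y t - Y s \<le> (Y t + \<epsilon>) * (\<Lambda> t - \<Lambda> s)"
    and t: "t \<in> {0..\<tau>}"
  shows "Y t = 0"
proof -
  have bound: "Y t \<le> \<epsilon> * exp (2 * (\<Lambda> t - \<Lambda> 0))" if \<epsilon>: "\<epsilon> > 0" for \<epsilon>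
  proof -
    obtain \<delta>1 where \<delta>1: "\<delta>1 > 0" "\<And>s t. 0 \<le> s \<Longrightarrow> s \<le> t \<Longrightarrow> t \<le> \<tau> \<Longrightarrow> t - s < \<delta>1 \<Longrightarrow>
      Y t - Y s \<le> (Y t + \<epsilon>) * (\<Lambda> t - \<Lambda> s)"
      using inc[OF \<epsilon>] by blast
    have "uniformly_continuous_on {0..\<tau>} \<Lambda>"
      by (rule compact_uniformly_continuous[OF \<Lambda> compact_Icc])
    then have "\<exists>\<delta>>0. \<forall>x\<in>{0..\<tau>}. \<forall>x'\<in>{0..\<tau>}. dist x' x < \<delta> \<longrightarrow> dist (\<Lambda> x') (\<Lambda> x) < 1 / 2"
      unfolding uniformly_continuous_on_def by (rule allE[of _ "1 / 2"]) simp
    then obtain \<delta>2 where \<delta>2: "\<delta>2 > 0" "\<And>x x'. x \<in> {0..\<tau>} \<Longrightarrow> x' \<in> {0..\<tau>} \<Longrightarrow> dist x' x < \<delta>2 \<Longrightarrow> dist (\<Lambda> x') (\<Lambda> x) < 1 / 2"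
      by blast
    define \<delta> where "\<delta> = min \<delta>1 \<delta>2"
    have \<delta>: "\<delta> > 0" using \<delta>1 \<delta>2 by (simp add: \<delta>_def)
    define \<Phi> where "\<Phi> t = (Y t + \<epsilon>) * exp (- 2 * \<Lambda> t)" for t
    have step: "\<Phi> t \<le> \<Phi> s" if st: "0 \<le> s" "s \<le> t" "t \<le> \<tau>" "t - s < \<delta>" for s t
    proof -
      define x where "x = \<Lambda> t - \<Lambda> s"
      have x: "0 \<le> x" "x \<le> 1 / 2"
        using mono_onD[OF \<Lambda>mono, of s t] \<delta>2(2)[of s t] st by (auto simp: x_def \<delta>_def dist_real_def)
      have "1 \<le> (1 - x) * (1 + 2 * x)"
      proof -
        have "0 \<le> x * (1 - 2 * x)" using x by (intro mult_nonneg_nonneg) auto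
        then show ?thesis by (simp add: algebra_simps)
      qed
      also have "\<dots> \<le> (1 - x) * exp (2 * x)" using x by (intro mult_left_mono exp_ge_add_one_self) auto
      finally have ex: "exp (- 2 * x) \<le> 1 - x" by (simp add: exp_minus field_simps)
      have "(Y t + \<epsilon>) * exp (- 2 * x) \<le> (Y t + \<epsilon>) * (1 - x)"
        using ex Ynn[of t] st \<epsilon> by (intro mult_left_mono) auto
      also have "\<dots> \<le> Y s + \<epsilon>" using \<delta>1(2)[of s t] st by (simp add: x_def \<delta>_def algebra_simps)
      finally have "(Y t + \<epsilon>) * exp (- 2 * x) * exp (- 2 * \<Lambda> s) \<le> (Y s + \<epsilon>) * exp (- 2 * \<Lambda> s)"
        by (intro mult_right_mono) auto
      moreover have "exp (- 2 * x) * exp (- 2 * \<Lambda> s) = exp (- 2 * \<Lambda> t)"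
        by (simp add: x_def algebra_simps flip: exp_add)
      ultimately show ?thesis by (simp only: \<Phi>_def mult.assoc)
    qed
    have chain: "\<Phi> t \<le> \<Phi> 0" if "t \<in> {0..\<tau>}" "t \<le> real n * (\<delta> / 2)" for n t
      using that
    proof (induction n arbitrary: t)
      case 0
      then show ?case by simp
    next
      case (Suc n)
      define s where "s = max 0 (t - \<delta> / 2)"
      have "\<Phi> t \<le> \<Phi> s" using Suc.prems \<delta> by (intro step) (auto simp: s_def)
      also have "\<Phi> s \<le> \<Phi> 0"
        using Suc.prems \<delta> by (intro Suc.IH) (auto simp: s_def algebra_simps max_def)
      finally show ?case .
    qed
    obtain n :: nat where "t / (\<delta> / 2) < real n" using reals_Archimedean2 by blast
    then have "\<Phi> t \<le> \<Phi> 0" using chain[OF t, of n] \<delta> by (simp add: field_simps)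
    then have "(Y t + \<epsilon>) * exp (- 2 * \<Lambda> t) * exp (2 * \<Lambda> t) \<le> \<epsilon> * exp (- 2 * \<Lambda> 0) * exp (2 * \<Lambda> t)"
      by (intro mult_right_mono) (auto simp: \<Phi>_def Y0)
    then have "Y t + \<epsilon> \<le> \<epsilon> * exp (2 * (\<Lambda> t - \<Lambda> 0))"
      by (simp add: mult.assoc algebra_simps flip: exp_add)
    then show ?thesis using \<epsilon> by simp
  qed
  have "Y t \<le> 0"
  proof (rule field_le_epsilon)
    fix e :: real assume "e > 0"
    then show "Y t \<le> 0 + e" using bound[of "e / exp (2 * (\<Lambda> t - \<Lambda> 0))"] by simp
  qed
  then show ?thesis using Ynn[OF t] by simp
qed

section \<open>Weak solutions\<close>

context bounded_open
begin

lemma lipschitz_superposition: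
  assumes lip: "\<And>s t. \<bar>R s - R t\<bar> \<le> K * \<bar>s - t\<bar>" and K: "0 \<le> K"
    and g: "g \<in> L2 \<Omega>" and g': "g' \<in> L2 \<Omega>"
  shows "(\<lambda>x. R (g x)) \<in> L2 \<Omega>"
    and "L2_norm \<Omega> (\<lambda>x. R (g x) - R (g' x)) \<le> K * L2_norm \<Omega> (\<lambda>x. g x - g' x)"
proof -
  have "K-lipschitz_on UNIV R" using lip K by (intro lipschitz_onI) (auto simp: dist_real_def)
  then have [measurable]: "R \<in> borel_measurable borel"
    by (intro borel_measurable_continuous_onI lipschitz_on_continuous_on)
  note [measurable] = L2_measurable[OF g] L2_measurable[OF g']
  show "(\<lambda>x. R (g x)) \<in> L2 \<Omega>"
  proof (rule L2_bound)
    have "(\<lambda>x. \<bar>g x\<bar>) \<in> L2 \<Omega>" by (rule L2_bound[OF _ g]) auto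
    then show "(\<lambda>x. \<bar>R 0\<bar> + K * \<bar>g x\<bar>) \<in> L2 \<Omega>" by (rule L2_lincomb[OF const_in_L2])
    show "AE x in M. \<bar>R (g x)\<bar> \<le> \<bar>\<bar>R 0\<bar> + K * \<bar>g x\<bar>\<bar>"
    proof (rule AE_I2)
      fix x
      show "\<bar>R (g x)\<bar> \<le> \<bar>\<bar>R 0\<bar> + K * \<bar>g x\<bar>\<bar>" using lip[of "g x" 0] K by simp
    qed
  qed measurable
  have "L2_norm \<Omega> (\<lambda>x. R (g x) - R (g' x)) \<le> L2_norm \<Omega> (\<lambda>x. K * (g x - g' x))"
    using lip K by (intro L2_norm_mono L2_scale L2_diff g g') (auto simp: abs_mult)
  then show "L2_norm \<Omega> (\<lambda>x. R (g x) - R (g' x)) \<le> K * L2_norm \<Omega> (\<lambda>x. g x - g' x)"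
    using K by (simp add: L2_norm_scale)
qed

lemma C_time_L2_superposition:
  assumes lip: "\<And>s t. \<bar>R s - R t\<bar> \<le> K * \<bar>s - t\<bar>" and K: "0 \<le> K" and p: "p \<in> C_time_L2 T \<Omega>"
  shows "(\<lambda>t x. R (p t x)) \<in> C_time_L2 T \<Omega>"
  unfolding C_time_L2_def
proof (intro CollectI conjI ballI)
  note sup = lipschitz_superposition[of R K, OF lip K]
  fix t assume t: "t \<in> {0..<T}"
  show "(\<lambda>x. R (p t x)) \<in> L2 \<Omega>" using sup(1) C_time_L2_in_L2[OF p t] by blast
  show "((\<lambda>s. L2_norm \<Omega> (\<lambda>x. R (p s x) - R (p t x))) \<longlongrightarrow> 0) (at t within {0..<T})"
    by (rule Lim_null_comparison[OF _ tendsto_mult_right_zero[OF C_time_L2_tendsto[OF p t], of K]])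
      (use sup(2) C_time_L2_in_L2[OF p] t in \<open>auto simp: eventually_at_filter L2_norm_nonneg\<close>)
qed

text \<open>
  The source term of each equation collected into a single element of \<open>L\<^sup>2\<close>, which is possible since
  Lipschitz functions act on \<open>L\<^sup>2\<close> of a bounded set.
\<close>

lemma weak_solution_equations:
  assumes f: "\<And>s t. \<bar>f s - f t\<bar> \<le> M1 * \<bar>s - t\<bar>" and M1: "0 \<le> M1"
    and sol: "weak_solution \<Omega> T \<alpha> f a l u0 v0 u v" and h: "h \<in> H10 \<Omega>" and \<psi>: "test_function {0<..<T} \<psi>"
  shows "dist_deriv T (\<lambda>t. L2_inner \<Omega> (u t) h) \<psi> + dist_of T (\<lambda>t. a (l (u t)) * dirichlet (u t) h) \<psi>
      = dist_of T (\<lambda>t. L2_inner \<Omega> (\<lambda>x. \<alpha> * (u t x - v t x) - f (u t x - v t x)) h) \<psi>"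
    and "dist_deriv T (\<lambda>t. L2_inner \<Omega> (v t) h) \<psi> + dist_of T (\<lambda>t. a (l (v t)) * dirichlet (v t) h) \<psi>
      = dist_of T (\<lambda>t. L2_inner \<Omega> (\<lambda>x. f (u t x - v t x) - \<alpha> * (u t x - v t x)) h) \<psi>"
proof -
  have u: "u \<in> C_time_L2 T \<Omega>" and v: "v \<in> C_time_L2 T \<Omega>"
    using sol solution_space_C_time_L2 by (auto simp: weak_solution_def)
  have split: "L2_inner \<Omega> (\<lambda>x. \<alpha> * (u t x - v t x) - f (u t x - v t x)) h =
      - (LINT x|M. f (u t x - v t x) * h x) + (LINT x|M. \<alpha> * (u t x - v t x) * h x)"
    "L2_inner \<Omega> (\<lambda>x. f (u t x - v t x) - \<alpha> * (u t x - v t x)) h =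
      (LINT x|M. f (u t x - v t x) * h x) - (LINT x|M. \<alpha> * (u t x - v t x) * h x)"
    if "t \<in> {0<..<T}" for t
  proof -
    have t: "t \<in> {0..<T}" using that by simp
    have d: "(\<lambda>x. u t x - v t x) \<in> L2 \<Omega>" using C_time_L2_in_L2[OF u t] C_time_L2_in_L2[OF v t] by (rule L2_diff)
    note parts = lipschitz_superposition(1)[of f, OF f M1 d d] L2_scale[OF d, of \<alpha>]
    show "L2_inner \<Omega> (\<lambda>x. f (u t x - v t x) - \<alpha> * (u t x - v t x)) h =
      (LINT x|M. f (u t x - v t x) * h x) - (LINT x|M. \<alpha> * (u t x - v t x) * h x)"
      using L2_inner_diff_left[OF parts H10_L2[OF h]] by (simp add: L2_inner_def)
    show "L2_inner \<Omega> (\<lambda>x. \<alpha> * (u t x - v t x) - f (u t x - v t x)) h =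
      - (LINT x|M. f (u t x - v t x) * h x) + (LINT x|M. \<alpha> * (u t x - v t x) * h x)"
      using L2_inner_diff_left[OF parts(2,1) H10_L2[OF h]] by (simp add: L2_inner_def)
  qed
  have cong: "dist_of T F \<psi> = dist_of T G \<psi>" if "\<And>t. t \<in> {0<..<T} \<Longrightarrow> F t = G t" for F G
    unfolding dist_of_def using that by (intro Bochner_Integration.integral_cong) auto
  note eqs = sol[unfolded weak_solution_def, THEN conjunct2, THEN conjunct2, THEN conjunct2, THEN conjunct2,
      THEN conjunct2, THEN conjunct2, rule_format, OF h h \<psi>]
  show "dist_deriv T (\<lambda>t. L2_inner \<Omega> (u t) h) \<psi> + dist_of T (\<lambda>t. a (l (u t)) * dirichlet (u t) h) \<psi>
      = dist_of T (\<lambda>t. L2_inner \<Omega> (\<lambda>x. \<alpha> * (u t x - v t x) - f (u t x - v t x)) h) \<psi>"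
    unfolding dirichlet_def eqs[THEN conjunct1] by (rule cong) (simp add: split)
  show "dist_deriv T (\<lambda>t. L2_inner \<Omega> (v t) h) \<psi> + dist_of T (\<lambda>t. a (l (v t)) * dirichlet (v t) h) \<psi>
      = dist_of T (\<lambda>t. L2_inner \<Omega> (\<lambda>x. f (u t x - v t x) - \<alpha> * (u t x - v t x)) h) \<psi>"
    unfolding dirichlet_def eqs[THEN conjunct2] by (rule cong) (simp add: split)
qed

text \<open>
  A nonzero \<open>z(t)\<close> would stay nonzero on a time interval, but at almost every time of that interval
  \<open>z\<close> is in \<open>H\<^sub>0\<^sup>1\<close>, where vanishing dual energy forces \<open>z = 0\<close>.
\<close>

lemma L2_norm_zero_of_dual_energy_zero:
  assumes z: "z \<in> C_time_L2 T \<Omega>" and H10: "AE r in lebesgue_on {0<..<T}. z r \<in> H10 \<Omega>"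
    and E: "\<And>t. t \<in> {0..<T} \<Longrightarrow> dual_energy (z t) = 0" and t: "t \<in> {0..<T}"
  shows "L2_norm \<Omega> (z t) = 0"
proof (rule ccontr)
  assume "L2_norm \<Omega> (z t) \<noteq> 0"
  then have "0 < L2_norm \<Omega> (z t)" using L2_norm_nonneg[of \<Omega> "z t"] by simp
  moreover have "((\<lambda>s. L2_norm \<Omega> (z s)) \<longlongrightarrow> L2_norm \<Omega> (z t)) (at t within {0..<T})"
    using continuous_on_L2_norm_time[OF z] t by (simp add: continuous_on_def)
  ultimately have "\<forall>\<^sub>F s in at t within {0..<T}. 0 < L2_norm \<Omega> (z s)"
    by (rule order_tendstoD(1)[rotated])
  then obtain d where d: "d > 0" "\<And>s. s \<in> {0..<T} \<Longrightarrow> s \<noteq> t \<Longrightarrow> dist s t < d \<Longrightarrow> 0 < L2_norm \<Omega> (z s)"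
    unfolding eventually_at by blast
  define J where "J = {t<..<min (t + d) T}"
  have J: "J \<subseteq> {0<..<T}" using t by (auto simp: J_def)
  have "AE r in lebesgue_on {0<..<T}. r \<notin> J"
    using H10
  proof eventually_elim
    case (elim r)
    show ?case
    proof
      assume r: "r \<in> J"
      then have "r \<in> {0..<T}" using J by auto
      then have "L2_norm \<Omega> (z r) = 0" using dual_energy_eq_0_imp[OF elim] E by simp
      moreover have "0 < L2_norm \<Omega> (z r)"
        using d(2)[of r] r \<open>r \<in> {0..<T}\<close> by (simp add: J_def dist_real_def)
      ultimately show False by simp
    qed
  qed
  then have "AE r in lebesgue. r \<notin> J"
    using J by (auto simp: AE_restrict_space_iff elim!: eventually_mono)
  then have "negligible J"
    by (simp add: AE_iff_null_sets negligible_iff_null_sets J_def)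
  moreover have "J \<noteq> {}" using d(1) t dense[of t "min (t + d) T"] by (auto simp: J_def)
  ultimately show False
    using open_not_negligible[of J] by (simp add: J_def)
qed

lemma continuous_on_nonlocal_coefficient:
  assumes l: "continuous_linear_form (L2 \<Omega>) (L2_norm \<Omega>) l"
    and L: "\<And>g. g \<in> L2 \<Omega> \<Longrightarrow> \<bar>l g\<bar> \<le> L * L2_norm \<Omega> g"
    and a: "\<And>s t. \<bar>a s - a t\<bar> \<le> M2 * \<bar>s - t\<bar>" and M2: "0 \<le> M2"
  shows "g \<in> L2 \<Omega> \<Longrightarrow> h \<in> L2 \<Omega> \<Longrightarrow> \<bar>a (l g) - a (l h)\<bar> \<le> M2 * L * L2_norm \<Omega> (\<lambda>x. g x - h x)"
    and "p \<in> C_time_L2 T \<Omega> \<Longrightarrow> continuous_on {0..<T} (\<lambda>t. a (l (p t)))"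
proof -
  show mod: "\<bar>a (l g) - a (l h)\<bar> \<le> M2 * L * L2_norm \<Omega> (\<lambda>x. g x - h x)" if g: "g \<in> L2 \<Omega>" and h: "h \<in> L2 \<Omega>" for g h
  proof -
    have add: "l (\<lambda>x. g x + k x) = l g + l k" if "k \<in> L2 \<Omega>" for k
      using l g that by (simp add: continuous_linear_form_def)
    have neg: "l (\<lambda>x. - 1 * h x) = - 1 * l h"
      using l h unfolding continuous_linear_form_def by blast
    have "l (\<lambda>x. g x - h x) = l g - l h"
      using add[OF L2_scale[OF h, of "- 1"]] neg by simp
    then have "\<bar>l g - l h\<bar> \<le> L * L2_norm \<Omega> (\<lambda>x. g x - h x)" using L[OF L2_diff[OF g h]] by simp
    then have "M2 * \<bar>l g - l h\<bar> \<le> M2 * (L * L2_norm \<Omega> (\<lambda>x. g x - h x))" using M2 by (rule mult_left_mono)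
    then show ?thesis using a[of "l g" "l h"] by simp
  qed
  show "continuous_on {0..<T} (\<lambda>t. a (l (p t)))" if p: "p \<in> C_time_L2 T \<Omega>"
    using mod C_time_L2_in_L2[OF p] by (intro continuous_on_of_L2_modulus[OF p, where C = "M2 * L"]) auto
qed

lemma weak_solutions_dual_energy_zero:
  fixes u v u' v' :: "real \<Rightarrow> 'a \<Rightarrow> real"
  defines "z \<equiv> \<lambda>t x. u t x - u' t x" and "w \<equiv> \<lambda>t x. v t x - v' t x"
  assumes \<alpha>: "0 \<le> \<alpha>" and M1: "0 \<le> M1" and M2: "0 \<le> M2" and m: "0 < m"
    and f: "\<And>s t. \<bar>f s - f t\<bar> \<le> M1 * \<bar>s - t\<bar>"
    and a: "\<And>s t. \<bar>a s - a t\<bar> \<le> M2 * \<bar>s - t\<bar>" and am: "\<And>\<xi>. m \<le> a \<xi>"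
    and l: "continuous_linear_form (L2 \<Omega>) (L2_norm \<Omega>) l"
    and sol: "weak_solution \<Omega> T \<alpha> f a l u0 v0 u v" and sol': "weak_solution \<Omega> T \<alpha> f a l u0 v0 u' v'"
    and \<tau>: "0 \<le> \<tau>" "\<tau> < T"
  shows "dual_energy (z \<tau>) = 0" and "dual_energy (w \<tau>) = 0"
proof -
  let ?M = "lebesgue_on {0<..<T}"
  have sp: "u \<in> solution_space T \<Omega>" "v \<in> solution_space T \<Omega>" "u' \<in> solution_space T \<Omega>" "v' \<in> solution_space T \<Omega>"
    using sol sol' by (auto simp: weak_solution_def)
  note ct = sp[THEN solution_space_C_time_L2]
  note L2t = ct[THEN C_time_L2_in_L2]
  obtain L where L: "0 \<le> L" "\<And>g. g \<in> L2 \<Omega> \<Longrightarrow> \<bar>l g\<bar> \<le> L * L2_norm \<Omega> g"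
    using continuous_linear_form_bounded[OF l] by blast
  have coeff: "g \<in> L2 \<Omega> \<Longrightarrow> h \<in> L2 \<Omega> \<Longrightarrow> \<bar>a (l g) - a (l h)\<bar> \<le> M2 * L * L2_norm \<Omega> (\<lambda>x. g x - h x)"
    "p \<in> C_time_L2 T \<Omega> \<Longrightarrow> continuous_on {0..<T} (\<lambda>t. a (l (p t)))" for g h p
    using continuous_on_nonlocal_coefficient[of l L a M2] l L(2) a M2 by blast+
  define K where "K = M1 + \<alpha>"
  have K0: "0 \<le> K" using M1 \<alpha> by (simp add: K_def)
  have zC: "z \<in> C_time_L2 T \<Omega>" and wC: "w \<in> C_time_L2 T \<Omega>"
    unfolding z_def w_def using ct by (auto intro: C_time_L2_diff)
  have zL2: "z t \<in> L2 \<Omega>" "w t \<in> L2 \<Omega>" if "t \<in> {0..<T}" for t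
    using C_time_L2_in_L2 zC wC that by auto
  define Z where "Z t = L2_norm \<Omega> (z t)" for t
  define W where "W t = L2_norm \<Omega> (w t)" for t
  have Zc: "continuous_on {0..<T} Z" and Wc: "continuous_on {0..<T} W"
    unfolding Z_def W_def using continuous_on_L2_norm_time zC wC by auto
  have ZW0: "0 \<le> Z t" "0 \<le> W t" for t by (simp_all add: Z_def W_def L2_norm_nonneg)

  \<comment> \<open>the source is \<open>R (u - v)\<close> in the equation for \<open>u\<close> and \<open>- R (u - v)\<close> in the one for \<open>v\<close>\<close>
  define R where "R s = \<alpha> * s - f s" for s
  have Rlip: "\<bar>R s - R t\<bar> \<le> K * \<bar>s - t\<bar>" for s t
  proof -
    have "\<bar>R s - R t\<bar> = \<bar>\<alpha> * (s - t) - (f s - f t)\<bar>" by (simp add: R_def algebra_simps)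
    also have "\<dots> \<le> \<bar>\<alpha> * (s - t)\<bar> + \<bar>f s - f t\<bar>" by (rule abs_triangle_ineq4)
    also have "\<bar>\<alpha> * (s - t)\<bar> = \<alpha> * \<bar>s - t\<bar>" using \<alpha> by (simp add: abs_mult)
    also have "\<alpha> * \<bar>s - t\<bar> + \<bar>f s - f t\<bar> \<le> K * \<bar>s - t\<bar>" using f[of s t] by (simp add: K_def distrib_right)
    finally show ?thesis .
  qed
  have Rlip': "\<bar>- R s - - R t\<bar> \<le> K * \<bar>s - t\<bar>" for s t
    using Rlip[of s t] by (simp add: abs_minus_commute)
  have q: "(\<lambda>t x. R (u t x - v t x)) \<in> C_time_L2 T \<Omega>" "(\<lambda>t x. R (u' t x - v' t x)) \<in> C_time_L2 T \<Omega>"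
    "(\<lambda>t x. - R (u t x - v t x)) \<in> C_time_L2 T \<Omega>" "(\<lambda>t x. - R (u' t x - v' t x)) \<in> C_time_L2 T \<Omega>"
    using C_time_L2_superposition[of R K, OF Rlip K0] C_time_L2_superposition[of "\<lambda>s. - R s" K, OF Rlip' K0]
      C_time_L2_diff[OF ct(1,2)] C_time_L2_diff[OF ct(3,4)] by auto
  have q_diff: "L2_norm \<Omega> (\<lambda>x. R (u t x - v t x) - R (u' t x - v' t x)) \<le> K * (Z t + W t)" if t: "t \<in> {0..<T}" for t
  proof -
    have "L2_norm \<Omega> (\<lambda>x. R (u t x - v t x) - R (u' t x - v' t x))
        \<le> K * L2_norm \<Omega> (\<lambda>x. (u t x - v t x) - (u' t x - v' t x))"
      using lipschitz_superposition(2)[of R K, OF Rlip K0 L2_diff[OF L2t(1)[OF t] L2t(2)[OF t]] L2_diff[OF L2t(3)[OF t] L2t(4)[OF t]]] .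
    also have "(\<lambda>x. (u t x - v t x) - (u' t x - v' t x)) = (\<lambda>x. z t x - w t x)"
      by (auto simp: z_def w_def)
    also have "K * L2_norm \<Omega> (\<lambda>x. z t x - w t x) \<le> K * (Z t + W t)"
      using L2_norm_diff_le[OF zL2(1)[OF t] zL2(2)[OF t]] K0 by (intro mult_left_mono) (auto simp: Z_def W_def)
    finally show ?thesis .
  qed
  have q_diff': "L2_norm \<Omega> (\<lambda>x. - R (u t x - v t x) - - R (u' t x - v' t x)) \<le> K * (W t + Z t)" if t: "t \<in> {0..<T}" for t
  proof -
    have "L2_norm \<Omega> (\<lambda>x. - 1 * (R (u t x - v t x) - R (u' t x - v' t x))) \<le> K * (Z t + W t)"
      unfolding L2_norm_scale using q_diff[OF t] by simp
    then show ?thesis by (simp add: add.commute)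
  qed
  have eqs: "dist_deriv T (\<lambda>t. L2_inner \<Omega> (u t) h) \<psi> + dist_of T (\<lambda>t. a (l (u t)) * dirichlet (u t) h) \<psi>
      = dist_of T (\<lambda>t. L2_inner \<Omega> (\<lambda>x. R (u t x - v t x)) h) \<psi>"
    "dist_deriv T (\<lambda>t. L2_inner \<Omega> (v t) h) \<psi> + dist_of T (\<lambda>t. a (l (v t)) * dirichlet (v t) h) \<psi>
      = dist_of T (\<lambda>t. L2_inner \<Omega> (\<lambda>x. - R (u t x - v t x)) h) \<psi>"
    "dist_deriv T (\<lambda>t. L2_inner \<Omega> (u' t) h) \<psi> + dist_of T (\<lambda>t. a (l (u' t)) * dirichlet (u' t) h) \<psi>
      = dist_of T (\<lambda>t. L2_inner \<Omega> (\<lambda>x. R (u' t x - v' t x)) h) \<psi>"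
    "dist_deriv T (\<lambda>t. L2_inner \<Omega> (v' t) h) \<psi> + dist_of T (\<lambda>t. a (l (v' t)) * dirichlet (v' t) h) \<psi>
      = dist_of T (\<lambda>t. L2_inner \<Omega> (\<lambda>x. - R (u' t x - v' t x)) h) \<psi>"
    if "h \<in> H10 \<Omega>" "test_function {0<..<T} \<psi>" for h \<psi>
    using weak_solution_equations[of f M1, OF f M1 sol that] weak_solution_equations[of f M1, OF f M1 sol' that]
    by (simp_all add: R_def)

  \<comment> \<open>constants that hold on \<open>[0,\<tau>]\<close>; the coefficients may be unbounded near \<open>T\<close>\<close>
  obtain B1 where B1: "0 < B1" "\<And>r. 0 \<le> r \<Longrightarrow> r \<le> \<tau> \<Longrightarrow> \<bar>a (l (u r))\<bar> \<le> B1"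
    using continuous_bounded_until[OF coeff(2)[OF ct(1)] \<tau>(2)] by blast
  obtain B2 where B2: "0 < B2" "\<And>r. 0 \<le> r \<Longrightarrow> r \<le> \<tau> \<Longrightarrow> \<bar>a (l (v r))\<bar> \<le> B2"
    using continuous_bounded_until[OF coeff(2)[OF ct(2)] \<tau>(2)] by blast
  obtain C where C: "0 < C" "\<And>r. 0 \<le> r \<Longrightarrow> r \<le> \<tau> \<Longrightarrow> \<bar>Z r + W r\<bar> \<le> C"
    using continuous_bounded_until[OF continuous_on_add[OF Zc Wc] \<tau>(2)] by blast
  define B where "B = max B1 B2"
  have B: "0 < B" "\<And>r. 0 \<le> r \<Longrightarrow> r \<le> \<tau> \<Longrightarrow> a (l (u r)) \<le> B" "\<And>r. 0 \<le> r \<Longrightarrow> r \<le> \<tau> \<Longrightarrow> a (l (v r)) \<le> B"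
    using B1 B2 by (fastforce simp: B_def)+
  define \<Lambda> where "\<Lambda> = M2 * L"
  have \<Lambda>0: "0 \<le> \<Lambda>" using M2 L(1) by (simp add: \<Lambda>_def)
  define \<mu> where "\<mu> p r = ((B + K)\<^sup>2 + \<Lambda>\<^sup>2 * (H1_norm \<Omega> (p r))\<^sup>2) / m + K\<^sup>2 / (2 * m)" for p :: "real \<Rightarrow> 'a \<Rightarrow> real" and r
  have \<mu>0: "0 \<le> \<mu> p r" for p r using m by (simp add: \<mu>_def)
  interpret time: finite_measure ?M by (rule finite_measure_time)
  have \<mu>_loc: "locally_integrable T (\<mu> p)" if "p \<in> solution_space T \<Omega>" for p
    unfolding \<mu>_def using solution_space_H1_norm_square[OF that]
    by (intro integrable_imp_locally_integrable) simp
  \<comment> \<open>the factor \<open>4\<close> is that in the bound of near maximizers; the summand \<open>1\<close> lets \<open>\<nu>\<close> dominate the error \<open>\<epsilon>\<close>\<close>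
  define \<nu> where "\<nu> r = 4 * (\<mu> u' r + \<mu> v' r) + 1" for r
  have \<nu>i: "integrable ?M \<nu>"
    unfolding \<nu>_def \<mu>_def using sp[THEN solution_space_H1_norm_square] by simp
  define N where "N t = (LINT r|?M. indicator {0<..t} r * \<nu> r)" for t
  have N_diff: "N t - N s = (LINT r|?M. indicator {s<..t} r * \<nu> r)" if "0 \<le> s" "s \<le> t" for s t
  proof -
    have "indicator {0<..t} r * \<nu> r - indicator {0<..s} r * \<nu> r = indicator {s<..t} r * \<nu> r" for r
      using that by (auto simp: indicator_def)
    then show ?thesis
      unfolding N_def using Bochner_Integration.integral_diff[OF integrable_indicator_interval[OF \<nu>i] integrable_indicator_interval[OF \<nu>i], of 0 t 0 s]
      by simp
  qed
  define Y where "Y t = dual_energy (z t) + dual_energy (w t)" for t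
  have Y0: "0 \<le> dual_energy (z t)" "0 \<le> dual_energy (w t)" if "t \<in> {0..<T}" for t
    using dual_energy_nonneg zL2[OF that] by auto
  have "Y \<tau> = 0"
  proof (rule gronwall_local_increment[where Y = Y and \<Lambda> = N and \<tau> = \<tau>])
    show "continuous_on {0..\<tau>} N" unfolding N_def by (rule continuous_on_integral_upto[OF \<nu>i])
    show "mono_on {0..\<tau>} N"
    proof (rule mono_onI)
      fix s t assume st: "s \<in> {0..\<tau>}" "t \<in> {0..\<tau>}" "s \<le> t"
      have "0 \<le> N t - N s"
        using st \<mu>0 by (subst N_diff) (auto simp: \<nu>_def intro!: integral_nonneg_AE add_nonneg_nonneg)
      then show "N s \<le> N t" by simp
    qed
    show "Y 0 = 0"
    proof -
      have "AE x in M. z 0 x = 0" "AE x in M. w 0 x = 0"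
        using sol sol' unfolding weak_solution_def z_def w_def by auto
      then have "L2_norm \<Omega> (z 0) = 0" "L2_norm \<Omega> (w 0) = 0"
        using L2_norm_eq_0_iff zL2[of 0] \<tau> by auto
      then have "dual_energy (z 0) \<le> 0" "dual_energy (w 0) \<le> 0"
        using dual_energy_le[OF zL2(1)[of 0]] dual_energy_le[OF zL2(2)[of 0]] \<tau> by auto
      then show ?thesis using Y0[of 0] \<tau> by (simp add: Y_def)
    qed
    show "0 \<le> Y t" if "t \<in> {0..\<tau>}" for t using Y0[of t] that \<tau> by (simp add: Y_def)
    show "\<tau> \<in> {0..\<tau>}" using \<tau> by simp
    fix \<epsilon> :: real assume \<epsilon>: "0 < \<epsilon>"
    \<comment> \<open>the error \<open>B \<eta> (Z + W)\<close> of the two energy estimates is then at most \<open>\<epsilon>\<close>\<close>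
    define \<eta> where "\<eta> = \<epsilon> / (B * C)"
    have \<eta>: "0 < \<eta>" "B * \<eta> * C = \<epsilon>" using \<epsilon> B(1) C(1) by (auto simp: \<eta>_def)
    obtain \<delta>1 where \<delta>1: "\<delta>1 > 0" "\<And>s t. s \<in> {0..\<tau>} \<Longrightarrow> t \<in> {0..\<tau>} \<Longrightarrow> \<bar>s - t\<bar> < \<delta>1 \<Longrightarrow> L2_norm \<Omega> (\<lambda>x. z t x - z s x) \<le> \<eta>"
      using C_time_L2_uniformly_continuous[OF zC \<tau>(2) \<eta>(1)] by blast
    obtain \<delta>2 where \<delta>2: "\<delta>2 > 0" "\<And>s t. s \<in> {0..\<tau>} \<Longrightarrow> t \<in> {0..\<tau>} \<Longrightarrow> \<bar>s - t\<bar> < \<delta>2 \<Longrightarrow> L2_norm \<Omega> (\<lambda>x. w t x - w s x) \<le> \<eta>"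
      using C_time_L2_uniformly_continuous[OF wC \<tau>(2) \<eta>(1)] by blast
    have "Y t - Y s \<le> (Y t + \<epsilon>) * (N t - N s)"
      if st: "0 \<le> s" "s \<le> t" "t \<le> \<tau>" "t - s < min \<delta>1 \<delta>2" for s t
    proof -
      have tT: "t < T" using st \<tau> by simp
      have rT: "r \<in> {0..<T}" "0 \<le> r" "r \<le> \<tau>" if "r \<in> {s<..t}" for r using that st \<tau> by auto
      define I where "I G = (LINT r|?M. indicator {s<..t} r * G r)" for G :: "real \<Rightarrow> real"
      define F where "F P Q e p r = m / 2 * (Q r)\<^sup>2 - m / 2 * (P r)\<^sup>2 + 4 * e * \<mu> p r + B * \<eta> * P r"
        for P Q :: "real \<Rightarrow> real" and e :: real and p :: "real \<Rightarrow> 'a \<Rightarrow> real" and r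
      have z_step: "dual_energy (z t) - dual_energy (z s) \<le> I (F Z W (dual_energy (z t)) u')"
      proof -
        have A_diff: "\<bar>a (l (u r)) - a (l (u' r))\<bar> \<le> \<Lambda> * L2_norm \<Omega> (\<lambda>x. u r x - u' r x)" if "r \<in> {s<..t}" for r
          unfolding \<Lambda>_def using coeff(1)[OF L2t(1,3)] rT(1)[OF that] by blast
        have close: "L2_norm \<Omega> (\<lambda>x. u t x - u' t x - (u r x - u' r x)) \<le> \<eta>" if "r \<in> {s<..t}" for r
          using \<delta>1(2)[of r t] that st by (auto simp: z_def)
        show ?thesis
          unfolding I_def F_def \<mu>_def Z_def z_def
          by (rule dual_energy_increment[OF sp(1) sp(3) coeff(2)[OF ct(1)] coeff(2)[OF ct(3)] Wc q(1,2) eqs(1,3)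
              m K0 \<Lambda>0 st(1,2) tT am B(2)[OF rT(2,3)] A_diff ZW0(2) q_diff[OF rT(1), unfolded Z_def z_def]
              less_imp_le[OF \<eta>(1)] close])
      qed
      have w_step: "dual_energy (w t) - dual_energy (w s) \<le> I (F W Z (dual_energy (w t)) v')"
      proof -
        have A_diff: "\<bar>a (l (v r)) - a (l (v' r))\<bar> \<le> \<Lambda> * L2_norm \<Omega> (\<lambda>x. v r x - v' r x)" if "r \<in> {s<..t}" for r
          unfolding \<Lambda>_def using coeff(1)[OF L2t(2,4)] rT(1)[OF that] by blast
        have close: "L2_norm \<Omega> (\<lambda>x. v t x - v' t x - (v r x - v' r x)) \<le> \<eta>" if "r \<in> {s<..t}" for r
          using \<delta>2(2)[of r t] that st by (auto simp: w_def)
        show ?thesis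
          unfolding I_def F_def \<mu>_def W_def w_def
          by (rule dual_energy_increment[OF sp(2) sp(4) coeff(2)[OF ct(2)] coeff(2)[OF ct(4)] Zc q(3,4) eqs(2,4)
              m K0 \<Lambda>0 st(1,2) tT am B(3)[OF rT(2,3)] A_diff ZW0(1) q_diff'[OF rT(1), unfolded W_def w_def]
              less_imp_le[OF \<eta>(1)] close])
      qed
      have F_loc: "locally_integrable T (F P Q e p)"
        if "continuous_on {0..<T} P" "continuous_on {0..<T} Q" "locally_integrable T (\<mu> p)" for P Q e p
      proof -
        have "locally_integrable T (\<lambda>r. (m / 2 * (Q r)\<^sup>2 - m / 2 * (P r)\<^sup>2 + B * \<eta> * P r) + 4 * e * \<mu> p r)"
          by (intro locally_integrable_add locally_integrable_continuous continuous_intros that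
              locally_integrable_mult_continuous[OF continuous_on_const])
        then show ?thesis by (simp add: F_def[abs_def] algebra_simps)
      qed
      note int = locally_integrableD[OF _ st(1) tT]
      note zi = int[OF F_loc[OF Zc Wc \<mu>_loc[OF sp(3)]], of "dual_energy (z t)"]
      note wi = int[OF F_loc[OF Wc Zc \<mu>_loc[OF sp(4)]], of "dual_energy (w t)"]
      have "Y t - Y s \<le> I (F Z W (dual_energy (z t)) u') + I (F W Z (dual_energy (w t)) v')"
        using z_step w_step by (simp add: Y_def)
      also have "\<dots> = (LINT r|?M. indicator {s<..t} r * F Z W (dual_energy (z t)) u' r
          + indicator {s<..t} r * F W Z (dual_energy (w t)) v' r)"
        unfolding I_def using zi wi by (rule Bochner_Integration.integral_add[symmetric])
      also have "\<dots> \<le> (LINT r|?M. (Y t + \<epsilon>) * (indicator {s<..t} r * \<nu> r))"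
      proof (rule integral_mono_AE)
        show "AE r in ?M. indicator {s<..t} r * F Z W (dual_energy (z t)) u' r
          + indicator {s<..t} r * F W Z (dual_energy (w t)) v' r \<le> (Y t + \<epsilon>) * (indicator {s<..t} r * \<nu> r)"
        proof (rule AE_I2)
          fix r
          show "indicator {s<..t} r * F Z W (dual_energy (z t)) u' r
            + indicator {s<..t} r * F W Z (dual_energy (w t)) v' r \<le> (Y t + \<epsilon>) * (indicator {s<..t} r * \<nu> r)"
          proof (cases "r \<in> {s<..t}")
            case r: True
            have e0: "0 \<le> dual_energy (z t)" "0 \<le> dual_energy (w t)" using Y0[of t] st \<tau> by auto
            have "B * \<eta> * (Z r + W r) \<le> B * \<eta> * C"
              using C(2)[OF rT(2,3)[OF r]] B(1) \<eta>(1) by (intro mult_left_mono) auto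
            then have "F Z W (dual_energy (z t)) u' r + F W Z (dual_energy (w t)) v' r
                \<le> 4 * (dual_energy (z t) * \<mu> u' r) + 4 * (dual_energy (w t) * \<mu> v' r) + \<epsilon>"
              using \<eta>(2) by (simp add: F_def algebra_simps)
            also have "\<dots> \<le> 4 * (Y t * \<mu> u' r) + 4 * (Y t * \<mu> v' r) + \<epsilon>"
              using e0 \<mu>0 by (intro add_mono mult_left_mono mult_right_mono) (auto simp: Y_def)
            also have "\<dots> \<le> (Y t + \<epsilon>) * \<nu> r"
            proof -
              have "0 \<le> Y t + \<epsilon> * (4 * (\<mu> u' r + \<mu> v' r))"
                using e0 \<mu>0 \<epsilon> by (simp add: Y_def)
              then show ?thesis by (simp add: \<nu>_def algebra_simps)
            qed
            finally show ?thesis using r by simp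
          qed simp
        qed
      qed (use zi wi integrable_indicator_interval[OF \<nu>i] in auto)
      also have "\<dots> = (Y t + \<epsilon>) * (N t - N s)" using st by (simp add: N_diff)
      finally show ?thesis .
    qed
    then show "\<exists>\<delta>>0. \<forall>s t. 0 \<le> s \<longrightarrow> s \<le> t \<longrightarrow> t \<le> \<tau> \<longrightarrow> t - s < \<delta> \<longrightarrow> Y t - Y s \<le> (Y t + \<epsilon>) * (N t - N s)"
      using \<delta>1(1) \<delta>2(1) by (intro exI[of _ "min \<delta>1 \<delta>2"]) auto
  qed
  then show "dual_energy (z \<tau>) = 0" "dual_energy (w \<tau>) = 0"
    using Y0[of \<tau>] \<tau> by (auto simp: Y_def)
qed

end

theorem theorem1p2:
  fixes \<Omega> :: "(real ^ 'n) set"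
    and T \<alpha> M1 M2 m :: real
    and f a :: "real \<Rightarrow> real"
    and l :: "(real ^ 'n \<Rightarrow> real) \<Rightarrow> real"
    and u0 v0 :: "real ^ 'n \<Rightarrow> real"
    and u v u' v' :: "real \<Rightarrow> real ^ 'n \<Rightarrow> real"
  assumes "bounded_C2_domain \<Omega>"
    and "\<alpha> > 0" and "M1 > 0" and "M2 > 0" and "m > 0" and "T > 0"
    and "u0 \<in> L2 \<Omega>" and "v0 \<in> L2 \<Omega>"
    and "\<forall>s t. \<bar>f s - f t\<bar> \<le> M1 * \<bar>s - t\<bar>"
    and "\<forall>s t. \<bar>a s - a t\<bar> \<le> M2 * \<bar>s - t\<bar>"
    and "\<forall>\<xi>. a \<xi> \<ge> m"
    and "continuous_linear_form (L2 \<Omega>) (L2_norm \<Omega>) l"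
    and "weak_solution \<Omega> T \<alpha> f a l u0 v0 u v"
    and "weak_solution \<Omega> T \<alpha> f a l u0 v0 u' v'"
  shows "\<forall>t\<in>{0..<T}. AE x in lebesgue_on \<Omega>. u t x = u' t x \<and> v t x = v' t x"
proof -
  interpret bounded_open \<Omega>
    using assms(1) by unfold_locales (auto simp: bounded_C2_domain_def)
  let ?z = "\<lambda>t x. u t x - u' t x" and ?w = "\<lambda>t x. v t x - v' t x"
  have sp: "u \<in> solution_space T \<Omega>" "v \<in> solution_space T \<Omega>" "u' \<in> solution_space T \<Omega>" "v' \<in> solution_space T \<Omega>"
    using assms(13,14) by (auto simp: weak_solution_def)
  note ct = sp[THEN solution_space_C_time_L2]
  have zC: "?z \<in> C_time_L2 T \<Omega>" and wC: "?w \<in> C_time_L2 T \<Omega>"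
    using ct by (auto intro: C_time_L2_diff)
  have H10: "AE r in lebesgue_on {0<..<T}. ?z r \<in> H10 \<Omega>" "AE r in lebesgue_on {0<..<T}. ?w r \<in> H10 \<Omega>"
    using solution_space_H10[OF sp(1)] solution_space_H10[OF sp(3)] solution_space_H10[OF sp(2)] solution_space_H10[OF sp(4)]
    by (eventually_elim, simp add: H10_diff)+
  have energy: "dual_energy (?z t) = 0" "dual_energy (?w t) = 0" if "t \<in> {0..<T}" for t
    using weak_solutions_dual_energy_zero[of \<alpha> M1 M2 m f a l T u0 v0 u v u' v' t] assms that by auto
  have "AE x in lebesgue_on \<Omega>. u t x = u' t x \<and> v t x = v' t x" if t: "t \<in> {0..<T}" for t
  proof -
    have "L2_norm \<Omega> (?z t) = 0" by (rule L2_norm_zero_of_dual_energy_zero[OF zC H10(1) energy(1) t])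
    moreover have "L2_norm \<Omega> (?w t) = 0" by (rule L2_norm_zero_of_dual_energy_zero[OF wC H10(2) energy(2) t])
    ultimately have "AE x in lebesgue_on \<Omega>. u t x - u' t x = 0" "AE x in lebesgue_on \<Omega>. v t x - v' t x = 0"
      using L2_norm_eq_0_iff[OF C_time_L2_in_L2[OF zC t]] L2_norm_eq_0_iff[OF C_time_L2_in_L2[OF wC t]] by blast+
    then show ?thesis by eventually_elim simp
  qed
  then show ?thesis by blast
qed

end
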